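(* $\mathsf{ZP}_\tau\mathsf{CL}=\mathsf{ZP}_\tau\mathsf{CL}\mathsf{P}$.
   Context: A catalytic-type machine has a read-only input tape, a write-only output tape, a read-write work tape and a read-write catalytic tape initially holding an arbitrary string $\tau$. $L\in\mathsf{ZP}_\tau\mathsf{CSPACE}[s,c]$ if some deterministic such machine with work space $s$ and catalytic space $c$ always halts with its initial catalytic content $\tau$ restored, and on every input $x$ outputs either $L(x)$ or a special symbol $\perp$ (never the wrong answer), outputting $L(x)$ for at least half of all initial tapes $\tau\in\{0,1\}^c$. $\mathsf{ZP}_\tau\mathsf{CL}=\bigcup_{k}\mathsf{ZP}_\tau\mathsf{CSPACE}[k\log n,n^k]$, and $\mathsf{ZP}_\tau\mathsf{CL}\mathsf{P}$ is the subclass where for some $k$ the machine (with $k\log n$ work bits and $n^k$ catalytic bits) additionally always halts within $n^k$ steps. *)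

theory Defs
  imports Complex_Main
begin

text \<open>Deterministic machines with a read-only input tape, a read-write binary work
tape of a prescribed length, a read-write binary catalytic tape of a prescribed
length, and a write-only output of a single symbol (0, 1 or \<open>\<bottom>\<close>, modelled as
\<open>Some False\<close>, \<open>Some True\<close>, \<open>None\<close>) produced when the machine halts.
Every tape is delimited by end markers: a tape with contents \<open>xs\<close> has head positions
\<open>0 .. length xs + 1\<close>; positions \<open>0\<close> and \<open>length xs + 1\<close> hold end markers (read as
\<open>None\<close>), cell \<open>i\<close> (for \<open>1 \<le> i \<le> length xs\<close>) holds \<open>xs ! (i - 1)\<close>.
Heads cannot move beyond the end markers, and writing on an end marker has no effect.
States are natural numbers below \<open>nstates\<close>; \<open>0\<close> is the start state.\<close>

datatype dir = Lft | Stay | Rgt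

datatype act =
    Halt "bool option"
  | Step nat bool bool dir dir dir
    (* new state, bit written on work tape, bit written on catalytic tape,
       moves of input head, work head, catalytic head *)

record machine =
  nstates :: nat
  delta :: "nat \<Rightarrow> bool option \<Rightarrow> bool option \<Rightarrow> bool option \<Rightarrow> act"
    (* state, input symbol, work symbol, catalytic symbol *)

definition wf_machine :: "machine \<Rightarrow> bool" where
  "wf_machine M \<longleftrightarrow> 0 < nstates M \<and>
     (\<forall>q a b c q' w k d1 d2 d3. q < nstates M \<longrightarrow>
        delta M q a b c = Step q' w k d1 d2 d3 \<longrightarrow> q' < nstates M)"

record conf =
  st :: nat
  ih :: nat
  wtape :: "bool list"
  wh :: nat
  ctape :: "bool list"
  chd :: nat
  res :: "bool option option"   (* None: still running; Some r: halted with output r *)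

definition read_cell :: "bool list \<Rightarrow> nat \<Rightarrow> bool option" where
  "read_cell xs h = (if 1 \<le> h \<and> h \<le> length xs then Some (xs ! (h - 1)) else None)"

definition write_cell :: "bool list \<Rightarrow> nat \<Rightarrow> bool \<Rightarrow> bool list" where
  "write_cell xs h b = (if 1 \<le> h \<and> h \<le> length xs then xs[h - 1 := b] else xs)"

definition move :: "dir \<Rightarrow> nat \<Rightarrow> nat \<Rightarrow> nat" where
  "move d len h = (case d of Lft \<Rightarrow> h - 1 | Stay \<Rightarrow> h | Rgt \<Rightarrow> min (h + 1) (len + 1))"

definition step :: "machine \<Rightarrow> bool list \<Rightarrow> conf \<Rightarrow> conf" where
  "step M x C =
     (if res C \<noteq> None then C else
      (case delta M (st C) (read_cell x (ih C)) (read_cell (wtape C) (wh C))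
                    (read_cell (ctape C) (chd C)) of
         Halt r \<Rightarrow> C\<lparr>res := Some r\<rparr>
       | Step q' w k d1 d2 d3 \<Rightarrow>
           \<lparr> st = q',
             ih = move d1 (length x) (ih C),
             wtape = write_cell (wtape C) (wh C) w,
             wh = move d2 (length (wtape C)) (wh C),
             ctape = write_cell (ctape C) (chd C) k,
             chd = move d3 (length (ctape C)) (chd C),
             res = None \<rparr>))"

definition init_conf :: "nat \<Rightarrow> bool list \<Rightarrow> conf" where
  "init_conf s \<tau> = \<lparr> st = 0, ih = 0, wtape = replicate s False, wh = 0,
                      ctape = \<tau>, chd = 0, res = None \<rparr>"

definition run :: "machine \<Rightarrow> bool list \<Rightarrow> nat \<Rightarrow> bool list \<Rightarrow> nat \<Rightarrow> conf" where
  "run M x s \<tau> t = (step M x ^^ t) (init_conf s \<tau>)"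

definition halts_restoring :: "machine \<Rightarrow> bool list \<Rightarrow> nat \<Rightarrow> bool list \<Rightarrow> nat \<Rightarrow> bool option \<Rightarrow> bool" where
  "halts_restoring M x s \<tau> t r \<longleftrightarrow>
     res (run M x s \<tau> t) = Some r \<and> ctape (run M x s \<tau> t) = \<tau>"

definition zp_tau_decides ::
  "machine \<Rightarrow> bool list set \<Rightarrow> (nat \<Rightarrow> nat) \<Rightarrow> (nat \<Rightarrow> nat) \<Rightarrow> (nat \<Rightarrow> nat) option \<Rightarrow> bool" where
  "zp_tau_decides M L s c T \<longleftrightarrow> wf_machine M \<and>
     (\<forall>x \<tau>. length \<tau> = c (length x) \<longrightarrow>
        (\<exists>t r. halts_restoring M x (s (length x)) \<tau> t r \<and> (r = Some (x \<in> L) \<or> r = None) \<and>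
               (case T of None \<Rightarrow> True | Some f \<Rightarrow> t \<le> f (length x)))) \<and>
     (\<forall>x. 2 * card {\<tau>. length \<tau> = c (length x) \<and>
                        (\<exists>t. res (run M x (s (length x)) \<tau> t) = Some (Some (x \<in> L)))}
          \<ge> 2 ^ c (length x))"

definition ZP_tau_CSPACE :: "(nat \<Rightarrow> nat) \<Rightarrow> (nat \<Rightarrow> nat) \<Rightarrow> bool list set set" where
  "ZP_tau_CSPACE s c = {L. \<exists>M. zp_tau_decides M L s c None}"

text \<open>Bounds \<open>k log n\<close> and \<open>n^k\<close>; to avoid degenerate values for \<open>n \<in> {0,1}\<close>
(e.g. a time bound of \<open>0^k = 0\<close> steps) we evaluate them at \<open>max 2 n\<close>.\<close>
definition logsp :: "nat \<Rightarrow> nat \<Rightarrow> nat" where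
  "logsp k n = k * nat \<lceil>log 2 (real (max 2 n))\<rceil>"

definition polyb :: "nat \<Rightarrow> nat \<Rightarrow> nat" where
  "polyb k n = (max 2 n) ^ k"

definition ZP_tau_CL :: "bool list set set" where
  "ZP_tau_CL = (\<Union>k. ZP_tau_CSPACE (logsp k) (polyb k))"

definition ZP_tau_CLP :: "bool list set set" where
  "ZP_tau_CLP = {L. \<exists>k M. zp_tau_decides M L (logsp k) (polyb k) (Some (polyb k))}"

end

theory Submission
  imports Defs
begin

text \<open>
The configurations of a catalytic machine on a fixed input form a forest whose roots are the halting
configurations. Since the initial tape is always restored, different initial tapes lie in different
trees, so the average tree has only polynomially many nodes. A depth-first tour of a tree (in the
manner of Lange, McKenzie and Tapp) is a reversible walk: one step is an involution, which crosses an
edge, followed by a cyclic shift of the edges at the current node. The new machine walks from the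
initial configuration along the tour, guarded by a clock. If it reaches the root, the tape is restored
and the answer is known; if the clock runs out first, it walks the same number of steps back, which
also restores the tape. By Markov's inequality only a fraction 1/8 of the tapes is too slow. Running
this on two disjoint blocks of a longer catalytic tape fails with probability at most
\<open>(1/2 + 1/8)^2 < 1/2\<close>.
\<close>

text \<open>The forest is built on all configurations of the right size, reachable or not. Some of
  these may loop; they lie in no tree and do no harm to the count. There are \<open>2 ^ c\<close>
  tapes and \<open>2 ^ c\<close> times polynomially many configurations, whence the polynomial
  average. A step can be inverted locally because the state and the three scanned symbols of a
  predecessor, of which there are constantly many choices, fix its moves and writes. Moves blocked
  at an end marker would spoil this, so the two markers have to be told apart. One block alone would
  guarantee success only for 1/2 - 1/8 of the tapes. As the machine never errs, any proper answer
  can be trusted, and a second block lifts the fraction above 1/2 again. Work space, catalytic space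
  and time share one exponent \<open>k\<close>, so the new catalytic tape is longer than the
  simulated one. The new machine therefore has to compute the simulated length from the input and to
  count its position on that tape. These counters, the clock and the simulated work tape are tracks
  of a single work tape; one sweep over it updates all of them, and its columns are finally coded in
  bits.\<close>

definition reaches :: "('c \<Rightarrow> 'c) \<Rightarrow> nat \<Rightarrow> 'c \<Rightarrow> 'c \<Rightarrow> bool" where
  "reaches f b X Y \<longleftrightarrow> (\<exists>t\<le>b. (f ^^ t) X = Y)"

lemma reaches_refl [simp]: "reaches f b X X"
  unfolding reaches_def by (rule exI[of _ 0]) simp

lemma reaches_trans: "reaches f a X Y \<Longrightarrow> reaches f b Y Z \<Longrightarrow> reaches f (a + b) X Z"
  unfolding reaches_def
proof (elim exE conjE)
  fix t u assume *: "t \<le> a" "(f ^^ t) X = Y" "u \<le> b" "(f ^^ u) Y = Z"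
  then have "(f ^^ (u + t)) X = Z" by (simp add: funpow_add)
  with * show "\<exists>t\<le>a + b. (f ^^ t) X = Z" by (intro exI[of _ "u + t"]) simp
qed

lemma reaches_mono: "reaches f a X Y \<Longrightarrow> a \<le> b \<Longrightarrow> reaches f b X Y"
  unfolding reaches_def by (metis (no_types) order_trans)

lemma reaches_Suc: "f X = X' \<Longrightarrow> reaches f b X' Y \<Longrightarrow> reaches f (Suc b) X Y"
  unfolding reaches_def by (metis Suc_le_mono funpow_simps_right(2) o_apply)

lemma reaches_step: "f X = Y \<Longrightarrow> 1 \<le> b \<Longrightarrow> reaches f b X Y"
  unfolding reaches_def by (intro exI[of _ 1]) simp

text \<open>Both simulation layers below use this form: \<open>R\<close> relates a simulated to a
  simulating configuration and each simulated step costs at most \<open>b\<close>. The invariant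
  \<open>I\<close> concerns the simulated side alone.\<close>

lemma reaches_funpow:
  assumes "\<And>A. I A \<Longrightarrow> I (g A)" "\<And>A X. I A \<Longrightarrow> R A X \<Longrightarrow> \<exists>X'. reaches f b X X' \<and> R (g A) X'"
  shows "I A \<Longrightarrow> R A X \<Longrightarrow> \<exists>X'. reaches f (n * b) X X' \<and> R ((g ^^ n) A) X'"
proof (induction n arbitrary: A X)
  case 0
  then show ?case by (intro exI[of _ X]) simp
next
  case (Suc n)
  obtain Y where Y: "reaches f b X Y" "R (g A) Y" using assms(2)[OF Suc.prems] by blast
  obtain Z where Z: "reaches f (n * b) Y Z" "R ((g ^^ n) (g A)) Z"
    using Suc.IH[OF assms(1)[OF Suc.prems(1)] Y(2)] by blast
  show ?case
    using reaches_trans[OF Y(1) Z(1)] Z(2)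
    by (intro exI[of _ Z]) (simp add: funpow_simps_right(2) del: funpow.simps)
qed

section \<open>Machines over an arbitrary work alphabet\<close>

datatype ('q, 'w) wact = WHalt "bool option" | WStep 'q 'w bool dir dir dir

type_synonym ('q, 'w) wconf =
  "'q \<times> nat \<times> 'w list \<times> nat \<times> bool list \<times> nat \<times> bool option option"

definition rd :: "'w list \<Rightarrow> nat \<Rightarrow> 'w option" where
  "rd xs h = (if 1 \<le> h \<and> h \<le> length xs then Some (xs ! (h - 1)) else None)"

definition wr :: "'w list \<Rightarrow> nat \<Rightarrow> 'w \<Rightarrow> 'w list" where
  "wr xs h b = (if 1 \<le> h \<and> h \<le> length xs then xs[h - 1 := b] else xs)"

lemma read_cell_eq_rd: "read_cell = rd"
  by (simp add: fun_eq_iff read_cell_def rd_def)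

lemma write_cell_eq_wr: "write_cell = wr"
  by (simp add: fun_eq_iff write_cell_def wr_def)

lemma length_wr [simp]: "length (wr xs h b) = length xs"
  by (simp add: wr_def)

lemma rd_append [simp]: "rd (A @ b # B) (Suc (length A)) = Some b"
  by (simp add: rd_def)

lemma wr_append [simp]: "wr (A @ b # B) (Suc (length A)) c = A @ c # B"
  by (simp add: wr_def)

lemma move_simps [simp]: "move Lft n h = h - 1" "move Stay n h = h" "move Rgt n h = min (h + 1) (n + 1)"
  by (simp_all add: move_def)

text \<open>Every transition has to write; this writes back the scanned bit. The value on an end
  marker is arbitrary, as writing there has no effect.\<close>

definition keep :: "bool option \<Rightarrow> bool" where
  "keep v = (case v of Some b \<Rightarrow> b | None \<Rightarrow> False)"

lemma wr_keep [simp]: "wr xs h (keep (rd xs h)) = xs"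
  by (auto simp: wr_def rd_def keep_def)

definition wstep ::
  "('q \<Rightarrow> bool option \<Rightarrow> 'w option \<Rightarrow> bool option \<Rightarrow> ('q, 'w) wact) \<Rightarrow> bool list
    \<Rightarrow> ('q, 'w) wconf \<Rightarrow> ('q, 'w) wconf" where
  "wstep \<delta> x = (\<lambda>(q, i, ws, h, ct, p, r).
     if r \<noteq> None then (q, i, ws, h, ct, p, r) else
     (case \<delta> q (rd x i) (rd ws h) (rd ct p) of
        WHalt r' \<Rightarrow> (q, i, ws, h, ct, p, Some r')
      | WStep q' w k d1 d2 d3 \<Rightarrow>
          (q', move d1 (length x) i, wr ws h w, move d2 (length ws) h, wr ct p k,
           move d3 (length ct) p, None)))"

lemma wstep_halted [simp]: "wstep \<delta> x (q, i, ws, h, ct, p, Some r) = (q, i, ws, h, ct, p, Some r)"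
  by (simp add: wstep_def)

text \<open>A \<open>machine\<close> has numbers as states and starts in 0, so \<open>S\<close> is
  numbered with \<open>s0\<close> first and the others shifted by one. The two runs proceed in
  lockstep, hence no time is lost.\<close>

lemma numbered_machine:
  fixes \<delta> :: "'s \<Rightarrow> bool option \<Rightarrow> bool option \<Rightarrow> bool option \<Rightarrow> ('s, bool) wact"
  assumes "finite S" "s0 \<in> S"
    and closed: "\<And>s a b c s' w k d1 d2 d3. s \<in> S \<Longrightarrow> \<delta> s a b c = WStep s' w k d1 d2 d3 \<Longrightarrow> s' \<in> S"
  obtains M where "wf_machine M"
    "\<And>x s \<tau> t q i ws h ct p r.
       (wstep \<delta> x ^^ t) (s0, 0, replicate s False, 0, \<tau>, 0, None) = (q, i, ws, h, ct, p, r)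
       \<Longrightarrow> res (run M x s \<tau> t) = r \<and> ctape (run M x s \<tau> t) = ct"
proof -
  obtain f0 where f0: "bij_betw f0 (S - {s0}) {0..<card (S - {s0})}"
    using ex_bij_betw_finite_nat[of "S - {s0}"] assms(1) by blast
  define f where "f s = (if s = s0 then 0 else Suc (f0 s))" for s
  have inj: "inj_on f S"
    using f0 by (auto simp: inj_on_def f_def bij_betw_def)
  have bound: "f s < card S" if "s \<in> S" for s
  proof (cases "s = s0")
    case True
    then show ?thesis using assms(1,2) by (auto simp: f_def card_gt_0_iff)
  next
    case False
    then have "f0 s < card (S - {s0})" using f0 that by (auto simp: bij_betw_def)
    then show ?thesis using False assms(1,2) by (simp add: f_def card_gt_0_iff)
  qed
  define g where "g = inv_into S f"
  have gf: "g (f s) = s" if "s \<in> S" for s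
    using that inj by (simp add: g_def)
  define M where "M = \<lparr>nstates = card S, delta = (\<lambda>n a b c. if n \<in> f ` S then
      (case \<delta> (g n) a b c of WHalt r \<Rightarrow> Halt r
       | WStep s' w k d1 d2 d3 \<Rightarrow> Step (f s') w k d1 d2 d3) else Halt None)\<rparr>"
  have wf: "wf_machine M"
    unfolding wf_machine_def
  proof (intro conjI allI impI)
    show "0 < nstates M" using assms(1,2) by (auto simp: M_def card_gt_0_iff)
    fix q a b c q' w k d1 d2 d3
    assume "delta M q a b c = Step q' w k d1 d2 d3"
    then obtain s s' where s: "s \<in> S" "\<delta> s a b c = WStep s' w k d1 d2 d3" "q' = f s'"
      by (auto simp: M_def gf split: if_splits wact.splits)
    show "q' < nstates M" using bound[OF closed[OF s(1,2)]] s(3) by (simp add: M_def)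
  qed
  have sim: "\<exists>s i ws h ct p r. s \<in> S \<and>
       (wstep \<delta> x ^^ t) (s0, 0, replicate n False, 0, \<tau>, 0, None) = (s, i, ws, h, ct, p, r) \<and>
       run M x n \<tau> t = \<lparr>st = f s, ih = i, wtape = ws, wh = h, ctape = ct, chd = p, res = r\<rparr>"
    for x n \<tau> t
  proof (induction t)
    case 0
    then show ?case by (simp add: run_def init_conf_def f_def assms(2))
  next
    case (Suc t)
    then obtain s i ws h ct p r where IH: "s \<in> S"
       "(wstep \<delta> x ^^ t) (s0, 0, replicate n False, 0, \<tau>, 0, None) = (s, i, ws, h, ct, p, r)"
       "run M x n \<tau> t = \<lparr>st = f s, ih = i, wtape = ws, wh = h, ctape = ct, chd = p, res = r\<rparr>"
      by blast
    have fS: "f s \<in> f ` S" using IH(1) by simp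
    have r: "run M x n \<tau> (Suc t) =
        step M x \<lparr>st = f s, ih = i, wtape = ws, wh = h, ctape = ct, chd = p, res = r\<rparr>"
      unfolding IH(3)[symmetric] by (simp add: run_def)
    have w: "(wstep \<delta> x ^^ Suc t) (s0, 0, replicate n False, 0, \<tau>, 0, None) =
        wstep \<delta> x (s, i, ws, h, ct, p, r)"
      by (simp add: IH(2))
    show ?case
    proof (cases "r = None")
      case False
      then show ?thesis using IH(1) unfolding r w by (auto simp: step_def)
    next
      case True
      show ?thesis
      proof (cases "\<delta> s (rd x i) (rd ws h) (rd ct p)")
        case (WHalt r')
        then show ?thesis unfolding r w using True IH(1) fS
          by (auto simp: wstep_def step_def M_def gf read_cell_eq_rd)
      next
        case (WStep s' w k d1 d2 d3)
        then show ?thesis unfolding r w using True IH(1) fS closed[OF IH(1) WStep]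
          by (auto simp: wstep_def step_def M_def gf read_cell_eq_rd write_cell_eq_wr)
      qed
    qed
  qed
  show thesis
  proof (rule that[OF wf])
    fix x n \<tau> t q i ws h ct p r
    assume "(wstep \<delta> x ^^ t) (s0, 0, replicate n False, 0, \<tau>, 0, None) = (q, i, ws, h, ct, p, r)"
    then show "res (run M x n \<tau> t) = r \<and> ctape (run M x n \<tau> t) = ct"
      using sim[where x = x and t = t and n = n and \<tau> = \<tau>] by auto
  qed
qed

section \<open>Binary encoding of the work alphabet\<close>

text \<open>\<open>Rd\<close> holds the bits of a column read so far, \<open>Wr\<close> the bits
  still to be written, \<open>Mv\<close> the number of single-cell moves still to be made.\<close>

datatype 'q micro = Rd 'q "bool list" | Wr 'q "bool list" dir | Mv 'q dir nat

text \<open>\<open>enc w0\<close> is all zeros because a \<open>machine\<close> starts with a blank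
  work tape. \<open>closedA\<close> concerns scanned letters only, since a letter written on an end
  marker is lost.\<close>

locale wide =
  fixes \<delta> :: "'q \<Rightarrow> bool option \<Rightarrow> 'w option \<Rightarrow> bool option \<Rightarrow> ('q, 'w) wact"
    and Q :: "'q set" and q0 :: 'q and A :: "'w set" and w0 :: 'w
    and enc :: "'w \<Rightarrow> bool list" and g :: nat
  assumes finQ: "finite Q" and q0: "q0 \<in> Q" and w0: "w0 \<in> A" "enc w0 = replicate g False"
    and inj_enc: "inj_on enc A" and len_enc: "\<And>w. w \<in> A \<Longrightarrow> length (enc w) = g" and g: "1 \<le> g"
    and closedQ: "\<And>q a v c q' w k d1 d2 d3. q \<in> Q \<Longrightarrow> set_option v \<subseteq> A \<Longrightarrow>
          \<delta> q a v c = WStep q' w k d1 d2 d3 \<Longrightarrow> q' \<in> Q"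
    and closedA: "\<And>q a v c q' w k d1 d2 d3. q \<in> Q \<Longrightarrow> v \<in> A \<Longrightarrow>
          \<delta> q a (Some v) c = WStep q' w k d1 d2 d3 \<Longrightarrow> w \<in> A"
begin

text \<open>A column is read rightwards and written leftwards. Input and catalytic tape are used in
  one micro step only, the one that consults \<open>\<delta>\<close>. After writing, the head is one
  cell left of the column, so \<open>Suc g\<close> moves right, 1 move right or \<open>g - 1\<close>
  moves left lead to the first cell of the next, the same or the previous column.\<close>

primrec \<mu> :: "'q micro \<Rightarrow> bool option \<Rightarrow> bool option \<Rightarrow> bool option \<Rightarrow> ('q micro, bool) wact" where
  "\<mu> (Rd q u) a b c = (case b of
     None \<Rightarrow> if u \<noteq> [] then WHalt None else
       (case \<delta> q a None c of WHalt r \<Rightarrow> WHalt r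
        | WStep q' w k d1 d2 d3 \<Rightarrow>
           (if d2 = Lft then WStep (Mv q' Lft g) False k d1 Stay d3
            else WStep (Rd q' []) False k d1 d2 d3))
   | Some b' \<Rightarrow> if Suc (length u) < g then WStep (Rd q (u @ [b'])) b' (keep c) Stay Rgt Stay
      else if u @ [b'] \<in> enc ` A then
        (case \<delta> q a (Some (inv_into A enc (u @ [b']))) c of WHalt r \<Rightarrow> WHalt r
         | WStep q' w k d1 d2 d3 \<Rightarrow> WStep (Wr q' (enc w) d2) b' k d1 Stay d3)
      else WHalt None)"
| "\<mu> (Wr q v d) a b c =
     (if v \<noteq> [] then WStep (Wr q (butlast v) d) (last v) (keep c) Stay Lft Stay
      else WStep (case d of Rgt \<Rightarrow> Mv q Rgt (Suc g) | Stay \<Rightarrow> Mv q Rgt 1 | Lft \<Rightarrow> Mv q Lft (g - 1))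
             (keep b) (keep c) Stay Stay Stay)"
| "\<mu> (Mv q d n) a b c =
     (case n of 0 \<Rightarrow> WStep (Rd q []) (keep b) (keep c) Stay Stay Stay
      | Suc n' \<Rightarrow> WStep (Mv q d n') (keep b) (keep c) Stay d Stay)"

definition states :: "'q micro set" where
  "states = (\<lambda>(q, u). Rd q u) ` (Q \<times> {u. length u \<le> g}) \<union>
     (\<lambda>(q, u, d). Wr q u d) ` (Q \<times> {u. length u \<le> g} \<times> {Lft, Stay, Rgt}) \<union>
     (\<lambda>(q, d, n). Mv q d n) ` (Q \<times> {Lft, Stay, Rgt} \<times> {..Suc g})"

lemma finite_states: "finite states"
proof -
  have "finite {u :: bool list. length u \<le> g}"
    using finite_lists_length_le[of "UNIV :: bool set" g] by simp
  then show ?thesis by (simp add: states_def finQ)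
qed

lemma states_simps [simp]:
  "Rd q u \<in> states \<longleftrightarrow> q \<in> Q \<and> length u \<le> g"
  "Wr q u d \<in> states \<longleftrightarrow> q \<in> Q \<and> length u \<le> g"
  "Mv q d n \<in> states \<longleftrightarrow> q \<in> Q \<and> n \<le> Suc g"
  using dir.exhaust by (auto simp: states_def image_iff)

lemma states_closed:
  assumes "s \<in> states" "\<mu> s a b c = WStep s' w k d1 d2 d3"
  shows "s' \<in> states"
proof (cases s)
  case (Rd q u)
  show ?thesis
  proof (cases b)
    case None
    then show ?thesis using assms Rd g closedQ[of q None]
      by (auto split: if_splits wact.splits)
  next
    case (Some b')
    show ?thesis
    proof (cases "Suc (length u) < g")
      case True
      then show ?thesis using assms Rd Some by auto
    next
      case False
      with Rd Some assms obtain v where v: "v \<in> A" "u @ [b'] = enc v" by (auto split: if_splits)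
      with False Rd Some assms inj_enc obtain q' w' d where
        *: "\<delta> q a (Some v) c = WStep q' w' k d1 d d3" "s' = Wr q' (enc w') d"
        by (auto split: if_splits wact.splits)
      have "q \<in> Q" using assms Rd by simp
      then show ?thesis
        using closedQ[OF _ _ *(1)] closedA[OF _ v(1) *(1)] v *(2) len_enc by simp
    qed
  qed
next
  case (Wr q v d)
  then show ?thesis using assms g by (cases d) (auto split: if_splits)
next
  case (Mv q d n)
  then show ?thesis using assms g by (auto split: nat.splits)
qed

abbreviation bstep where "bstep \<equiv> wstep \<mu>"

definition pos :: "nat \<Rightarrow> nat" where
  "pos h = (if h = 0 then 0 else g * (h - 1) + 1)"

abbreviation flat :: "'w list \<Rightarrow> bool list" where
  "flat ws \<equiv> concat (map enc ws)"

lemma length_flat: "set ws \<subseteq> A \<Longrightarrow> length (flat ws) = g * length ws"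
  by (induction ws) (auto simp: len_enc)

lemma read_column:
  assumes "length (u @ v @ [b]) = g"
  shows "reaches (bstep x) (length v)
     (Rd q u, i, L @ u @ v @ b # R, Suc (length L + length u), ct, p, None)
     (Rd q (u @ v), i, L @ u @ v @ b # R, length L + g, ct, p, None)"
  using assms
proof (induction v arbitrary: u)
  case Nil
  then have "g = Suc (length u)" by simp
  then show ?case by simp
next
  case (Cons c v)
  have "rd ((L @ u) @ c # (v @ b # R)) (Suc (length (L @ u))) = Some c"
       "wr ((L @ u) @ c # (v @ b # R)) (Suc (length (L @ u))) c = (L @ u) @ c # (v @ b # R)"
    by (rule rd_append wr_append)+
  then have "bstep x (Rd q u, i, L @ u @ (c # v) @ b # R, Suc (length L + length u), ct, p, None)
    = (Rd q (u @ [c]), i, L @ (u @ [c]) @ v @ b # R, Suc (length L + length (u @ [c])), ct, p, None)"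
    using Cons.prems by (simp add: wstep_def)
  from reaches_Suc[OF this Cons.IH[of "u @ [c]"]] show ?case using Cons.prems by simp
qed

lemma write_column:
  assumes "length u = length v"
  shows "reaches (bstep x) (length v)
     (Wr q v d, i, L @ u @ R, length L + length u, ct, p, None)
     (Wr q [] d, i, L @ v @ R, length L, ct, p, None)"
  using assms
proof (induction v arbitrary: u R rule: rev_induct)
  case Nil
  then show ?case by simp
next
  case (snoc c v)
  then obtain u' b where u: "u = u' @ [b]" "length u' = length v"
    by (cases u rule: rev_cases) auto
  have "rd ((L @ u') @ b # R) (Suc (length (L @ u'))) = Some b"
       "wr ((L @ u') @ b # R) (Suc (length (L @ u'))) c = (L @ u') @ c # R"
    by (rule rd_append wr_append)+
  then have "bstep x (Wr q (v @ [c]) d, i, L @ u @ R, length L + length u, ct, p, None)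
    = (Wr q v d, i, L @ u' @ c # R, length L + length u', ct, p, None)"
    by (simp add: wstep_def u)
  from reaches_Suc[OF this snoc.IH[of u' "c # R"]] show ?case using u by simp
qed

lemma move_column:
  "reaches (bstep x) (Suc n)
     (Mv q d n, i, ws, h, ct, p, None)
     (Rd q [], i, ws, (move d (length ws) ^^ n) h, ct, p, None)"
proof (induction n arbitrary: h)
  case 0
  then show ?case by (intro reaches_step) (simp_all add: wstep_def)
next
  case (Suc n)
  have "bstep x (Mv q d (Suc n), i, ws, h, ct, p, None)
    = (Mv q d n, i, ws, move d (length ws) h, ct, p, None)"
    by (simp add: wstep_def)
  from reaches_Suc[OF this Suc[of "move d (length ws) h"]] show ?case
    by (simp add: funpow_simps_right(2) del: funpow.simps move_simps)
qed

lemma funpow_move: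
  "(move Lft l ^^ n) h = h - n" "h \<le> l + 1 \<Longrightarrow> (move Rgt l ^^ n) h = min (h + n) (l + 1)"
  by (induction n) auto

fun valid :: "('q, 'w) wconf \<Rightarrow> bool" where
  "valid (q, i, ws, h, ct, p, r) \<longleftrightarrow> q \<in> Q \<and> set ws \<subseteq> A \<and> h \<le> length ws + 1"

text \<open>The binary machine may halt in the middle of a column, so after halting only the
  catalytic tape and the result are compared.\<close>

fun embeds :: "('q, 'w) wconf \<Rightarrow> ('q micro, bool) wconf \<Rightarrow> bool" where
  "embeds (q, i, ws, h, ct, p, r) Y \<longleftrightarrow> (if r = None then Y = (Rd q [], i, flat ws, pos h, ct, p, None)
     else \<exists>q' i' ws' h' p'. Y = (q', i', ws', h', ct, p', r))"

text \<open>The budget \<open>3 * g + 4\<close> allows \<open>g\<close> steps to read a column, one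
  to consult \<open>\<delta>\<close>, \<open>g\<close> to write and \<open>g + 3\<close> to reach
  the next column.\<close>

lemma embeds_step:
  assumes "valid X" "embeds X Y"
  shows "valid (wstep \<delta> x X)" "\<exists>Z. reaches (bstep x) (3 * g + 4) Y Z \<and> embeds (wstep \<delta> x X) Z"
proof -
  obtain q i ws h ct p r where X: "X = (q, i, ws, h, ct, p, r)" by (metis prod_cases7)
  have v: "q \<in> Q" "set ws \<subseteq> A" "h \<le> length ws + 1" using assms X by auto
  have "valid (wstep \<delta> x X) \<and> (\<exists>Z. reaches (bstep x) (3 * g + 4) Y Z \<and> embeds (wstep \<delta> x X) Z)"
  proof (cases "r = None")
    case False
    then have "wstep \<delta> x X = X" by (auto simp: X)
    then show ?thesis using assms reaches_refl[of "bstep x" _ Y] by metis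
  next
    case running: True
    have Y: "Y = (Rd q [], i, flat ws, pos h, ct, p, None)" using assms(2) running X by simp
    show ?thesis
    proof (cases "rd ws h")
      case None
      then have h: "h = 0 \<or> h = length ws + 1" using v(3) by (auto simp: rd_def split: if_splits)
      then have rdN: "rd (flat ws) (pos h) = None"
        by (auto simp: pos_def rd_def length_flat[OF v(2)])
      then have wrN: "wr (flat ws) (pos h) b = flat ws" for b
        by (auto simp: rd_def wr_def split: if_splits)
      have wrN': "wr ws h w = ws" for w using None by (auto simp: rd_def wr_def split: if_splits)
      show ?thesis
      proof (cases "\<delta> q (rd x i) None (rd ct p)")
        case (WHalt r')
        then have "wstep \<delta> x X = (q, i, ws, h, ct, p, Some r')"
          "bstep x Y = (Rd q [], i, flat ws, pos h, ct, p, Some r')"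
          using None running rdN by (simp_all add: X Y wstep_def)
        then show ?thesis using v reaches_step[of "bstep x" Y _ "3 * g + 4"] by auto blast
      next
        case (WStep q' w k d1 d2 d3)
        let ?i = "move d1 (length x) i" and ?ct = "wr ct p k" and ?p = "move d3 (length ct) p"
        have st: "wstep \<delta> x X = (q', ?i, ws, move d2 (length ws) h, ?ct, ?p, None)"
          using running None WStep wrN' by (simp add: X wstep_def)
        let ?Z = "(Rd q' [], ?i, flat ws, pos (move d2 (length ws) h), ?ct, ?p, None)"
        have q': "q' \<in> Q" using closedQ[OF v(1) _ WStep] by simp
        have val: "valid (wstep \<delta> x X)" using q' v(2,3) by (cases d2) (auto simp: st)
        have "reaches (bstep x) (3 * g + 4) Y ?Z"
        proof (cases "d2 = Lft")
          case True
          have "bstep x Y = (Mv q' Lft g, ?i, flat ws, pos h, ?ct, ?p, None)"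
            using running WStep rdN wrN True by (simp add: Y wstep_def)
          from reaches_Suc[OF this move_column]
          have "reaches (bstep x) (Suc (Suc g)) Y (Rd q' [], ?i, flat ws, pos h - g, ?ct, ?p, None)"
            by (simp add: funpow_move)
          \<comment> \<open>On the left marker both sides are 0. From the right marker,
            \<open>g\<close> cells lead back to the start of the last column, or to the left marker
            if there is no column.\<close>
          moreover have "pos h - g = pos (h - 1)"
            using h g by (cases ws) (auto simp: pos_def)
          ultimately show ?thesis using True by (auto elim: reaches_mono)
        next
          case False
          have "move d2 (length (flat ws)) (pos h) = pos (move d2 (length ws) h)"
            using h g False by (cases d2) (auto simp: pos_def length_flat[OF v(2)])
          then have "bstep x Y = ?Z"
            using running WStep rdN wrN False by (simp add: Y wstep_def)
          then show ?thesis by (intro reaches_step) auto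
        qed
        with val show ?thesis unfolding st by auto
      qed
    next
      case (Some w)
      then have h: "1 \<le> h" "h \<le> length ws" "ws ! (h - 1) = w" by (auto simp: rd_def split: if_splits)
      define P R where "P = take (h - 1) ws" and "R = drop h ws"
      have ws: "ws = P @ w # R" "length P = h - 1"
        using h id_take_nth_drop[of "h - 1" ws] by (auto simp: P_def R_def)
      have wA: "w \<in> A" and PA: "set P \<subseteq> A" using v(2) ws by auto
      have lP: "length (flat P) = g * (h - 1)" using length_flat[OF PA] ws(2) by simp
      obtain u b where ub: "enc w = u @ [b]" using len_enc[OF wA] g by (cases "enc w" rule: rev_cases) auto
      have lu: "Suc (length u) = g" using len_enc[OF wA] ub by simp
      let ?T = "flat P @ enc w @ flat R"
      have flat: "flat ws = ?T" by (simp add: ws)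
      have r1: "reaches (bstep x) g Y (Rd q u, i, ?T, length (flat P) + g, ct, p, None)"
        using read_column[of "[]" u b x q i "flat P" "flat R" ct p, THEN reaches_mono, of g] lu h running
        by (simp add: Y flat ub pos_def lP)
      have "rd ((flat P @ u) @ b # flat R) (Suc (length (flat P @ u))) = Some b"
        "wr ((flat P @ u) @ b # flat R) (Suc (length (flat P @ u))) c = (flat P @ u) @ c # flat R" for c
        by (rule rd_append wr_append)+
      then have rb: "rd ?T (length (flat P) + g) = Some b"
        and wb: "wr ?T (length (flat P) + g) b = ?T"
        by (simp_all add: ub flip: lu)
      have dec: "inv_into A enc (u @ [b]) = w" "u @ [b] \<in> enc ` A"
        using ub wA inj_enc by (metis inv_into_f_f, metis imageI)
      show ?thesis
      proof (cases "\<delta> q (rd x i) (Some w) (rd ct p)")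
        case (WHalt r')
        then have st: "wstep \<delta> x X = (q, i, ws, h, ct, p, Some r')"
          using running Some by (simp add: X wstep_def)
        have "bstep x (Rd q u, i, ?T, length (flat P) + g, ct, p, None)
           = (Rd q u, i, ?T, length (flat P) + g, ct, p, Some r')"
          using rb dec WHalt lu by (simp add: wstep_def)
        from reaches_trans[OF r1 reaches_step[where f = "bstep x" and b = 1, OF this, simplified]]
        have "reaches (bstep x) (3 * g + 4) Y (Rd q u, i, ?T, length (flat P) + g, ct, p, Some r')"
          by (rule reaches_mono) auto
        then show ?thesis using v unfolding st by auto blast
      next
        case (WStep q' w' k d1 d2 d3)
        let ?i = "move d1 (length x) i" and ?ct = "wr ct p k" and ?p = "move d3 (length ct) p"
        have st: "wstep \<delta> x X = (q', ?i, P @ w' # R, move d2 (length ws) h, ?ct, ?p, None)"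
          using running Some WStep wr_append[of P w R w'] ws h(1) by (simp add: X wstep_def)
        have q': "q' \<in> Q" and w': "w' \<in> A" 
          using closedQ[OF v(1) _ WStep] closedA[OF v(1) wA WStep] wA by auto
        have val: "valid (wstep \<delta> x X)" using q' w' v(2,3) ws h by (cases d2) (auto simp: st)
        have "bstep x (Rd q u, i, ?T, length (flat P) + g, ct, p, None)
           = (Wr q' (enc w') d2, ?i, ?T, length (flat P) + g, ?ct, ?p, None)"
          using rb wb dec WStep lu by (simp add: wstep_def)
        then have r2: "reaches (bstep x) 1 (Rd q u, i, ?T, length (flat P) + g, ct, p, None)
           (Wr q' (enc w') d2, ?i, ?T, length (flat P) + g, ?ct, ?p, None)"
          by (intro reaches_step) auto
        let ?T' = "flat (P @ w' # R)"
        let ?Z = "(Rd q' [], ?i, ?T', pos (move d2 (length ws) h), ?ct, ?p, None)"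
        have r3: "reaches (bstep x) g (Wr q' (enc w') d2, ?i, ?T, length (flat P) + g, ?ct, ?p, None)
           (Wr q' [] d2, ?i, ?T', length (flat P), ?ct, ?p, None)"
          using write_column[of "enc w" "enc w'" x q' d2 ?i "flat P" "flat R" ?ct ?p] len_enc[OF wA] len_enc[OF w']
          by simp
        have lT': "length ?T' = g * length ws"
          using length_flat[of "P @ w' # R"] v(2) ws w' by auto
        have r4: "reaches (bstep x) (g + 3) (Wr q' [] d2, ?i, ?T', length (flat P), ?ct, ?p, None)
           ?Z"
        proof -
          define d n where "d = (if d2 = Lft then Lft else Rgt)"
            and "n = (case d2 of Rgt \<Rightarrow> Suc g | Stay \<Rightarrow> 1 | Lft \<Rightarrow> g - 1)"
          have "bstep x (Wr q' [] d2, ?i, ?T', length (flat P), ?ct, ?p, None)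
            = (Mv q' d n, ?i, ?T', length (flat P), ?ct, ?p, None)"
            by (cases d2) (simp_all add: wstep_def d_def n_def)
          from reaches_Suc[OF this move_column]
          have "reaches (bstep x) (Suc (Suc n)) (Wr q' [] d2, ?i, ?T', length (flat P), ?ct, ?p, None)
            (Rd q' [], ?i, ?T', (move d (length ?T') ^^ n) (length (flat P)), ?ct, ?p, None)" .
          moreover have "(move d (length ?T') ^^ n) (length (flat P)) = pos (move d2 (length ws) h)"
          proof -
            obtain j where j: "h = Suc j" using h(1) by (cases h) auto
            have le: "g * j + g \<le> g * length ws" using h(2) j mult_le_mono2[of "Suc j" "length ws" g] by simp
            show ?thesis
            proof (cases d2)
              case Lft
              then show ?thesis using g unfolding lT' lP d_def n_def j by (cases j) (auto simp: funpow_move pos_def)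
            next
              case Stay
              then show ?thesis using g le unfolding lT' lP d_def n_def j by (auto simp: pos_def)
            next
              case Rgt
              have "(move Rgt (g * length ws) ^^ Suc g) (g * j) = g * j + Suc g"
                using le by (subst funpow_move) auto
              then show ?thesis using le h(2) Rgt unfolding lT' lP d_def n_def j
                by (simp add: pos_def del: funpow.simps)
            qed
          qed
          moreover have "Suc (Suc n) \<le> g + 3" using g by (cases d2) (auto simp: n_def)
          ultimately show ?thesis by (auto elim: reaches_mono)
        qed
        have "reaches (bstep x) (g + 1 + g + (g + 3)) Y ?Z"
          using r1 r2 r3 r4 by (blast intro: reaches_trans)
        then have "reaches (bstep x) (3 * g + 4) Y ?Z" by (rule reaches_mono) simp
        then show ?thesis using val unfolding st by auto
      qed
    qed
  qed
  then show "valid (wstep \<delta> x X)"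
    "\<exists>Z. reaches (bstep x) (3 * g + 4) Y Z \<and> embeds (wstep \<delta> x X) Z"
    by auto
qed

lemma valid_step: "valid X \<Longrightarrow> valid (wstep \<delta> x X)"
proof -
  assume "valid X"
  moreover have "\<exists>Y. embeds X Y"
  proof -
    obtain q i ws h ct p r where "X = (q, i, ws, h, ct, p, r)" by (metis prod_cases7)
    then have "embeds X (Rd q [], i, flat ws, pos h, ct, p, r)" by simp
    then show ?thesis ..
  qed
  ultimately show ?thesis using embeds_step(1) by blast
qed

theorem binary_machine:
  obtains M where "wf_machine M"
    "\<And>x K \<tau> n q i ws h ct p r. reaches (wstep \<delta> x) n (q0, 0, replicate K w0, 0, \<tau>, 0, None)
         (q, i, ws, h, ct, p, Some r) \<Longrightarrow>
       \<exists>t\<le>n * (3 * g + 4). res (run M x (g * K) \<tau> t) = Some r \<and> ctape (run M x (g * K) \<tau> t) = ct"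
proof -
  have "Rd q0 [] \<in> states" using q0 by simp
  then obtain M where wf: "wf_machine M" and run: "\<And>x s \<tau> t q i ws h ct p r.
       (bstep x ^^ t) (Rd q0 [], 0, replicate s False, 0, \<tau>, 0, None) = (q, i, ws, h, ct, p, r)
       \<Longrightarrow> res (run M x s \<tau> t) = r \<and> ctape (run M x s \<tau> t) = ct"
    by (rule numbered_machine[OF finite_states _ states_closed]) (assumption, assumption, rule that)
  show thesis
  proof (rule that[OF wf])
    fix x K \<tau> n q i ws h ct p r
    assume "reaches (wstep \<delta> x) n (q0, 0, replicate K w0, 0, \<tau>, 0, None) (q, i, ws, h, ct, p, Some r)"
    then obtain m where m: "m \<le> n"
      "(wstep \<delta> x ^^ m) (q0, 0, replicate K w0, 0, \<tau>, 0, None) = (q, i, ws, h, ct, p, Some r)"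
      by (auto simp: reaches_def)
    have "flat (replicate K w0) = replicate (g * K) False"
      by (induction K) (simp_all add: w0 replicate_add)
    then have "embeds (q0, 0, replicate K w0, 0, \<tau>, 0, None)
        (Rd q0 [], 0, replicate (g * K) False, 0, \<tau>, 0, None)"
      by (simp add: pos_def)
    moreover have "valid (q0, 0, replicate K w0, 0, \<tau>, 0, None)"
      using q0 w0(1) by auto
    ultimately have "\<exists>Z. reaches (bstep x) (m * (3 * g + 4))
        (Rd q0 [], 0, replicate (g * K) False, 0, \<tau>, 0, None) Z \<and>
        embeds ((wstep \<delta> x ^^ m) (q0, 0, replicate K w0, 0, \<tau>, 0, None)) Z"
      by (intro reaches_funpow[where I = valid and R = embeds and g = "wstep \<delta> x",
            OF valid_step embeds_step(2)])
    then obtain t q' i' ws' h' p' where "t \<le> m * (3 * g + 4)"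
        "(bstep x ^^ t) (Rd q0 [], 0, replicate (g * K) False, 0, \<tau>, 0, None)
          = (q', i', ws', h', ct, p', Some r)"
      unfolding m(2) by (auto simp: reaches_def)
    from this(1) run[OF this(2)] m(1)
    show "\<exists>t\<le>n * (3 * g + 4). res (run M x (g * K) \<tau> t) = Some r
        \<and> ctape (run M x (g * K) \<tau> t) = ct"
      by (intro exI[of _ t]) (auto intro: order_trans[OF _ mult_le_mono1])
  qed
qed

end

section \<open>Sweep machines\<close>

lemma rd_0 [simp]: "rd xs 0 = None"
  by (simp add: rd_def)

lemma wr_0 [simp]: "wr xs 0 w = xs"
  by (simp add: wr_def)

text \<open>The zero word is reserved for \<open>w0\<close>; the cardinalities still allow the other
  letters to be injected into the other words.\<close>

lemma ex_binary_code:
  assumes "finite A" "w0 \<in> A" "card A \<le> 2 ^ g"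
  obtains enc :: "'w \<Rightarrow> bool list" where "inj_on enc A" "\<And>w. w \<in> A \<Longrightarrow> length (enc w) = g"
    "enc w0 = replicate g False"
proof -
  let ?L = "{u :: bool list. length u = g}"
  have L: "finite ?L" "card ?L = 2 ^ g"
    using finite_lists_length_eq[of "UNIV :: bool set" g] card_lists_length_eq[of "UNIV :: bool set" g]
    by simp_all
  have "card (A - {w0}) \<le> card (?L - {replicate g False})"
    using assms L by (simp add: card_Diff_singleton)
  then obtain f where f: "f ` (A - {w0}) \<subseteq> ?L - {replicate g False}" "inj_on f (A - {w0})"
    using card_le_inj[of "A - {w0}" "?L - {replicate g False}"] assms(1) L(1) by auto
  define enc where "enc = f(w0 := replicate g False)"
  have "length (enc w) = g" if "w \<in> A" for w
    using that f(1) by (cases "w = w0") (auto simp: enc_def)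
  moreover have "inj_on enc A"
  proof (rule inj_onI)
    fix v w assume *: "v \<in> A" "w \<in> A" "enc v = enc w"
    have ne: "f u \<noteq> replicate g False" if "u \<in> A" "u \<noteq> w0" for u using f(1) that by auto
    show "v = w"
      using * ne[of v] ne[of w] inj_onD[OF f(2), of v w]
      by (cases "v = w0"; cases "w = w0") (auto simp: enc_def)
  qed
  ultimately show thesis by (intro that[of enc]) (auto simp: enc_def)
qed

text \<open>A sweep machine keeps its memory as a list of columns that is written on the work tape in
reverse order. One macro step runs the work head once to the right end (\<open>down\<close>, reaching the head
of the list last), consults the finite control there, and runs it back (\<open>upward\<close>).\<close>

fun down :: "('d \<Rightarrow> 'w \<Rightarrow> 'd \<times> 'w) \<Rightarrow> 'd \<Rightarrow> 'w list \<Rightarrow> 'd \<times> 'w list" where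
  "down f d [] = (d, [])"
| "down f d (w # ws) = (let (d1, ws1) = down f d ws; (d2, w2) = f d1 w in (d2, w2 # ws1))"

fun upward :: "('u \<Rightarrow> 'w \<Rightarrow> 'u \<times> 'w) \<Rightarrow> 'u \<Rightarrow> 'w list \<Rightarrow> 'w list" where
  "upward f u [] = []"
| "upward f u (w # ws) = (let (u1, w1) = f u w in w1 # upward f u1 ws)"

lemma length_down [simp]: "length (snd (down f d ws)) = length ws"
  by (induction ws) (auto split: prod.splits)

lemma length_upward [simp]: "length (upward f u ws) = length ws"
  by (induction ws arbitrary: u) (auto split: prod.splits)

datatype ('b, 'u) sact = SHalt "bool option" | SGo 'b 'u bool dir dir

type_synonym ('b, 'w) sconf = "'b \<times> nat \<times> 'w list \<times> bool list \<times> nat \<times> bool option option"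

datatype ('b, 'd, 'u) phase = At 'b | Dn 'b 'd | Up 'b 'u

locale sweep =
  fixes act :: "'b \<Rightarrow> 'd \<Rightarrow> bool option \<Rightarrow> bool option \<Rightarrow> ('b, 'u) sact"
    and d0 :: 'd and dn :: "'d \<Rightarrow> 'w \<Rightarrow> 'd \<times> 'w" and up :: "'u \<Rightarrow> 'w \<Rightarrow> 'u \<times> 'w"
    and w0 :: 'w
begin

definition mstep :: "bool list \<Rightarrow> ('b, 'w) sconf \<Rightarrow> ('b, 'w) sconf" where
  "mstep x = (\<lambda>(b, i, cs, ct, p, r).
     if r \<noteq> None then (b, i, cs, ct, p, r) else
     (case act b (fst (down dn d0 cs)) (rd x i) (rd ct p) of
        SHalt r' \<Rightarrow> (b, i, cs, ct, p, Some r')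
      | SGo b' u k d1 d3 \<Rightarrow>
          (b', move d1 (length x) i, upward up u (snd (down dn d0 cs)), wr ct p k,
           move d3 (length ct) p, None)))"

lemma mstep_SHalt: "act b (fst (down dn d0 cs)) (rd x i) (rd ct p) = SHalt r \<Longrightarrow>
    mstep x (b, i, cs, ct, p, None) = (b, i, cs, ct, p, Some r)"
  by (simp add: mstep_def)

lemma mstep_SGo: "act b (fst (down dn d0 cs)) (rd x i) (rd ct p) = SGo b' u k d1 d3 \<Longrightarrow>
    mstep x (b, i, cs, ct, p, None) = (b', move d1 (length x) i, upward up u (snd (down dn d0 cs)),
      wr ct p k, move d3 (length ct) p, None)"
  by (simp add: mstep_def)

primrec \<delta> :: "('b, 'd, 'u) phase \<Rightarrow> bool option \<Rightarrow> 'w option \<Rightarrow> bool option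
    \<Rightarrow> (('b, 'd, 'u) phase, 'w) wact" where
  "\<delta> (At b) a v c = WStep (Dn b d0) (case v of None \<Rightarrow> w0 | Some w \<Rightarrow> w) (keep c) Stay Rgt Stay"
| "\<delta> (Dn b d) a v c = (case v of
     Some w \<Rightarrow> WStep (Dn b (fst (dn d w))) (snd (dn d w)) (keep c) Stay Rgt Stay
   | None \<Rightarrow> (case act b d a c of SHalt r \<Rightarrow> WHalt r
      | SGo b' u k d1 d3 \<Rightarrow> WStep (Up b' u) w0 k d1 Lft d3))"
| "\<delta> (Up b u) a v c = (case v of
     Some w \<Rightarrow> WStep (Up b (fst (up u w))) (snd (up u w)) (keep c) Stay Lft Stay
   | None \<Rightarrow> WStep (At b) w0 (keep c) Stay Stay Stay)"

lemma down_pass: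
  "reaches (wstep \<delta> x) (length cs)
     (Dn b d0, i, rev cs @ R, 1, ct, p, None)
     (Dn b (fst (down dn d0 cs)), i, rev (snd (down dn d0 cs)) @ R, Suc (length cs), ct, p, None)"
proof (induction cs arbitrary: R)
  case Nil
  then show ?case by simp
next
  case (Cons w cs)
  obtain d ws where d: "down dn d0 cs = (d, ws)" by fastforce
  obtain e w' where e: "dn d w = (e, w')" by fastforce
  have l: "length ws = length cs" using d length_down[of dn d0 cs] by simp
  have "rd (rev ws @ w # R) (Suc (length (rev ws))) = Some w"
    "wr (rev ws @ w # R) (Suc (length (rev ws))) w' = rev ws @ w' # R"
    by (rule rd_append wr_append)+
  then have "wstep \<delta> x (Dn b d, i, rev ws @ w # R, Suc (length cs), ct, p, None) =
    (Dn b e, i, rev ws @ w' # R, Suc (Suc (length cs)), ct, p, None)"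
    using l e by (simp add: wstep_def)
  from reaches_trans[OF Cons.IH[of "w # R", unfolded d fst_conv snd_conv]
      reaches_step[where f = "wstep \<delta> x" and b = 1, OF this, simplified]]
  show ?case by (simp add: d e)
qed

lemma up_pass:
  "\<exists>u'. reaches (wstep \<delta> x) (length cs)
     (Up b u, i, rev cs @ R, length cs, ct, p, None)
     (Up b u', i, rev (upward up u cs) @ R, 0, ct, p, None)"
proof (induction cs arbitrary: u R)
  case Nil
  then show ?case by (intro exI[of _ u]) simp
next
  case (Cons w cs)
  obtain e w' where e: "up u w = (e, w')" by fastforce
  have "rd (rev cs @ w # R) (Suc (length (rev cs))) = Some w"
    "wr (rev cs @ w # R) (Suc (length (rev cs))) w' = rev cs @ w' # R"
    by (rule rd_append wr_append)+
  then have 1: "wstep \<delta> x (Up b u, i, rev (w # cs) @ R, length (w # cs), ct, p, None) =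
    (Up b e, i, rev cs @ w' # R, length cs, ct, p, None)"
    using e by (simp add: wstep_def)
  obtain u' where "reaches (wstep \<delta> x) (length cs) (Up b e, i, rev cs @ w' # R, length cs, ct, p, None)
     (Up b u', i, rev (upward up e cs) @ w' # R, 0, ct, p, None)" using Cons.IH by blast
  from reaches_Suc[OF 1 this] show ?case by (auto simp: e)
qed

fun spread :: "('b, 'w) sconf \<Rightarrow> (('b, 'd, 'u) phase, 'w) wconf \<Rightarrow> bool" where
  "spread (b, i, cs, ct, p, r) Y \<longleftrightarrow> (if r = None then Y = (At b, i, rev cs, 0, ct, p, None)
     else \<exists>q i' ws h p'. Y = (q, i', ws, h, ct, p', r))"

lemma spread_step:
  assumes "spread X Y" "length (fst (snd (snd X))) = K"
  shows "\<exists>Z. reaches (wstep \<delta> x) (2 * K + 4) Y Z \<and> spread (mstep x X) Z"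
proof -
  obtain b i cs ct p r where X: "X = (b, i, cs, ct, p, r)" by (metis prod_cases6)
  have K: "length cs = K" using assms X by simp
  show ?thesis
  proof (cases "r = None")
    case False
    then have "mstep x X = X" by (simp add: X mstep_def)
    then show ?thesis using assms reaches_refl[of "wstep \<delta> x" _ Y] by metis
  next
    case True
    have Y: "Y = (At b, i, rev cs, 0, ct, p, None)" using assms(1) X True by simp
    obtain d ws where d: "down dn d0 cs = (d, ws)" by fastforce
    have l: "length ws = K" using d length_down[of dn d0 cs] K by simp
    have "wstep \<delta> x Y = (Dn b d0, i, rev cs @ [], 1, ct, p, None)"
      by (simp add: Y wstep_def)
    from reaches_Suc[OF this down_pass[of x cs b i "[]" ct p, unfolded d fst_conv snd_conv]]
    have r1: "reaches (wstep \<delta> x) (Suc K) Y (Dn b d, i, rev ws, Suc K, ct, p, None)"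
      using K by simp
    have N: "rd (rev ws) (Suc K) = None" "wr (rev ws) (Suc K) w = rev ws" for w
      using l by (auto simp: rd_def wr_def)
    show ?thesis
    proof (cases "act b d (rd x i) (rd ct p)")
      case (SHalt r')
      have "wstep \<delta> x (Dn b d, i, rev ws, Suc K, ct, p, None) = (Dn b d, i, rev ws, Suc K, ct, p, Some r')"
        using SHalt N by (simp add: wstep_def)
      from reaches_trans[OF r1 reaches_step[where f = "wstep \<delta> x" and b = 1, OF this, simplified]]
      have "reaches (wstep \<delta> x) (2 * K + 4) Y (Dn b d, i, rev ws, Suc K, ct, p, Some r')"
        by (rule reaches_mono) simp
      moreover have "mstep x X = (b, i, cs, ct, p, Some r')" using SHalt True d by (simp add: X mstep_def)
      ultimately show ?thesis by auto blast
    next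
      case (SGo b' u k d1 d3)
      let ?i = "move d1 (length x) i" and ?ct = "wr ct p k" and ?p = "move d3 (length ct) p"
      have s2: "wstep \<delta> x (Dn b d, i, rev ws, Suc K, ct, p, None) = (Up b' u, ?i, rev ws, K, ?ct, ?p, None)"
        using SGo N by (simp add: wstep_def)
      obtain u' where r3: "reaches (wstep \<delta> x) K (Up b' u, ?i, rev ws, K, ?ct, ?p, None)
        (Up b' u', ?i, rev (upward up u ws), 0, ?ct, ?p, None)"
        using up_pass[of x ws b' u ?i "[]" ?ct ?p] l by auto
      have "wstep \<delta> x (Up b' u', ?i, rev (upward up u ws), 0, ?ct, ?p, None)
        = (At b', ?i, rev (upward up u ws), 0, ?ct, ?p, None)"
        by (simp add: wstep_def)
      from reaches_trans[OF r1 reaches_Suc[OF s2 reaches_trans[OF r3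
            reaches_step[where f = "wstep \<delta> x" and b = 1, OF this, simplified]]]]
      have "reaches (wstep \<delta> x) (2 * K + 4) Y (At b', ?i, rev (upward up u ws), 0, ?ct, ?p, None)"
        by (rule reaches_mono) simp
      moreover have "mstep x X = (b', ?i, upward up u ws, ?ct, ?p, None)"
        using SGo True d by (simp add: X mstep_def)
      ultimately show ?thesis by auto
    qed
  qed
qed

lemma length_mstep: "length (fst (snd (snd (mstep x X)))) = length (fst (snd (snd X)))"
  by (cases X) (auto simp: mstep_def split: sact.splits)

end

locale finite_sweep = sweep act d0 dn up w0
  for act :: "'b \<Rightarrow> 'd \<Rightarrow> bool option \<Rightarrow> bool option \<Rightarrow> ('b, 'u) sact"
    and d0 :: 'd and dn :: "'d \<Rightarrow> 'w \<Rightarrow> 'd \<times> 'w" and up :: "'u \<Rightarrow> 'w \<Rightarrow> 'u \<times> 'w"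
    and w0 :: 'w +
  fixes B :: "'b set" and D :: "'d set" and U :: "'u set" and A :: "'w set" and b0 :: 'b
  assumes fin: "finite B" "finite D" "finite U" "finite A"
    and init: "b0 \<in> B" "d0 \<in> D" "w0 \<in> A"
    and closed_dn: "\<And>d w. d \<in> D \<Longrightarrow> w \<in> A \<Longrightarrow> dn d w \<in> D \<times> A"
    and closed_up: "\<And>u w. u \<in> U \<Longrightarrow> w \<in> A \<Longrightarrow> up u w \<in> U \<times> A"
    and closed_act: "\<And>b d a c b' u k d1 d3. b \<in> B \<Longrightarrow> d \<in> D \<Longrightarrow> act b d a c = SGo b' u k d1 d3
          \<Longrightarrow> b' \<in> B \<and> u \<in> U"
begin

text \<open>Both layers composed: a macro step on \<open>K\<close> columns costs at most
  \<open>2 * K + 4\<close> wide steps, each of these at most \<open>3 * g + 4\<close> machine steps,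
  and \<open>K\<close> columns fill exactly \<open>g * K\<close> work bits.\<close>

theorem sweep_machine:
  assumes "card A \<le> 2 ^ g" "1 \<le> g"
  obtains M where "wf_machine M"
    "\<And>x K \<tau> n b i cs ct p r. reaches (mstep x) n (b0, 0, replicate K w0, \<tau>, 0, None)
         (b, i, cs, ct, p, Some r) \<Longrightarrow>
       \<exists>t\<le>n * (2 * K + 4) * (3 * g + 4).
         res (run M x (g * K) \<tau> t) = Some r \<and> ctape (run M x (g * K) \<tau> t) = ct"
proof -
  obtain enc :: "'w \<Rightarrow> bool list" where enc: "inj_on enc A" "\<And>w. w \<in> A \<Longrightarrow> length (enc w) = g"
    "enc w0 = replicate g False"
    using ex_binary_code[OF fin(4) init(3) assms(1)] by blast
  let ?Q = "At ` B \<union> (\<lambda>(b, d). Dn b d) ` (B \<times> D) \<union> (\<lambda>(b, u). Up b u) ` (B \<times> U)"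
  have Q: "At b \<in> ?Q \<longleftrightarrow> b \<in> B" "Dn b d \<in> ?Q \<longleftrightarrow> b \<in> B \<and> d \<in> D" "Up b u \<in> ?Q \<longleftrightarrow> b \<in> B \<and> u \<in> U" for b d u
    by auto
  interpret W: wide \<delta> ?Q "At b0" A w0 enc g
  proof
    fix q a v c q' w k d1 d2 d3
    assume q: "q \<in> ?Q" and v: "set_option v \<subseteq> A" and d: "\<delta> q a v c = WStep q' w k d1 d2 d3"
    show "q' \<in> ?Q"
    proof (cases q)
      case (At b)
      then show ?thesis using q d init(2) unfolding At by auto
    next
      case (Dn b e)
      then have *: "b \<in> B" "e \<in> D" using q unfolding Dn Q by auto
      show ?thesis
      proof (cases v)
        case None
        then show ?thesis using d closed_act[OF *] * unfolding Dn by (auto split: sact.splits)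
      next
        case (Some w)
        then show ?thesis using d closed_dn[OF *(2), of w] *(1) v unfolding Dn by auto
      qed
    next
      case (Up b u)
      then have *: "b \<in> B" "u \<in> U" using q unfolding Up Q by auto
      show ?thesis
      proof (cases v)
        case None
        then show ?thesis using d * unfolding Up by auto
      next
        case (Some w)
        then show ?thesis using d closed_up[OF *(2), of w] *(1) v unfolding Up by auto
      qed
    qed
  next
    fix q a v c q' w k d1 d2 d3
    assume q: "q \<in> ?Q" and v: "v \<in> A" and d: "\<delta> q a (Some v) c = WStep q' w k d1 d2 d3"
    show "w \<in> A"
    proof (cases q)
      case (At b)
      then show ?thesis using d v by simp
    next
      case (Dn b e)
      then show ?thesis using q d closed_dn[of e v] v unfolding Dn Q by auto
    next
      case (Up b u)
      then show ?thesis using q d closed_up[of u v] v unfolding Up Q by auto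
    qed
  qed (use fin init enc assms in auto)
  obtain M where wf: "wf_machine M" and M: "\<And>x K \<tau> n q i ws h ct p r.
       reaches (wstep \<delta> x) n (At b0, 0, replicate K w0, 0, \<tau>, 0, None) (q, i, ws, h, ct, p, Some r) \<Longrightarrow>
       \<exists>t\<le>n * (3 * g + 4). res (run M x (g * K) \<tau> t) = Some r \<and> ctape (run M x (g * K) \<tau> t) = ct"
    using W.binary_machine by blast
  show thesis
  proof (rule that[OF wf])
    fix x K \<tau> n b i cs ct p r
    assume "reaches (mstep x) n (b0, 0, replicate K w0, \<tau>, 0, None) (b, i, cs, ct, p, Some r)"
    then obtain m where m: "m \<le> n"
      "(mstep x ^^ m) (b0, 0, replicate K w0, \<tau>, 0, None) = (b, i, cs, ct, p, Some r)"
      by (auto simp: reaches_def)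
    have "\<exists>Z. reaches (wstep \<delta> x) (m * (2 * K + 4)) (At b0, 0, replicate K w0, 0, \<tau>, 0, None) Z \<and>
        spread ((mstep x ^^ m) (b0, 0, replicate K w0, \<tau>, 0, None)) Z"
      by (rule reaches_funpow[where I = "\<lambda>X. length (fst (snd (snd X))) = K" and R = spread,
            OF _ spread_step]) (simp_all add: length_mstep)
    then obtain q i' ws h p' where "reaches (wstep \<delta> x) (m * (2 * K + 4))
        (At b0, 0, replicate K w0, 0, \<tau>, 0, None) (q, i', ws, h, ct, p', Some r)"
      unfolding m(2) by auto
    then have "reaches (wstep \<delta> x) (n * (2 * K + 4))
        (At b0, 0, replicate K w0, 0, \<tau>, 0, None) (q, i', ws, h, ct, p', Some r)"
      by (rule reaches_mono) (use m(1) in simp)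
    from M[OF this] show "\<exists>t\<le>n * (2 * K + 4) * (3 * g + 4).
        res (run M x (g * K) \<tau> t) = Some r \<and> ctape (run M x (g * K) \<tau> t) = ct" .
  qed
qed

end

section \<open>The tour of the configuration forest\<close>

text \<open>Both end markers read as \<open>None\<close>, but whether a move is blocked depends on
  which of them is scanned. Separating them makes the actual head movement a function of the scanned
  symbol.\<close>

datatype sym = LE | RE | Bit bool

definition look :: "bool list \<Rightarrow> nat \<Rightarrow> sym" where
  "look xs h = (if h = 0 then LE else if h \<le> length xs then Bit (xs ! (h - 1)) else RE)"

fun opt :: "sym \<Rightarrow> bool option" where
  "opt (Bit b) = Some b" | "opt _ = None"

fun bitv :: "sym \<Rightarrow> bool" where
  "bitv (Bit b) = b" | "bitv _ = False"

fun over :: "sym \<Rightarrow> bool \<Rightarrow> sym" where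
  "over (Bit _) b = Bit b" | "over y b = y"

fun flip :: "dir \<Rightarrow> dir" where
  "flip Lft = Rgt" | "flip Stay = Stay" | "flip Rgt = Lft"

fun go :: "dir \<Rightarrow> nat \<Rightarrow> nat" where
  "go Lft h = h - 1" | "go Stay h = h" | "go Rgt h = h + 1"

definition ok :: "dir \<Rightarrow> sym \<Rightarrow> bool" where
  "ok d y \<longleftrightarrow> \<not> (d = Lft \<and> y = LE) \<and> \<not> (d = Rgt \<and> y = RE)"

text \<open>A blocked move counts as \<open>Stay\<close>; the actual movement can then be undone by
  its \<open>flip\<close>.\<close>

definition eff :: "dir \<Rightarrow> sym \<Rightarrow> dir" where
  "eff d y = (if ok d y then d else Stay)"

lemma read_cell_look: "read_cell xs h = opt (look xs h)"
  by (auto simp: read_cell_def look_def)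

lemma look_write [simp]: "look (write_cell xs h v) h = over (look xs h) v"
  by (auto simp: look_def write_cell_def)

lemma write_bitv [simp]: "write_cell xs h (bitv (look xs h)) = xs"
  by (auto simp: look_def write_cell_def)

lemma write_write_bitv [simp]: "write_cell (write_cell xs h v) h (bitv (look xs h)) = xs"
  by (auto simp: look_def write_cell_def)

lemma write_write_over: "look xs h = over y w \<Longrightarrow> write_cell (write_cell xs h u) h w = xs"
  by (cases y) (auto simp: look_def write_cell_def list_update_same_conv split: if_splits)

lemma over_over: "y' = over y w \<Longrightarrow> over y' (bitv y) = y"
  by (cases y) auto

lemma length_write_cell [simp]: "length (write_cell xs h v) = length xs"
  by (simp add: write_cell_def)

lemma ok_eff [simp]: "ok (eff d y) y"
  by (simp add: eff_def ok_def)

lemma go_ok: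
  assumes "h \<le> Suc (length xs)" "ok e (look xs h)"
  shows "go e h \<le> Suc (length xs)" "go (flip e) (go e h) = h"
    "length ys = length xs \<Longrightarrow> ok (flip e) (look ys (go e h))"
  using assms by (cases e; auto simp: ok_def look_def split: if_splits)+

lemma flip_flip [simp]: "flip (flip e) = e"
  by (cases e) auto

lemma move_go: "h \<le> Suc (length xs) \<Longrightarrow> ok e (look xs h) \<Longrightarrow> move e (length xs) h = go e h"
  by (cases e) (auto simp: ok_def look_def split: if_splits)

lemma move_eff: "h \<le> Suc (length xs) \<Longrightarrow> move d (length xs) h = go (eff d (look xs h)) h"
  by (cases d) (auto simp: eff_def ok_def look_def split: if_splits)

definition shift :: "dir \<Rightarrow> dir \<Rightarrow> dir \<Rightarrow> conf \<Rightarrow> conf" where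
  "shift e1 e2 e3 C = C\<lparr>ih := go e1 (ih C), wh := go e2 (wh C), chd := go e3 (chd C)\<rparr>"

definition put :: "bool \<Rightarrow> bool \<Rightarrow> conf \<Rightarrow> conf" where
  "put w k C = C\<lparr>wtape := write_cell (wtape C) (wh C) w, ctape := write_cell (ctape C) (chd C) k\<rparr>"

abbreviation symW :: "conf \<Rightarrow> sym" where "symW C \<equiv> look (wtape C) (wh C)"
abbreviation symC :: "conf \<Rightarrow> sym" where "symC C \<equiv> look (ctape C) (chd C)"

locale catalytic =
  fixes M :: machine
  assumes wf: "wf_machine M"
begin

text \<open>All values that the state and the scanned symbols of a predecessor can take. Their
  number is independent of the input, so a slot fits into the finite control.\<close>

definition slots :: "(nat \<times> sym \<times> sym \<times> sym) list" where
  "slots = (let ys = [LE, RE, Bit False, Bit True] in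
     List.product [0..<nstates M] (List.product ys (List.product ys ys)))"

definition m :: nat where "m = length slots"

definition idx :: "nat \<times> sym \<times> sym \<times> sym \<Rightarrow> nat" where
  "idx v = (SOME i. i < m \<and> slots ! i = v)"

lemma set_slots: "set slots = {..<nstates M} \<times> UNIV"
proof -
  have "set [LE, RE, Bit False, Bit True] = UNIV"
  proof (intro equalityI subset_UNIV subsetI)
    show "y \<in> set [LE, RE, Bit False, Bit True]" for y by (cases y) auto
  qed
  then show ?thesis unfolding slots_def Let_def set_product by (simp add: atLeast0LessThan)
qed

lemma distinct_slots: "distinct slots"
  by (simp add: slots_def Let_def distinct_product)

lemma idx: "fst v < nstates M \<Longrightarrow> idx v < m \<and> slots ! idx v = v"
proof -
  assume "fst v < nstates M"
  then have "v \<in> set slots" by (auto simp: set_slots mem_Times_iff)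
  then have "\<exists>i. i < m \<and> slots ! i = v" by (auto simp: in_set_conv_nth m_def)
  then show ?thesis unfolding idx_def by (rule someI_ex)
qed

lemma fst_slots: "i < m \<Longrightarrow> fst (slots ! i) < nstates M"
  using nth_mem[of i slots] by (auto simp: set_slots m_def mem_Times_iff)

lemma idx_slots: "i < m \<Longrightarrow> idx (slots ! i) = i"
  using idx[OF fst_slots, of i] distinct_slots nth_eq_iff_index_eq[of slots] by (auto simp: m_def)

definition nxt :: "nat \<Rightarrow> nat" where "nxt s = (if s = m then 0 else s + 1)"
definition prv :: "nat \<Rightarrow> nat" where "prv s = (if s = 0 then m else s - 1)"

lemma prv_nxt [simp]: "prv (nxt s) = s"
  by (auto simp: nxt_def prv_def)

lemma nxt_le: "s \<le> m \<Longrightarrow> nxt s \<le> m" and prv_le: "s \<le> m \<Longrightarrow> prv s \<le> m"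
  by (auto simp: nxt_def prv_def)

text \<open>Slot \<open>m\<close> of a configuration leads to its successor; slot \<open>s < m\<close> leads to the predecessor,
if there is one, whose state and scanned symbols are \<open>slots ! s\<close>. A predecessor is found by moving
the heads back, checking the symbols there and undoing the writes.\<close>

definition cand ::
  "nat \<Rightarrow> (nat \<times> nat \<times> sym \<times> sym \<times> sym \<times> bool \<times> bool \<times> dir \<times> dir \<times> dir) option" where
  "cand s = (case slots ! s of (q, a, b, k) \<Rightarrow>
     (case delta M q (opt a) (opt b) (opt k) of Halt _ \<Rightarrow> None
      | Step q' w v d1 d2 d3 \<Rightarrow> Some (q, q', a, b, k, w, v, eff d1 a, eff d2 b, eff d3 k)))"

context
  fixes x :: "bool list"
begin

abbreviation symI :: "conf \<Rightarrow> sym" where "symI C \<equiv> look x (ih C)"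

definition todo :: "conf \<Rightarrow> act" where
  "todo C = delta M (st C) (opt (symI C)) (opt (symW C)) (opt (symC C))"

definition key :: "conf \<Rightarrow> nat \<times> sym \<times> sym \<times> sym" where
  "key C = (st C, symI C, symW C, symC C)"

text \<open>An absent edge is a fixed point, which keeps the map total. The test for a predecessor
  has two stages because its scanned symbols are seen only after the heads have moved back.\<close>

definition \<alpha> :: "conf \<times> nat \<Rightarrow> conf \<times> nat" where
  "\<alpha> = (\<lambda>(C, s). if s = m then
       (case todo C of Halt r \<Rightarrow> (C, s)
        | Step q' w v d1 d2 d3 \<Rightarrow> (step M x C, idx (key C)))
     else (case cand s of None \<Rightarrow> (C, s)
        | Some (q, q', a, b, k, w, v, e1, e2, e3) \<Rightarrow>
           if st C = q' \<and> ok (flip e1) (symI C) \<and> ok (flip e2) (symW C) \<and> ok (flip e3) (symC C) then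
             (let C' = shift (flip e1) (flip e2) (flip e3) C in
              if symI C' = a \<and> symW C' = over b w \<and> symC C' = over k v
              then ((put (bitv b) (bitv k) C')\<lparr>st := q\<rparr>, m) else (C, s))
           else (C, s)))"

definition tour :: "conf \<times> nat \<Rightarrow> conf \<times> nat" where
  "tour X = (case \<alpha> X of (C, s) \<Rightarrow> (C, nxt s))"

text \<open>The inverse of \<open>tour\<close>: first undo the shift of the slot, then apply
  \<open>\<alpha>\<close>, which is its own inverse.\<close>

definition tour_back :: "conf \<times> nat \<Rightarrow> conf \<times> nat" where
  "tour_back X = \<alpha> (fst X, prv (snd X))"

context
  fixes l c :: nat
begin

definition legal :: "conf \<Rightarrow> bool" where
  "legal C \<longleftrightarrow> st C < nstates M \<and> ih C \<le> Suc (length x) \<and> length (wtape C) = l \<and> wh C \<le> Suc l \<and>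
     length (ctape C) = c \<and> chd C \<le> Suc c \<and> res C = None"

lemma step_todo:
  assumes "legal C" "todo C = Step q' w v d1 d2 d3"
  shows "step M x C =
    (shift (eff d1 (symI C)) (eff d2 (symW C)) (eff d3 (symC C)) (put w v C))\<lparr>st := q'\<rparr>"
proof -
  have "move d1 (length x) (ih C) = go (eff d1 (symI C)) (ih C)"
    "move d2 (length (wtape C)) (wh C) = go (eff d2 (symW C)) (wh C)"
    "move d3 (length (ctape C)) (chd C) = go (eff d3 (symC C)) (chd C)"
    using assms(1) by (auto simp: legal_def intro!: move_eff)
  then show ?thesis using assms
    by (cases C) (simp add: step_def legal_def todo_def read_cell_look shift_def put_def)
qed

lemma todo_state: "legal C \<Longrightarrow> todo C = Step q' w v d1 d2 d3 \<Longrightarrow> q' < nstates M"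
  using wf unfolding wf_machine_def todo_def legal_def by blast

lemma legal_step:
  assumes "legal C" "todo C = Step q' w v d1 d2 d3"
  shows "legal (step M x C)"
  using assms(1) todo_state[OF assms] unfolding step_todo[OF assms]
  using go_ok(1)[of "ih C" x "eff d1 (symI C)"] go_ok(1)[of "wh C" "wtape C" "eff d2 (symW C)"]
    go_ok(1)[of "chd C" "ctape C" "eff d3 (symC C)"]
  by (auto simp: legal_def shift_def put_def)

text \<open>The slot of arrival is the \<open>key\<close> of the child, from which the step can be
  recomputed. Retreating by the flipped effective moves leads to exactly the cells that the step has
  overwritten, and the key supplies their old contents.\<close>

lemma \<alpha>_parent:
  assumes "legal C" "todo C = Step q' w v d1 d2 d3"
  shows "\<alpha> (C, m) = (step M x C, idx (key C))" "\<alpha> (step M x C, idx (key C)) = (C, m)"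
proof -
  show "\<alpha> (C, m) = (step M x C, idx (key C))" using assms by (simp add: \<alpha>_def)
  have i: "idx (key C) < m" "slots ! idx (key C) = key C"
    using idx[of "key C"] assms(1) by (auto simp: key_def legal_def)
  let ?e1 = "eff d1 (symI C)" and ?e2 = "eff d2 (symW C)" and ?e3 = "eff d3 (symC C)"
  have cand: "cand (idx (key C)) = Some (st C, q', symI C, symW C, symC C, w, v, ?e1, ?e2, ?e3)"
    unfolding cand_def i(2) using assms(2) by (simp add: key_def todo_def)
  have b: "ih C \<le> Suc (length x)" "wh C \<le> Suc (length (wtape C))" "chd C \<le> Suc (length (ctape C))"
    using assms(1) by (auto simp: legal_def)
  note g1 = go_ok[OF b(1) ok_eff[of d1]] and g2 = go_ok[OF b(2) ok_eff[of d2]]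
    and g3 = go_ok[OF b(3) ok_eff[of d3]]
  let ?C = "step M x C"
  have ok: "st ?C = q'" "ok (flip ?e1) (symI ?C)" "ok (flip ?e2) (symW ?C)" "ok (flip ?e3) (symC ?C)"
    unfolding step_todo[OF assms] by (auto simp: shift_def put_def intro: g1 g2 g3)
  have sh: "shift (flip ?e1) (flip ?e2) (flip ?e3) ?C = (put w v C)\<lparr>st := q'\<rparr>"
    unfolding step_todo[OF assms] by (simp add: shift_def put_def g1 g2 g3)
  have pp: "put (bitv (symW C)) (bitv (symC C)) (put w v C\<lparr>st := q'\<rparr>)\<lparr>st := st C\<rparr> = C"
    by (simp add: put_def)
  show "\<alpha> (?C, idx (key C)) = (C, m)"
    using i(1) ok unfolding \<alpha>_def prod.case cand option.case Let_def sh pp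
    by (auto simp: put_def)
qed

text \<open>The local test is sound: if the retreat is not blocked and the cells found there carry
  what the step would have left, the reconstructed configuration is a genuine predecessor.
  \<open>over_over\<close> recovers its scanned symbols.\<close>

lemma \<alpha>_child:
  assumes "legal C" "s < m" "\<alpha> (C, s) \<noteq> (C, s)"
  obtains P q' w v d1 d2 d3 where "\<alpha> (C, s) = (P, m)" "legal P" "todo P = Step q' w v d1 d2 d3"
    "step M x P = C" "idx (key P) = s"
proof -
  obtain q a b k where s: "slots ! s = (q, a, b, k)" by (metis prod_cases4)
  obtain q' w v d1 d2 d3 where d: "delta M q (opt a) (opt b) (opt k) = Step q' w v d1 d2 d3"
    using assms(2,3) by (cases "delta M q (opt a) (opt b) (opt k)") (auto simp: \<alpha>_def cand_def s)
  define e1 e2 e3 where e: "e1 = eff d1 a" "e2 = eff d2 b" "e3 = eff d3 k"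
  have cand: "cand s = Some (q, q', a, b, k, w, v, e1, e2, e3)"
    by (simp add: cand_def s d e)
  define C' where "C' = shift (flip e1) (flip e2) (flip e3) C"
  define P where "P = (put (bitv b) (bitv k) C')\<lparr>st := q\<rparr>"
  have c: "st C = q'" "ok (flip e1) (symI C)" "ok (flip e2) (symW C)" "ok (flip e3) (symC C)"
    "symI C' = a" "symW C' = over b w" "symC C' = over k v" and aC: "\<alpha> (C, s) = (P, m)"
    using assms(2,3) by (auto simp: \<alpha>_def cand P_def C'_def Let_def split: if_splits)
  have q: "q < nstates M" using fst_slots[OF assms(2)] s by simp
  have bd: "ih C \<le> Suc (length x)" "wh C \<le> Suc (length (wtape C))" "chd C \<le> Suc (length (ctape C))"
    using assms(1) by (auto simp: legal_def)
  note g1 = go_ok[OF bd(1) c(2)] and g2 = go_ok[OF bd(2) c(3)] and g3 = go_ok[OF bd(3) c(4)]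
  have legP: "legal P" using assms(1) q g1(1) g2(1) g3(1)
    by (simp add: legal_def P_def C'_def put_def shift_def)
  have symP: "symI P = a" "symW P = b" "symC P = k"
    using c(5) over_over[OF c(6)] over_over[OF c(7)] by (simp_all add: P_def put_def)
  have stP: "st P = q" by (simp add: P_def)
  have todoP: "todo P = Step q' w v d1 d2 d3" by (simp add: todo_def symP stP d)
  have "step M x P = C"
    unfolding step_todo[OF legP todoP] symP e[symmetric]
    using write_write_over[OF c(6)] write_write_over[OF c(7)] g1(2) g2(2) g3(2) c(1)
    by (simp add: shift_def put_def P_def C'_def)
  moreover have "idx (key P) = s" using idx_slots[OF assms(2)] by (simp add: key_def symP stP s)
  ultimately show thesis using aC legP todoP by (intro that) auto
qed

lemma \<alpha>_cases:
  assumes "legal C" "s \<le> m"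
  obtains
    (parent) q' w v d1 d2 d3 where "s = m" "todo C = Step q' w v d1 d2 d3" "\<alpha> (C, s) = (step M x C, idx (key C))"
  | (fixed) "\<alpha> (C, s) = (C, s)" "s = m \<Longrightarrow> \<exists>r. todo C = Halt r"
  | (child) P q' w v d1 d2 d3 where "s < m" "\<alpha> (C, s) = (P, m)" "legal P" "todo P = Step q' w v d1 d2 d3"
      "step M x P = C" "idx (key P) = s"
proof (cases "s = m")
  case True
  show thesis
  proof (cases "todo C")
    case (Halt r)
    then show thesis using True fixed by (simp add: \<alpha>_def)
  next
    case (Step q' w v d1 d2 d3)
    then show thesis using True parent \<alpha>_parent(1)[OF assms(1)] by simp
  qed
next
  case False
  then have s: "s < m" using assms(2) by simp
  show thesis
  proof (cases "\<alpha> (C, s) = (C, s)")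
    case True
    then show thesis using fixed False by blast
  next
    case False
    show thesis by (rule \<alpha>_child[OF assms(1) s False]) (rule child[OF s])
  qed
qed

lemma \<alpha>_involution:
  assumes "legal C" "s \<le> m"
  shows "\<alpha> (\<alpha> (C, s)) = (C, s)"
proof (rule \<alpha>_cases[OF assms])
  fix q' w v d1 d2 d3
  assume "s = m" "todo C = Step q' w v d1 d2 d3" "\<alpha> (C, s) = (step M x C, idx (key C))"
  then show ?thesis using \<alpha>_parent(2)[OF assms(1)] by simp
next
  fix P q' w v d1 d2 d3
  assume "\<alpha> (C, s) = (P, m)" "legal P" "todo P = Step q' w v d1 d2 d3" "step M x P = C" "idx (key P) = s"
  then show ?thesis using \<alpha>_parent(1)[of P] by simp
qed simp

lemma \<alpha>_legal:
  assumes "legal C" "s \<le> m" "\<alpha> (C, s) = (C', s')"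
  shows "legal C' \<and> s' \<le> m"
proof (rule \<alpha>_cases[OF assms(1,2)])
  fix q' w v d1 d2 d3
  assume *: "s = m" "todo C = Step q' w v d1 d2 d3" "\<alpha> (C, s) = (step M x C, idx (key C))"
  have "idx (key C) < m" using idx[of "key C"] assms(1) by (simp add: key_def legal_def)
  then show ?thesis using assms(3) * legal_step[OF assms(1) *(2)] by simp
qed (use assms in simp_all)

lemma tour_legal: "legal C \<Longrightarrow> s \<le> m \<Longrightarrow> tour (C, s) = (C', s') \<Longrightarrow> legal C' \<and> s' \<le> m"
  using \<alpha>_legal[of C s] nxt_le by (cases "\<alpha> (C, s)") (auto simp: tour_def)

lemma tour_back_tour: "legal C \<Longrightarrow> s \<le> m \<Longrightarrow> tour_back (tour (C, s)) = (C, s)"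
  using \<alpha>_involution[of C s] by (cases "\<alpha> (C, s)") (simp add: tour_def tour_back_def)

section \<open>Paths from the root and the absence of repetitions in a tour\<close>

inductive path :: "conf \<Rightarrow> nat list \<Rightarrow> conf \<Rightarrow> bool" where
  path_root: "todo C = Halt r \<Longrightarrow> path C [] C"
| path_step: "todo C = Step q' w v d1 d2 d3 \<Longrightarrow> path (step M x C) ps R \<Longrightarrow> path C (ps @ [idx (key C)]) R"

lemma path_HaltD: "path C ps R \<Longrightarrow> todo C = Halt r \<Longrightarrow> ps = [] \<and> R = C"
  by (erule path.cases) simp_all

lemma path_StepD: "path C ps R \<Longrightarrow> todo C = Step q' w v d1 d2 d3 \<Longrightarrow>
    \<exists>ps'. ps = ps' @ [idx (key C)] \<and> path (step M x C) ps' R"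
  by (erule path.cases) simp_all

text \<open>Determinism: the run of a configuration meets at most one halting configuration, along
  one way.\<close>

lemma path_unique: "path C ps R \<Longrightarrow> path C ps' R' \<Longrightarrow> ps = ps' \<and> R = R'"
proof (induction arbitrary: ps' R' rule: path.induct)
  case (path_root C r)
  show ?case using path_HaltD[OF path_root(2,1)] by simp
next
  case (path_step C q' w v d1 d2 d3 ps R)
  show ?case using path_StepD[OF path_step.prems path_step.hyps(1)] path_step.IH by blast
qed

text \<open>Listing the slots on the way down from the root makes the tour lexicographically increasing;
hence it never repeats a position.\<close>

lemma tour_increasing:
  assumes "legal C" "s \<le> m" "path C ps R" "\<not> (s = m \<and> (\<exists>r. todo C = Halt r))" "tour (C, s) = (C', s')"
  shows "\<exists>ps'. path C' ps' R \<and> (ps @ [s], ps' @ [s']) \<in> lexord less_than"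
proof (rule \<alpha>_cases[OF assms(1,2)])
  fix q' w v d1 d2 d3
  assume *: "s = m" "todo C = Step q' w v d1 d2 d3" "\<alpha> (C, s) = (step M x C, idx (key C))"
  have i: "idx (key C) < m" using idx[of "key C"] assms(1) by (auto simp: key_def legal_def)
  obtain ps' where ps': "ps = ps' @ [idx (key C)]" "path (step M x C) ps' R"
    using path_StepD[OF assms(3) *(2)] by blast
  have "C' = step M x C" "s' = Suc (idx (key C))"
    using assms(5) *(3) i by (auto simp: tour_def nxt_def)
  \<comment> \<open>Return to the parent: the last entry of the path becomes the slot and grows by
    one, without wrapping since it is below \<open>m\<close>. This place decides the
    comparison.\<close>
  moreover have "(ps' @ idx (key C) # [s], ps' @ Suc (idx (key C)) # []) \<in> lexord less_than"
    by (intro lexord_append_leftI) simp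
  ultimately show ?thesis using ps' by auto
next
  \<comment> \<open>No edge at this slot, so only the slot grows. It cannot be \<open>m\<close>,
    because a fixed point there is a halting root, which is excluded.\<close>
  assume *: "\<alpha> (C, s) = (C, s)" "s = m \<Longrightarrow> \<exists>r. todo C = Halt r"
  then have "C' = C" "s' = Suc s" using assms(4,5) by (auto simp: tour_def nxt_def)
  moreover have "(ps @ [s], ps @ [Suc s]) \<in> lexord less_than"
    by (intro lexord_append_leftI) simp
  ultimately show ?thesis using assms(3) by auto
next
  fix P q' w v d1 d2 d3
  assume *: "s < m" "\<alpha> (C, s) = (P, m)" "legal P" "todo P = Step q' w v d1 d2 d3"
      "step M x P = C" "idx (key P) = s"
  then have "C' = P" "s' = 0" using assms(5) by (auto simp: tour_def nxt_def)
  moreover have "path P (ps @ [s]) R" using path_step[OF *(4)] * assms(3) by simp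
  \<comment> \<open>Descent to a child: the old sequence is a proper prefix of the new one.\<close>
  moreover have "(ps @ s # [], ps @ s # [0]) \<in> lexord less_than"
    by (intro lexord_append_leftI) simp
  ultimately show ?thesis by auto
qed

definition stops :: "conf \<times> nat \<Rightarrow> bool" where
  "stops X \<longleftrightarrow> snd X = m \<and> (\<exists>r. todo (fst X) = Halt r)"

text \<open>Trees are grouped by the catalytic tape of the root. As roots are unique, different
  tapes give disjoint sets.\<close>

definition tree :: "bool list \<Rightarrow> conf set" where
  "tree \<tau> = {C. legal C \<and> (\<exists>ps R. path C ps R \<and> ctape R = \<tau>)}"

lemma tour_orbit:
  assumes "legal C" "path C ps R" "\<And>i. i < t \<Longrightarrow> \<not> stops ((tour ^^ i) (C, m))"
  shows "\<exists>C' s' ps'. (tour ^^ t) (C, m) = (C', s') \<and> legal C' \<and> s' \<le> m \<and> path C' ps' R"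
  using assms(3)
proof (induction t)
  case 0
  then show ?case using assms(1,2) by auto
next
  case (Suc t)
  then obtain C' s' ps' where *: "(tour ^^ t) (C, m) = (C', s')" "legal C'" "s' \<le> m" "path C' ps' R"
    by auto
  obtain C'' s'' where t: "tour (C', s') = (C'', s'')" by fastforce
  have "\<not> stops (C', s')" using Suc.prems[of t] *(1) by simp
  with tour_increasing[OF *(2,3,4) _ t] tour_legal[OF *(2,3) t] show ?case
    using * t by (auto simp: stops_def)
qed

text \<open>Path and slot form one sequence that grows lexicographically with every step;
  irreflexivity and transitivity of the order then exclude a repetition.\<close>

lemma tour_inj:
  assumes "legal C" "path C ps R" "\<And>i. i < T \<Longrightarrow> \<not> stops ((tour ^^ i) (C, m))"
  shows "inj_on (\<lambda>i. (tour ^^ i) (C, m)) {..T}"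
proof -
  define K where "K i = (THE ps. path (fst ((tour ^^ i) (C, m))) ps R) @ [snd ((tour ^^ i) (C, m))]" for i
  have inc: "(K i, K (Suc i)) \<in> lexord less_than" if "i < T" for i
  proof -
    have "\<And>j. j < i \<Longrightarrow> \<not> stops ((tour ^^ j) (C, m))" using assms(3) that by simp
    from tour_orbit[OF assms(1,2), of i, OF this] obtain C' s' ps' where
      *: "(tour ^^ i) (C, m) = (C', s')" "legal C'" "s' \<le> m" "path C' ps' R" by auto
    obtain C'' s'' where t: "tour (C', s') = (C'', s'')" by fastforce
    have "\<not> stops (C', s')" using assms(3)[OF that] *(1) by simp
    with tour_increasing[OF *(2,3,4) _ t] obtain ps'' where
      **: "path C'' ps'' R" "(ps' @ [s'], ps'' @ [s'']) \<in> lexord less_than" by (auto simp: stops_def)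
    have "(THE ps. path C' ps R) = ps'" "(THE ps. path C'' ps R) = ps''"
      using path_unique *(4) **(1) by blast+
    then show ?thesis using * ** t by (simp add: K_def)
  qed
  have lt: "(K i, K j) \<in> lexord less_than" if "i < j" "j \<le> T" for i j
    using that
  proof (induction j)
    case (Suc j)
    show ?case
    proof (cases "i = j")
      case True
      then show ?thesis using Suc.prems inc by simp
    next
      case False
      then have "(K i, K j) \<in> lexord less_than" using Suc by simp
      moreover have "(K j, K (Suc j)) \<in> lexord less_than"
        using Suc.prems inc by simp
      ultimately show ?thesis using lexord_trans trans_less_than by blast
    qed
  qed simp
  have irr: "(ks, ks) \<notin> lexord less_than" for ks :: "nat list"
    by (rule lexord_irreflexive) simp
  have Keq: "K i = K j" if "(tour ^^ i) (C, m) = (tour ^^ j) (C, m)" for i j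
    using that by (simp add: K_def)
  show ?thesis
  proof (rule inj_onI)
    fix i j assume "i \<in> {..T}" "j \<in> {..T}" "(tour ^^ i) (C, m) = (tour ^^ j) (C, m)"
    then show "i = j" using lt[of i j] lt[of j i] Keq[of i j] irr by (cases i j rule: linorder_cases) auto
  qed
qed

section \<open>Counting configurations: few tapes have long tours\<close>

lemma finite_legal: "finite {C. legal C}"
  and card_legal: "card {C. legal C} \<le>
    nstates M * ((length x + 2) * (2 ^ l * ((l + 2) * (2 ^ c * (c + 2)))))"
proof -
  let ?f = "\<lambda>C. (st C, ih C, wtape C, wh C, ctape C, chd C)"
  let ?S = "{..<nstates M} \<times> {..Suc (length x)} \<times> {u :: bool list. length u = l} \<times> {..Suc l}
     \<times> {u :: bool list. length u = c} \<times> {..Suc c}"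
  have L: "finite {u :: bool list. length u = n}" "card {u :: bool list. length u = n} = 2 ^ n" for n
    using finite_lists_length_eq[of "UNIV :: bool set" n] card_lists_length_eq[of "UNIV :: bool set" n]
    by simp_all
  have inj: "inj_on ?f {C. legal C}"
    by (rule inj_onI) (auto simp: legal_def intro: conf.equality)
  have sub: "?f ` {C. legal C} \<subseteq> ?S" by (auto simp: legal_def)
  have fin: "finite ?S" by (intro finite_cartesian_product L) auto
  show "finite {C. legal C}" using inj_on_finite[OF inj sub fin] .
  show "card {C. legal C} \<le> nstates M * ((length x + 2) * (2 ^ l * ((l + 2) * (2 ^ c * (c + 2)))))"
    using card_inj_on_le[OF inj sub fin] by (simp add: card_cartesian_product L)
qed

text \<open>Markov's inequality in counting form: each tape in \<open>S\<close> claims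
  \<open>Suc T\<close> distinct pairs of a configuration and a slot inside its own
  \<open>tree\<close>, and altogether there are only \<open>Suc m\<close> pairs for each legal
  configuration.\<close>

lemma long_tours:
  assumes "\<And>\<tau>. \<tau> \<in> S \<Longrightarrow> legal (I \<tau>) \<and> (\<exists>ps R. path (I \<tau>) ps R \<and> ctape R = \<tau>)"
    and "\<And>\<tau> i. \<tau> \<in> S \<Longrightarrow> i < T \<Longrightarrow> \<not> stops ((tour ^^ i) (I \<tau>, m))"
  shows "card S * Suc T \<le> card {C. legal C} * Suc m"
proof -
  have fin: "finite (tree \<tau>)" for \<tau>
    using finite_subset[OF _ finite_legal] by (auto simp: tree_def)
  have big: "Suc T \<le> card (tree \<tau> \<times> {..m})" if "\<tau> \<in> S" for \<tau>
  proof -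
    obtain ps R where *: "legal (I \<tau>)" "path (I \<tau>) ps R" "ctape R = \<tau>" using assms(1)[OF \<open>\<tau> \<in> S\<close>] by blast
    have "(\<lambda>i. (tour ^^ i) (I \<tau>, m)) ` {..T} \<subseteq> tree \<tau> \<times> {..m}"
    proof
      fix y assume "y \<in> (\<lambda>i. (tour ^^ i) (I \<tau>, m)) ` {..T}"
      then obtain i where i: "i \<le> T" "y = (tour ^^ i) (I \<tau>, m)" by auto
      have "\<And>j. j < i \<Longrightarrow> \<not> stops ((tour ^^ j) (I \<tau>, m))" using assms(2)[OF that] i(1) by simp
      from tour_orbit[OF *(1,2), of i, OF this] i(2) *(3) show "y \<in> tree \<tau> \<times> {..m}"
        unfolding tree_def by auto blast
    qed
    from card_mono[OF _ this] card_image[OF tour_inj[OF *(1,2), of T]] assms(2)[OF that] fin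
    show ?thesis by simp
  qed
  have disj: "(tree \<tau> \<times> {..m}) \<inter> (tree \<tau>' \<times> {..m}) = {}" if "\<tau> \<noteq> \<tau>'" for \<tau> \<tau>'
  proof -
    have False if C: "C \<in> tree \<tau>" "C \<in> tree \<tau>'" for C
    proof -
      obtain ps R where 1: "path C ps R" "ctape R = \<tau>" using C(1) unfolding tree_def by blast
      obtain ps' R' where 2: "path C ps' R'" "ctape R' = \<tau>'" using C(2) unfolding tree_def by blast
      show False using path_unique[OF 1(1) 2(1)] 1(2) 2(2) \<open>\<tau> \<noteq> \<tau>'\<close> by simp
    qed
    then show ?thesis by blast
  qed
  show ?thesis
  proof (cases "finite S")
    case True
    have "card S * Suc T \<le> (\<Sum>\<tau>\<in>S. card (tree \<tau> \<times> {..m}))"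
      using sum_bounded_below[of S "Suc T" "\<lambda>\<tau>. card (tree \<tau> \<times> {..m})"] big by simp
    also have "\<dots> = card (\<Union>\<tau>\<in>S. tree \<tau> \<times> {..m})"
      using True fin disj by (intro card_UN_disjoint[symmetric]) auto
    also have "\<dots> \<le> card ({C. legal C} \<times> {..m})"
      by (intro card_mono) (auto simp: finite_legal tree_def)
    finally show ?thesis by (simp add: card_cartesian_product)
  qed simp
qed

text \<open>Connects runs with the forest. Halting changes only \<open>res\<close>, so the root
  already carries the final catalytic tape.\<close>

lemma path_run:
  assumes "legal C" "res ((step M x ^^ t) C) = Some r"
  shows "\<exists>ps R. path C ps R \<and> ctape R = ctape ((step M x ^^ t) C) \<and> todo R = Halt r"
  using assms
proof (induction t arbitrary: C)
  case 0
  then show ?case by (simp add: legal_def)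
next
  case (Suc t)
  show ?case
  proof (cases "todo C")
    case (Halt r')
    then have s: "step M x C = C\<lparr>res := Some r'\<rparr>"
      using Suc.prems(1) by (simp add: step_def todo_def read_cell_look legal_def)
    have "(step M x ^^ n) (C\<lparr>res := Some r'\<rparr>) = C\<lparr>res := Some r'\<rparr>" for n
      by (induction n) (simp_all add: step_def)
    then have "(step M x ^^ Suc t) C = C\<lparr>res := Some r'\<rparr>"
      by (simp add: funpow_simps_right(2) s del: funpow.simps)
    then show ?thesis using Suc.prems(2) path_root[OF Halt] Halt by auto
  next
    case (Step q' w v d1 d2 d3)
    have "(step M x ^^ Suc t) C = (step M x ^^ t) (step M x C)"
      by (simp add: funpow_simps_right(2) del: funpow.simps)
    then show ?thesis
      using Suc.IH[OF legal_step[OF Suc.prems(1) Step]] Suc.prems(2) path_step[OF Step] by metis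
  qed
qed

end
end
end

section \<open>Walking the tour with a clock\<close>

text \<open>An iteration passes through \<open>Top\<close> (select the slot), \<open>Al\<close> and
  possibly \<open>Ck\<close> (cross the edge), \<open>Fin\<close> (tick the clock) and
  \<open>Tst\<close> (is the clock zero?).\<close>

datatype ctl = Top bool nat | Al bool nat | Ck bool nat | Fin bool nat | Tst bool nat | RI | RC

datatype tact = THalt "bool option" | TDo ctl nat bool bool dir dir dir bool

lemma eff_ok [simp]: "ok e y \<Longrightarrow> eff e y = e"
  by (simp add: eff_def)

lemma eff_Stay [simp]: "eff Stay y = Stay"
  by (simp add: eff_def)

lemma put_bitv [simp]: "put (bitv (symW C)) (bitv (symC C)) C = C"
  by (simp add: put_def)

lemma shift_Stay [simp]: "shift Stay Stay Stay C = C"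
  by (simp add: shift_def)

context catalytic
begin

text \<open>The flag of a control state tells whether the tour is walked forwards. \<open>RI\<close> and \<open>RC\<close> take
the input head to the left and the catalytic head to the right end marker.\<close>

definition \<theta> :: "ctl \<Rightarrow> nat \<Rightarrow> sym \<Rightarrow> sym \<Rightarrow> sym \<Rightarrow> bool \<Rightarrow> tact" where
  "\<theta> k q a b c z = (let idle = \<lambda>k'. TDo k' q (bitv b) (bitv c) Stay Stay Stay False in
     case k of
       Top f s \<Rightarrow> idle (Al f (if f then s else prv s))
     | Al f s \<Rightarrow>
        (if s = m then
          (case delta M q (opt a) (opt b) (opt c) of
             Halt r \<Rightarrow> (if r = None then idle RI else THalt r)
           | Step q' w v d1 d2 d3 \<Rightarrow>
               TDo (Fin f (idx (q, a, b, c))) q' w v (eff d1 a) (eff d2 b) (eff d3 c) False)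
         else (case cand s of None \<Rightarrow> idle (Fin f s)
           | Some (q0, q', a', b', c', w, v, e1, e2, e3) \<Rightarrow>
               if q = q' \<and> ok (flip e1) a \<and> ok (flip e2) b \<and> ok (flip e3) c
               then TDo (Ck f s) q (bitv b) (bitv c) (flip e1) (flip e2) (flip e3) False
               else idle (Fin f s)))
     | Ck f s \<Rightarrow>
        (case cand s of None \<Rightarrow> idle RI
         | Some (q0, q', a', b', c', w, v, e1, e2, e3) \<Rightarrow>
             if a = a' \<and> b = over b' w \<and> c = over c' v
             then TDo (Fin f m) q0 (bitv b') (bitv c') Stay Stay Stay False
             else TDo (Fin f s) q (bitv b) (bitv c) e1 e2 e3 False)
     | Fin f s \<Rightarrow> TDo (Tst f (if f then nxt s else s)) q (bitv b) (bitv c) Stay Stay Stay True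
     | Tst f s \<Rightarrow> idle (if z then (if f then Top False s else RI) else Top f s)
     | RI \<Rightarrow> if a = LE then idle RC else TDo RI q (bitv b) (bitv c) Lft Stay Stay False
     | RC \<Rightarrow> if c = RE then THalt None else TDo RC q (bitv b) (bitv c) Stay Stay Rgt False)"

context
  fixes x :: "bool list" and TT :: nat
begin

definition tstep :: "ctl \<times> conf \<times> nat \<Rightarrow> ctl \<times> conf \<times> nat" where
  "tstep = (\<lambda>(k, C, t). if res C \<noteq> None then (k, C, t) else
     (case \<theta> k (st C) (symI x C) (symW C) (symC C) (t = 0) of
        THalt r \<Rightarrow> (k, C\<lparr>res := Some r\<rparr>, t)
      | TDo k' q' w v e1 e2 e3 tk \<Rightarrow>
          (k', (shift (eff e1 (symI x C)) (eff e2 (symW C)) (eff e3 (symC C)) (put w v C))\<lparr>st := q'\<rparr>,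
           if tk then Suc t mod TT else t)))"

context
  fixes l c :: nat
begin

abbreviation leg :: "conf \<Rightarrow> bool" where "leg \<equiv> legal x l c"

lemma legal_bounds:
  "leg C \<Longrightarrow> ih C \<le> Suc (length x)" "leg C \<Longrightarrow> wh C \<le> Suc (length (wtape C))"
  "leg C \<Longrightarrow> chd C \<le> Suc (length (ctape C))" "leg C \<Longrightarrow> res C = None"
  by (auto simp: legal_def)

lemma tstep_Top: "leg C \<Longrightarrow> tstep (Top f s, C, t) = (Al f (if f then s else prv s), C, t)"
  by (simp add: tstep_def \<theta>_def legal_bounds Let_def)

lemma tstep_Fin: "leg C \<Longrightarrow> tstep (Fin f s, C, t) = (Tst f (if f then nxt s else s), C, Suc t mod TT)"
  by (simp add: tstep_def \<theta>_def legal_bounds Let_def)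

lemma tstep_Tst: "leg C \<Longrightarrow> tstep (Tst f s, C, t) =
    (if t = 0 then (if f then Top False s else RI) else Top f s, C, t)"
  by (simp add: tstep_def \<theta>_def legal_bounds Let_def)

lemma tstep_stop:
  "leg C \<Longrightarrow> todo x C = Halt r \<Longrightarrow> tstep (Al f m, C, t) =
    (if r = None then (RI, C, t) else (Al f m, C\<lparr>res := Some r\<rparr>, t))"
  by (simp add: tstep_def \<theta>_def legal_bounds todo_def Let_def)

text \<open>Looking for a predecessor takes two steps: \<open>Al\<close> moves the heads back and
  \<open>Ck\<close> compares the symbols found there. On a mismatch \<open>Ck\<close> moves the
  heads forward again, which \<open>go_ok\<close> shows to restore the configuration.\<close>

lemma reaches_Al:
  assumes "leg C" "s \<le> m" "\<not> stops x (C, s)" "\<alpha> x (C, s) = (C', s')"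
  shows "reaches tstep 2 (Al f s, C, t) (Fin f s', C', t)"
proof (cases "s = m")
  case True
  then obtain q' w v d1 d2 d3 where d: "todo x C = Step q' w v d1 d2 d3"
    using assms(3) by (cases "todo x C") (auto simp: stops_def)
  then have "tstep (Al f s, C, t) = (Fin f s', C', t)"
    using assms(4) True step_todo[OF assms(1) d]
    by (simp add: tstep_def \<theta>_def legal_bounds[OF assms(1)] todo_def \<alpha>_def key_def Let_def)
  then show ?thesis by (rule reaches_step) simp
next
  case False
  show ?thesis
  proof (cases "cand s")
    case None
    then have "tstep (Al f s, C, t) = (Fin f s', C', t)"
      using assms(4) False legal_bounds(4)[OF assms(1)] by (auto simp: tstep_def \<theta>_def \<alpha>_def Let_def)
    then show ?thesis by (rule reaches_step) simp
  next
    case (Some v)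
    obtain q0 q' a b k w u e1 e2 e3 where "v = (q0, q', a, b, k, w, u, e1, e2, e3)"
      by (cases v) auto
    with Some have cand: "cand s = Some (q0, q', a, b, k, w, u, e1, e2, e3)" by simp
    show ?thesis
    proof (cases "st C = q' \<and> ok (flip e1) (symI x C) \<and> ok (flip e2) (symW C) \<and> ok (flip e3) (symC C)")
      case False
      then have "\<alpha> x (C, s) = (C, s)" using \<open>s \<noteq> m\<close> by (auto simp: \<alpha>_def cand)
      moreover have "tstep (Al f s, C, t) = (Fin f s, C, t)"
        using False \<open>s \<noteq> m\<close> by (auto simp: tstep_def \<theta>_def legal_bounds[OF assms(1)] cand Let_def)
      ultimately show ?thesis using assms(4) by (auto intro: reaches_step)
    next
      case True
      define D where "D = shift (flip e1) (flip e2) (flip e3) C"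
      have s1: "tstep (Al f s, C, t) = (Ck f s, D, t)"
        using True \<open>s \<noteq> m\<close> by (simp add: tstep_def \<theta>_def legal_bounds[OF assms(1)] cand D_def Let_def shift_def)
      have resD: "res D = None" using legal_bounds[OF assms(1)] by (simp add: D_def shift_def)
      have okD: "ok e1 (symI x D)" "ok e2 (symW D)" "ok e3 (symC D)"
        and undo: "shift e1 e2 e3 D = C"
        using go_ok[OF legal_bounds(1)[OF assms(1)], of "flip e1"]
          go_ok[OF legal_bounds(2)[OF assms(1)], of "flip e2"]
          go_ok[OF legal_bounds(3)[OF assms(1)], of "flip e3"] True
        by (simp_all add: D_def shift_def)
      have "tstep (Ck f s, D, t) = (Fin f s', C', t)"
      proof (cases "symI x D = a \<and> symW D = over b w \<and> symC D = over k u")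
        case match: True
        have "\<alpha> x (C, s) = ((put (bitv b) (bitv k) D)\<lparr>st := q0\<rparr>, m)"
          using match True \<open>s \<noteq> m\<close> by (simp add: \<alpha>_def cand D_def Let_def)
        then show ?thesis using match assms(4) resD by (auto simp: tstep_def \<theta>_def cand Let_def)
      next
        case no_match: False
        have "\<alpha> x (C, s) = (C, s)"
          using no_match True \<open>s \<noteq> m\<close> by (auto simp: \<alpha>_def cand D_def Let_def)
        moreover have "\<theta> (Ck f s) (st D) (symI x D) (symW D) (symC D) (t = 0) =
            TDo (Fin f s) (st D) (bitv (symW D)) (bitv (symC D)) e1 e2 e3 False"
          using no_match by (auto simp: \<theta>_def cand Let_def)
        moreover have "C\<lparr>st := st D\<rparr> = C" by (simp add: D_def shift_def)
        ultimately show ?thesis using assms(4) resD okD undo by (simp add: tstep_def)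
      qed
      from reaches_Suc[where f = tstep, OF s1 reaches_step[where f = tstep and b = 1, OF this]]
      show ?thesis by (simp add: numeral_2_eq_2)
    qed
  qed
qed

lemma reaches_forward:
  assumes "leg C" "s \<le> m" "\<not> stops x (C, s)" "tour x (C, s) = (C', s')"
  shows "reaches tstep 4 (Top True s, C, t) (Tst True s', C', Suc t mod TT)"
proof -
  obtain s1 where a: "\<alpha> x (C, s) = (C', s1)" "s' = nxt s1"
    using assms(4) by (auto simp: tour_def split: prod.splits)
  have l: "leg C'" using \<alpha>_legal[OF assms(1,2) a(1)] by simp
  from reaches_trans[OF reaches_Al[OF assms(1-3) a(1), of True t]
      reaches_step[where f = tstep and b = 1, OF tstep_Fin[OF l]]]
  have "reaches tstep 3 (Al True s, C, t) (Tst True s', C', Suc t mod TT)"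
    using a(2) by simp
  from reaches_Suc[where f = tstep, OF tstep_Top[OF assms(1)], of 3] this show ?thesis by simp
qed

text \<open>The condition on \<open>stops\<close> is there because \<open>Al\<close> reacts to slot
  \<open>m\<close> of a halting configuration in the same way in both directions.\<close>

lemma reaches_backward:
  assumes "leg C" "s \<le> m" "\<not> stops x (C, prv s)" "tour_back x (C, s) = (C', s')"
  shows "reaches tstep 4 (Top False s, C, t) (Tst False s', C', Suc t mod TT)"
proof -
  have a: "\<alpha> x (C, prv s) = (C', s')" using assms(4) by (simp add: tour_back_def)
  have l: "leg C'" using \<alpha>_legal[OF assms(1) prv_le[OF assms(2)] a] by simp
  from reaches_trans[OF reaches_Al[OF assms(1) prv_le[OF assms(2)] assms(3) a, of False t]
      reaches_step[where f = tstep and b = 1, OF tstep_Fin[OF l]]]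
  have "reaches tstep 3 (Al False (prv s), C, t) (Tst False s', C', Suc t mod TT)"
    by simp
  from reaches_Suc[where f = tstep, OF tstep_Top[OF assms(1)], of 3] this show ?thesis by simp
qed

lemma reaches_RC:
  assumes "leg C"
  shows "reaches tstep (length x + c + 5) (RI, C, t) (RC, C\<lparr>ih := 0, chd := Suc c\<rparr>, t)"
proof -
  have I: "reaches tstep (Suc (ih C)) (RI, C, t) (RC, C\<lparr>ih := 0\<rparr>, t)" if "leg C" for C
    using that
  proof (induction "ih C" arbitrary: C)
    case 0
    then have "symI x C = LE" "C\<lparr>ih := 0\<rparr> = C" by (simp_all add: look_def)
    then have "tstep (RI, C, t) = (RC, C\<lparr>ih := 0\<rparr>, t)"
      using 0 by (simp add: tstep_def \<theta>_def legal_bounds Let_def)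
    then show ?case by (rule reaches_step) simp
  next
    case (Suc i)
    then have a: "symI x C \<noteq> LE" by (simp add: look_def)
    have s: "tstep (RI, C, t) = (RI, C\<lparr>ih := i\<rparr>, t)"
      using Suc.hyps(2)[symmetric] Suc.prems a
      by (simp add: tstep_def \<theta>_def legal_bounds Let_def eff_def ok_def shift_def)
    have "leg (C\<lparr>ih := i\<rparr>)" using Suc.hyps(2) Suc.prems by (simp add: legal_def)
    from reaches_Suc[where f = tstep, OF s Suc.hyps(1)[OF _ this]] Suc.hyps(2) show ?case by simp
  qed
  have R: "reaches tstep (Suc c - chd C) (RC, C, t) (RC, C\<lparr>chd := Suc c\<rparr>, t)" if "leg C" for C
    using that
  proof (induction "Suc c - chd C" arbitrary: C)
    case 0
    then have "chd C = Suc c" by (simp add: legal_def)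
    then have "C\<lparr>chd := Suc c\<rparr> = C" by (metis conf.surjective conf.update_convs(6))
    then show ?case by simp
  next
    case (Suc i)
    then have "symC C \<noteq> RE" by (auto simp: look_def legal_def)
    then have s: "tstep (RC, C, t) = (RC, C\<lparr>chd := Suc (chd C)\<rparr>, t)"
      using Suc.prems by (simp add: tstep_def \<theta>_def legal_bounds Let_def eff_def ok_def shift_def)
    have "leg (C\<lparr>chd := Suc (chd C)\<rparr>)" using Suc.hyps(2) Suc.prems by (simp add: legal_def)
    from reaches_Suc[where f = tstep, OF s Suc.hyps(1)[OF _ this]] Suc.hyps(2)
    show ?case by (cases "chd C \<le> c") (simp_all add: Suc_diff_le)
  qed
  have "leg (C\<lparr>ih := 0\<rparr>)" using assms by (simp add: legal_def)
  from reaches_trans[OF I[OF assms] R[OF this]] show ?thesis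
    by (rule reaches_mono) (use legal_bounds[OF assms] in auto)
qed

definition clock_bound :: nat where
  "clock_bound = 10 * TT + length x + c + 10"

text \<open>Four of the five steps per iteration come from \<open>reaches_forward\<close>; the fifth
  is \<open>Tst\<close>, which sees a non-zero clock as long as \<open>i < TT\<close>.\<close>

lemma forward_loop:
  assumes "leg C" "path x C ps R" "i < TT" "\<And>j. j < i \<Longrightarrow> \<not> stops x ((tour x ^^ j) (C, m))"
    and "(tour x ^^ i) (C, m) = (C', s')"
  shows "reaches tstep (5 * i) (Top True m, C, 0) (Top True s', C', i)"
  using assms(3-5)
proof (induction i arbitrary: C' s')
  case 0
  then show ?case by simp
next
  case (Suc i)
  obtain C1 s1 where 1: "(tour x ^^ i) (C, m) = (C1, s1)" "leg C1" "s1 \<le> m"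
    using tour_orbit[OF assms(1,2), of i] Suc.prems(2) by auto
  have t: "tour x (C1, s1) = (C', s')" using Suc.prems(3) 1(1) by simp
  have n: "\<not> stops x (C1, s1)" using Suc.prems(2)[of i] 1(1) by simp
  have l: "leg C'" using tour_legal[OF 1(2,3) t] by simp
  have IH: "reaches tstep (5 * i) (Top True m, C, 0) (Top True s1, C1, i)"
    using Suc.IH[OF _ _ 1(1)] Suc.prems by simp
  have "tstep (Tst True s', C', Suc i mod TT) = (Top True s', C', Suc i)"
    using Suc.prems(1) by (simp add: tstep_Tst[OF l])
  from reaches_trans[OF reaches_trans[OF IH reaches_forward[OF 1(2,3) n t]]
      reaches_step[where f = tstep and b = 1, OF this]]
  show ?case by (simp add: algebra_simps)
qed

lemma reaches_timeout:
  assumes "leg C" "path x C ps R" "0 < TT" "\<And>j. j < TT \<Longrightarrow> \<not> stops x ((tour x ^^ j) (C, m))"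
  shows "reaches tstep (10 * TT) (Top True m, C, 0) (RI, C, 0)"
proof -
  define X where "X j = (tour x ^^ j) (C, m)" for j
  have X: "leg (fst (X j)) \<and> snd (X j) \<le> m" if "j \<le> TT" for j
    using tour_orbit[OF assms(1,2), of j] assms(4) that by (auto simp: X_def)
  have Xt: "tour x (X j) = X (Suc j)" for j by (simp add: X_def)
  have Xb: "tour_back x (X (Suc j)) = X j" if "j \<le> TT" for j
    using tour_back_tour[of x l c "fst (X j)" "snd (X j)"] X[OF that] Xt[of j] by simp
  \<comment> \<open>The way back never faces a halting root at slot \<open>m\<close>:
    \<open>\<alpha>\<close> fixes that position, so the forward walk would have been there already
    and would have stopped.\<close>
  have ns: "\<not> stops x (fst (X (Suc j)), prv (snd (X (Suc j))))" if "j < TT" for j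
  proof
    assume s: "stops x (fst (X (Suc j)), prv (snd (X (Suc j))))"
    obtain C' s' where a: "\<alpha> x (X j) = (C', s')" by fastforce
    then have "X (Suc j) = (C', nxt s')" using Xt[of j] by (simp add: tour_def)
    then have *: "s' = m" "\<exists>r. todo x C' = Halt r" using s by (auto simp: stops_def)
    then have "\<alpha> x (C', s') = (C', s')" by (auto simp: \<alpha>_def)
    then have "X j = (C', s')"
      using \<alpha>_involution[of x l c "fst (X j)" "snd (X j)"] X[of j] that a by simp
    then show False using assms(4)[OF that] * by (auto simp: stops_def X_def)
  qed
  \<comment> \<open>The last iteration in each direction is treated apart, since there the clock
    wraps to 0 and \<open>Tst\<close> branches.\<close>
  obtain N where N: "TT = Suc N" using assms(3) by (cases TT) auto
  have up: "reaches tstep (5 * TT) (Top True m, C, 0) (Top False (snd (X TT)), fst (X TT), 0)"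
  proof -
    have "reaches tstep (5 * N) (Top True m, C, 0) (Top True (snd (X N)), fst (X N), N)"
      using forward_loop[OF assms(1,2), of N "fst (X N)" "snd (X N)"] assms(4) by (simp add: N X_def)
    moreover have "reaches tstep 4 (Top True (snd (X N)), fst (X N), N) (Tst True (snd (X TT)), fst (X TT), 0)"
      using reaches_forward[of "fst (X N)" "snd (X N)" "fst (X TT)" "snd (X TT)" N] X[of N] assms(4)[of N] Xt[of N]
      by (simp add: N X_def)
    moreover have "tstep (Tst True (snd (X TT)), fst (X TT), 0) = (Top False (snd (X TT)), fst (X TT), 0)"
      using X[of TT] by (simp add: tstep_Tst)
    ultimately have "reaches tstep (5 * N + 4 + 1) (Top True m, C, 0) (Top False (snd (X TT)), fst (X TT), 0)"
      by (intro reaches_trans[OF reaches_trans] reaches_step[where f = tstep and b = 1]) auto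
    then show ?thesis by (simp add: N)
  qed
  have iter: "reaches tstep 4 (Top False (snd (X (Suc j))), fst (X (Suc j)), t)
      (Tst False (snd (X j)), fst (X j), Suc t mod TT)" if "j < TT" for j t
    using reaches_backward[of "fst (X (Suc j))" "snd (X (Suc j))" "fst (X j)" "snd (X j)" t]
      X[of "Suc j"] ns[OF that] Xb[of j] that by simp
  have dn: "reaches tstep (5 * i) (Top False (snd (X TT)), fst (X TT), 0)
      (Top False (snd (X (TT - i))), fst (X (TT - i)), i)" if "i < TT" for i
    using that
  proof (induction i)
    case (Suc i)
    have e: "TT - i = Suc (TT - Suc i)" using Suc.prems by simp
    have "tstep (Tst False (snd (X (TT - Suc i))), fst (X (TT - Suc i)), Suc i mod TT)
        = (Top False (snd (X (TT - Suc i))), fst (X (TT - Suc i)), Suc i)"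
      using X[of "TT - Suc i"] Suc.prems by (simp add: tstep_Tst)
    from reaches_trans[OF reaches_trans[OF Suc.IH[unfolded e] iter[of "TT - Suc i" i]]
        reaches_step[where f = tstep and b = 1, OF this]] Suc.prems
    show ?case by (simp add: algebra_simps)
  qed simp
  have "X 0 = (C, m)" by (simp add: X_def)
  then have "reaches tstep 4 (Top False (snd (X (TT - N))), fst (X (TT - N)), N) (Tst False m, C, 0)"
    using iter[of 0 N] by (simp add: N)
  moreover have "tstep (Tst False m, C, 0) = (RI, C, 0)" using assms(1) by (simp add: tstep_Tst)
  ultimately have "reaches tstep (5 * TT + (5 * N + (4 + 1))) (Top True m, C, 0) (RI, C, 0)"
    using up dn[of N]
    by (intro reaches_trans[OF up reaches_trans[OF dn[of N] reaches_trans]]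
        reaches_step[where f = tstep and b = 1]) (auto simp: N)
  then show ?thesis by (rule reaches_mono) (simp add: N)
qed

text \<open>A root with result \<open>None\<close> needs no walk back, because its tape is the
  initial one by assumption. This case and the timeout end alike, with the heads placed so that
  another block can follow.\<close>

theorem reaches_block:
  assumes "leg C" "path x C ps R" "0 < TT" "todo x R = Halt r" "ctape R = ctape C"
  shows "(\<exists>C' t v. r = Some v \<and> reaches tstep clock_bound (Top True m, C, 0) (Al True m, C', t) \<and>
            res C' = Some r \<and> ctape C' = ctape C) \<or>
      ((r = None \<or> (\<forall>j<TT. \<not> stops x ((tour x ^^ j) (C, m)))) \<and>
       (\<exists>C' t. reaches tstep clock_bound (Top True m, C, 0) (RC, C', t) \<and>
            leg C' \<and> ctape C' = ctape C \<and> ih C' = 0 \<and> chd C' = Suc c))"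
proof (cases "\<forall>j<TT. \<not> stops x ((tour x ^^ j) (C, m))")
  case True
  from reaches_trans[OF reaches_timeout[OF assms(1-3)] reaches_RC[OF assms(1)]] True
  have "reaches tstep (10 * TT + (length x + c + 5)) (Top True m, C, 0) (RC, C\<lparr>ih := 0, chd := Suc c\<rparr>, 0)"
    by simp
  then have "reaches tstep clock_bound (Top True m, C, 0) (RC, C\<lparr>ih := 0, chd := Suc c\<rparr>, 0)"
    by (rule reaches_mono) (simp add: clock_bound_def)
  moreover have "leg (C\<lparr>ih := 0, chd := Suc c\<rparr>)" using assms(1) by (simp add: legal_def)
  ultimately show ?thesis using True
    by (intro disjI2 conjI exI[of _ "C\<lparr>ih := 0, chd := Suc c\<rparr>"] exI[of _ 0]) simp_all
next
  case False
  define i where "i = (LEAST j. j < TT \<and> stops x ((tour x ^^ j) (C, m)))"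
  have i: "i < TT" "stops x ((tour x ^^ i) (C, m))"
    using LeastI_ex[of "\<lambda>j. j < TT \<and> stops x ((tour x ^^ j) (C, m))"] False by (auto simp: i_def)
  have before: "\<not> stops x ((tour x ^^ j) (C, m))" if "j < i" for j
    using not_less_Least[of j "\<lambda>j. j < TT \<and> stops x ((tour x ^^ j) (C, m))"] that i(1) by (auto simp: i_def)
  obtain C1 s1 ps1 where 1: "(tour x ^^ i) (C, m) = (C1, s1)" "leg C1" "path x C1 ps1 R"
    using tour_orbit[OF assms(1,2), of i] before by auto
  have s1: "s1 = m" and "\<exists>r. todo x C1 = Halt r" using i(2) 1(1) by (auto simp: stops_def)
  \<comment> \<open>The tour keeps its root, so a halting configuration met on the tour is the end
    of the original run.\<close>
  then have R: "R = C1" using path_HaltD[OF 1(3)] by blast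
  have "reaches tstep (5 * i) (Top True m, C, 0) (Top True m, C1, i)"
    using forward_loop[OF assms(1,2) i(1) _ 1(1)] before s1 by simp
  from reaches_trans[OF this reaches_step[where f = tstep and b = 1, OF tstep_Top[OF 1(2)]]]
  have t: "reaches tstep (5 * i + 1) (Top True m, C, 0) (Al True m, C1, i)" by simp
  note stop = tstep_stop[OF 1(2) assms(4)[unfolded R], of True i]
  show ?thesis
  proof (cases r)
    case None
    with stop have "tstep (Al True m, C1, i) = (RI, C1, i)" by simp
    from reaches_trans[OF reaches_trans[OF t reaches_step[where f = tstep and b = 1, OF this]] reaches_RC[OF 1(2)]]
    have "reaches tstep (5 * i + 1 + 1 + (length x + c + 5)) (Top True m, C, 0)
        (RC, C1\<lparr>ih := 0, chd := Suc c\<rparr>, i)" by simp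
    then have "reaches tstep clock_bound (Top True m, C, 0) (RC, C1\<lparr>ih := 0, chd := Suc c\<rparr>, i)"
      by (rule reaches_mono) (use i(1) in \<open>simp add: clock_bound_def\<close>)
    moreover have "leg (C1\<lparr>ih := 0, chd := Suc c\<rparr>)" using 1(2) by (simp add: legal_def)
    ultimately show ?thesis using None assms(5) R
      by - (rule disjI2, intro conjI exI[of _ "C1\<lparr>ih := 0, chd := Suc c\<rparr>"] exI[of _ i], simp_all)
  next
    case (Some v)
    with stop have "tstep (Al True m, C1, i) = (Al True m, C1\<lparr>res := Some r\<rparr>, i)" by simp
    from reaches_trans[OF t reaches_step[where f = tstep and b = 1, OF this]]
    have "reaches tstep (5 * i + 1 + 1) (Top True m, C, 0) (Al True m, C1\<lparr>res := Some r\<rparr>, i)" by simp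
    then have "reaches tstep clock_bound (Top True m, C, 0) (Al True m, C1\<lparr>res := Some r\<rparr>, i)"
      by (rule reaches_mono) (use i(1) in \<open>simp add: clock_bound_def\<close>)
    then show ?thesis using Some assms(5) R
      by (intro disjI1 exI[of _ "C1\<lparr>res := Some r\<rparr>"] exI[of _ i] exI[of _ v]) simp
  qed
qed

end
end
end

section \<open>The clocked tour as a sweep machine\<close>

fun val :: "nat \<Rightarrow> nat list \<Rightarrow> nat" where
  "val D [] = 0"
| "val D (d # ds) = d + D * val D ds"

fun ripple :: "nat \<Rightarrow> nat \<Rightarrow> (nat \<times> nat) list \<Rightarrow> nat list" where
  "ripple D c [] = []"
| "ripple D c ((d, a) # ps) = (d + a + c) mod D # ripple D ((d + a + c) div D) ps"

lemma val_less: "\<forall>d\<in>set ds. d < D \<Longrightarrow> val D ds < D ^ length ds"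
proof (induction ds)
  case (Cons d ds)
  have "d + D * val D ds < D + D * val D ds" using Cons.prems by simp
  also have "\<dots> = D * Suc (val D ds)" by simp
  also have "\<dots> \<le> D * D ^ length ds" using Cons by (intro mult_le_mono2) simp
  finally show ?case by simp
qed simp

lemma val_eq_0: "0 < D \<Longrightarrow> val D ds = 0 \<longleftrightarrow> (\<forall>d\<in>set ds. d = 0)"
  by (induction ds) auto

lemma val_inj: "\<forall>d\<in>set ds. d < D \<Longrightarrow> \<forall>d\<in>set es. d < D \<Longrightarrow> length ds = length es \<Longrightarrow>
    val D ds = val D es \<Longrightarrow> ds = es"
proof (induction ds arbitrary: es)
  case (Cons d ds)
  then obtain e es' where es: "es = e # es'" by (cases es) auto
  have eq: "d + D * val D ds = e + D * val D es'" and lt: "d < D" "e < D" using Cons.prems es by auto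
  have "d = (d + D * val D ds) mod D" using lt by simp
  also have "\<dots> = e" using lt eq by simp
  finally have "d = e" .
  moreover from this eq lt have "val D ds = val D es'" by auto
  ultimately show ?case using Cons.IH[of es'] Cons.prems es by simp
qed simp

text \<open>This numeral stands for -1 modulo \<open>D ^ n\<close>, so left moves of a head use the
  same carry chain as right moves.\<close>

lemma val_replicate: "0 < D \<Longrightarrow> Suc (val D (replicate n (D - 1))) = D ^ n"
proof (induction n)
  case (Suc n)
  have "Suc (val D (replicate (Suc n) (D - 1))) = D * Suc (val D (replicate n (D - 1)))"
    using Suc.prems by simp
  then show ?case unfolding Suc.IH[OF Suc.prems] by simp
qed simp

lemma val_replicate_0 [simp]: "val D (replicate n 0) = 0"
  by (induction n) auto

lemma val_ripple:
  assumes "0 < D"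
  shows "val D (ripple D c ps) = (val D (map fst ps) + val D (map snd ps) + c) mod D ^ length ps"
proof (induction ps arbitrary: c)
  case (Cons q ps)
  obtain d a where q: "q = (d, a)" by fastforce
  let ?V = "val D (map fst ps) + val D (map snd ps)"
  have e: "d + D * val D (map fst ps) + (a + D * val D (map snd ps)) + c = d + a + c + D * ?V"
    by (simp add: algebra_simps)
  have "(d + a + c + D * ?V) mod (D * D ^ length ps)
      = D * ((d + a + c + D * ?V) div D mod D ^ length ps) + (d + a + c + D * ?V) mod D"
    by (rule mod_mult2_eq)
  moreover have "(d + a + c + D * ?V) div D = ?V + (d + a + c) div D"
    using assms by simp
  ultimately show ?case unfolding q by (simp add: Cons.IH e del: distrib_left)
qed simp

lemma ripple_less: "0 < D \<Longrightarrow> d \<in> set (ripple D c ps) \<Longrightarrow> d < D"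
  by (induction ps arbitrary: c) auto

text \<open>A column carries a cell \<open>cW\<close> of the simulated work tape, the mark \<open>cH\<close> of its head, the
mark \<open>cX\<close> of the next column (recorded on the way down), and one base-\<open>D\<close> digit each of the
position on the simulated catalytic tape, of the position of its right end marker, and of the clock.\<close>

datatype col = Col (cW: bool) (cH: bool) (cX: "bool option") (cP: nat) (cE: nat) (cT: nat)

text \<open>\<open>CMove\<close> performs a simulated step and \<open>CReset\<close> prepares the
  second block. \<open>CIncE\<close>, \<open>CAddPE\<close> and \<open>CMovEP\<close> compute the
  simulated tape length by repeated addition: \<open>E := E + 1\<close>, \<open>P := P + E\<close>,
  and \<open>E := P\<close> together with \<open>P := 0\<close>.\<close>

datatype cmd = CMove bool dir dir bool bool | CReset | CIncE | CAddPE | CMovEP | CNop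

text \<open>\<open>IA\<close>, \<open>IW\<close> and \<open>IM\<close> compute the length:
  \<open>i\<close> counts multiplications and \<open>j\<close> counts summands up to 2, for the sake
  of \<open>max 2 n\<close>. In \<open>Rn\<close> the first flag marks the second block; the last
  two tell which marker a \<open>None\<close> on the input or work tape stands for.\<close>

datatype base = IA | IW nat | IM nat nat | Rn bool ctl nat bool bool

type_synonym scan = "bool option \<times> bool \<times> bool \<times> bool \<times> bool option"

text \<open>\<open>cX\<close> is filled here because a left shift of the head mark needs the mark of
  the following column, which the upward pass has not yet seen.\<close>

fun dn :: "scan \<Rightarrow> col \<Rightarrow> scan \<times> col" where
  "dn (f, pz, pe, tz, h) (Col W H X P E T) =
     ((if H then Some W else f, pz \<and> P = 0, pe \<and> P = E, tz \<and> T = 0, Some H), Col W H h P E T)"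

abbreviation scan0 :: scan where "scan0 \<equiv> (None, True, True, True, None)"

fun annot :: "col list \<Rightarrow> col list" where
  "annot [] = []"
| "annot (Col W H X P E T # cs) =
     Col W H (case cs of [] \<Rightarrow> None | c # _ \<Rightarrow> Some (cH c)) P E T # annot cs"

fun found :: "col list \<Rightarrow> bool option" where
  "found [] = None"
| "found (c # cs) = (if cH c then Some (cW c) else found cs)"

lemma down_dn: "down dn scan0 cs =
  ((found cs, \<forall>c\<in>set cs. cP c = 0, \<forall>c\<in>set cs. cP c = cE c, \<forall>c\<in>set cs. cT c = 0,
    case cs of [] \<Rightarrow> None | c # _ \<Rightarrow> Some (cH c)), annot cs)"
proof (induction cs)
  case (Cons c cs)
  then show ?case by (cases c) auto
qed simp

lemma length_annot [simp]: "length (annot cs) = length cs"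
  by (induction cs rule: annot.induct) auto

lemma cX_annot: "i < length cs \<Longrightarrow>
   cX (annot cs ! i) = (if Suc i < length cs then Some (cH (cs ! Suc i)) else None)"
proof (induction cs arbitrary: i rule: annot.induct)
  case (2 W H X P E T cs)
  then show ?case by (cases i; cases cs) auto
qed simp

lemma map_annot [simp]: "map cW (annot cs) = map cW cs" "map cH (annot cs) = map cH cs"
   "map cP (annot cs) = map cP cs" "map cE (annot cs) = map cE cs" "map cT (annot cs) = map cT cs"
  by (induction cs rule: annot.induct) auto

text \<open>The Boolean of \<open>CMove\<close> that comes last tells whether the simulated head enters the tape
from the right; a decrement is the addition of \<open>D ^ K - 1\<close>.\<close>

fun up :: "nat \<Rightarrow> cmd \<times> bool \<times> nat \<times> nat \<Rightarrow> col \<Rightarrow> (cmd \<times> bool \<times> nat \<times> nat) \<times> col" where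
  "up D (CMove w e2 e3 tk iR, h, p, t) (Col W H X P E T) =
     (let P' = P + (if e3 = Lft then D - 1 else 0) + p; T' = T + 0 + t in
      ((CMove w e2 e3 tk iR, H, P' div D, T' div D),
       Col (if H then w else W)
         (case e2 of Stay \<Rightarrow> H | Rgt \<Rightarrow> h | Lft \<Rightarrow> (case X of None \<Rightarrow> iR | Some h' \<Rightarrow> h'))
         X (P' mod D) E (T' mod D)))"
| "up D (CReset, s) (Col W H X P E T) = ((CReset, s), Col False False X 0 E 0)"
| "up D (CIncE, h, p, t) (Col W H X P E T) =
     ((CIncE, h, (E + 0 + p) div D, t), Col W H X P ((E + 0 + p) mod D) T)"
| "up D (CAddPE, h, p, t) (Col W H X P E T) =
     ((CAddPE, h, (P + E + p) div D, t), Col W H X ((P + E + p) mod D) E T)"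
| "up D (CMovEP, s) (Col W H X P E T) = ((CMovEP, s), Col W H X 0 P T)"
| "up D (CNop, s) c = ((CNop, s), c)"

text \<open>An increment is the addition of 0 with initial carry 1.\<close>

definition start :: "cmd \<Rightarrow> bool \<Rightarrow> cmd \<times> bool \<times> nat \<times> nat" where
  "start u h = (case u of
     CMove w e2 e3 tk iR \<Rightarrow> (u, h, if e3 = Rgt then 1 else 0, if tk then 1 else 0)
   | CIncE \<Rightarrow> (u, h, 1, 0) | _ \<Rightarrow> (u, h, 0, 0))"

lemma move_tracks:
  "map cP (upward (up D) (CMove w e2 e3 tk iR, h, p, t) cs) =
     ripple D p (map (\<lambda>c. (cP c, if e3 = Lft then D - 1 else 0)) cs)"
  "map cE (upward (up D) (CMove w e2 e3 tk iR, h, p, t) cs) = map cE cs"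
  "map cT (upward (up D) (CMove w e2 e3 tk iR, h, p, t) cs) = ripple D t (map (\<lambda>c. (cT c, 0)) cs)"
  "map cW (upward (up D) (CMove w e2 e3 tk iR, h, p, t) cs) = map (\<lambda>c. if cH c then w else cW c) cs"
proof (induction cs arbitrary: h p t)
  case (Cons c cs)
  {
    case 1 show ?case using Cons(1) by (cases c) (simp add: Let_def)
  next
    case 2 show ?case using Cons(2) by (cases c) (simp add: Let_def)
  next
    case 3 show ?case using Cons(3) by (cases c) (simp add: Let_def)
  next
    case 4 show ?case using Cons(4) by (cases c) (simp add: Let_def)
  }
qed simp_all

lemma move_marks: "i < length cs \<Longrightarrow>
   cH (upward (up D) (CMove w e2 e3 tk iR, h, p, t) cs ! i) =
     (case e2 of Stay \<Rightarrow> cH (cs ! i) | Rgt \<Rightarrow> (if i = 0 then h else cH (cs ! (i - 1)))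
      | Lft \<Rightarrow> (case cX (cs ! i) of None \<Rightarrow> iR | Some h' \<Rightarrow> h'))"
proof (induction cs arbitrary: h p t i)
  case (Cons c cs)
  show ?case
  proof (cases i)
    case 0
    then show ?thesis by (cases c; cases e2) (simp_all add: Let_def)
  next
    case (Suc j)
    then show ?thesis using Cons.IH[of j] Cons.prems
      by (cases c; cases e2; cases j) (simp_all add: Let_def)
  qed
qed simp

lemma reset_tracks:
  "map cP (upward (up D) (CReset, s) cs) = replicate (length cs) 0"
  "map cE (upward (up D) (CReset, s) cs) = map cE cs"
  "map cT (upward (up D) (CReset, s) cs) = replicate (length cs) 0"
  "map cW (upward (up D) (CReset, s) cs) = replicate (length cs) False"
  "map cH (upward (up D) (CReset, s) cs) = replicate (length cs) False"
proof (induction cs)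
  case (Cons c cs)
  {
    case 1 show ?case using Cons(1) by (cases c) simp
  next
    case 2 show ?case using Cons(2) by (cases c) simp
  next
    case 3 show ?case using Cons(3) by (cases c) simp
  next
    case 4 show ?case using Cons(4) by (cases c) simp
  next
    case 5 show ?case using Cons(5) by (cases c) simp
  }
qed simp_all

lemma IncE_tracks:
  "map cP (upward (up D) (CIncE, h, p, t) cs) = map cP cs"
  "map cE (upward (up D) (CIncE, h, p, t) cs) = ripple D p (map (\<lambda>c. (cE c, 0)) cs)"
  "map cT (upward (up D) (CIncE, h, p, t) cs) = map cT cs"
  "map cW (upward (up D) (CIncE, h, p, t) cs) = map cW cs"
  "map cH (upward (up D) (CIncE, h, p, t) cs) = map cH cs"
proof (induction cs arbitrary: p)
  case (Cons c cs)
  {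
    case 1 show ?case using Cons(1) by (cases c) simp
  next
    case 2 show ?case using Cons(2) by (cases c) simp
  next
    case 3 show ?case using Cons(3) by (cases c) simp
  next
    case 4 show ?case using Cons(4) by (cases c) simp
  next
    case 5 show ?case using Cons(5) by (cases c) simp
  }
qed simp_all

lemma AddPE_tracks:
  "map cP (upward (up D) (CAddPE, h, p, t) cs) = ripple D p (map (\<lambda>c. (cP c, cE c)) cs)"
  "map cE (upward (up D) (CAddPE, h, p, t) cs) = map cE cs"
  "map cT (upward (up D) (CAddPE, h, p, t) cs) = map cT cs"
  "map cW (upward (up D) (CAddPE, h, p, t) cs) = map cW cs"
  "map cH (upward (up D) (CAddPE, h, p, t) cs) = map cH cs"
proof (induction cs arbitrary: p)
  case (Cons c cs)
  {
    case 1 show ?case using Cons(1) by (cases c) simp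
  next
    case 2 show ?case using Cons(2) by (cases c) simp
  next
    case 3 show ?case using Cons(3) by (cases c) simp
  next
    case 4 show ?case using Cons(4) by (cases c) simp
  next
    case 5 show ?case using Cons(5) by (cases c) simp
  }
qed simp_all

lemma MovEP_tracks:
  "map cP (upward (up D) (CMovEP, s) cs) = replicate (length cs) 0"
  "map cE (upward (up D) (CMovEP, s) cs) = map cP cs"
  "map cT (upward (up D) (CMovEP, s) cs) = map cT cs"
  "map cW (upward (up D) (CMovEP, s) cs) = map cW cs"
  "map cH (upward (up D) (CMovEP, s) cs) = map cH cs"
proof (induction cs)
  case (Cons c cs)
  {
    case 1 show ?case using Cons(1) by (cases c) simp
  next
    case 2 show ?case using Cons(2) by (cases c) simp
  next
    case 3 show ?case using Cons(3) by (cases c) simp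
  next
    case 4 show ?case using Cons(4) by (cases c) simp
  next
    case 5 show ?case using Cons(5) by (cases c) simp
  }
qed simp_all

lemma Nop_tracks: "upward (up D) (CNop, s) cs = cs"
  by (induction cs) simp_all

text \<open>A scanned \<open>None\<close> does not tell the two end markers apart, so the control
  keeps a flag, updated by \<open>turn\<close>. It matters on a marker only, and a marker reached by
  a left move is the left one.\<close>

definition side :: "bool \<Rightarrow> bool option \<Rightarrow> sym" where
  "side r a = (case a of Some b \<Rightarrow> Bit b | None \<Rightarrow> if r then RE else LE)"

fun turn :: "bool \<Rightarrow> dir \<Rightarrow> bool" where
  "turn s Lft = False" | "turn s Stay = s" | "turn s Rgt = True"

lemma side_look:
  "h \<le> Suc (length xs) \<Longrightarrow> (h = 0 \<longrightarrow> \<not> s) \<Longrightarrow> (h = Suc (length xs) \<longrightarrow> s) \<Longrightarrow> side s (rd xs h) = look xs h"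
  by (auto simp: side_def rd_def look_def)

lemma turn_go:
  assumes "h \<le> Suc n" "h = 0 \<longrightarrow> \<not> s" "h = Suc n \<longrightarrow> s" "e = Lft \<longrightarrow> h \<noteq> 0" "e = Rgt \<longrightarrow> h \<noteq> Suc n"
  shows "go e h \<le> Suc n" "go e h = 0 \<longrightarrow> \<not> turn s e" "go e h = Suc n \<longrightarrow> turn s e"
  using assms by (cases e; auto)+

text \<open>\<open>e\<close> is the exponent of the simulated machine. In the case
  \<open>e = 0\<close> that machine has no work tape, although columns are still needed for the
  counters.\<close>

locale clocked = catalytic M for M +
  fixes e D :: nat
  assumes D: "2 \<le> D"
begin

text \<open>The simulated catalytic tape is a window of the real one, and its markers are recognised
  by \<open>P = 0\<close> and \<open>P = E\<close>. The real cell under such a marker may be a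
  genuine cell outside the window, so it is written back unchanged. At the end of the first block
  one move left brings the head to the left marker of the second.\<close>

definition act :: "base \<Rightarrow> scan \<Rightarrow> bool option \<Rightarrow> bool option \<Rightarrow> (base, cmd \<times> bool \<times> nat \<times> nat) sact" where
  "act b d a c = (case d of (f, pz, pe, tz, _) \<Rightarrow> (case b of
     IA \<Rightarrow> SGo (IW 0) (start CIncE False) (keep c) Stay Stay
   | IW i \<Rightarrow>
      (if a \<noteq> None then SGo (IW i) (start CNop False) (keep c) Lft Stay
       else if i < e then SGo (IM i 0) (start CNop False) (keep c) Rgt Stay
       else SGo (Rn False (Top True m) 0 False False) (start CIncE False) (keep c) Stay Stay)
   | IM i j \<Rightarrow>
      (if a \<noteq> None then SGo (IM i (min 2 (Suc j))) (start CAddPE False) (keep c) Rgt Stay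
       else if j < 2 then SGo (IM i (Suc j)) (start CAddPE False) (keep c) Stay Stay
       else SGo (IW (Suc i)) (start CMovEP False) (keep c) Lft Stay)
   | Rn blk k q sI sW \<Rightarrow>
      (let yI = side sI a; yW = side sW f; yC = (if pz then LE else if pe then RE else Bit (keep c)) in
       if k = RC \<and> yC = RE \<and> \<not> blk
       then SGo (Rn True (Top True m) 0 False False) (start CReset False) (keep c) Stay Lft
       else (case \<theta> k q yI yW yC tz of THalt r \<Rightarrow> SHalt r
         | TDo k' q' w v e1 e2 e3 tk \<Rightarrow>
             SGo (Rn blk k' q' (turn sI (eff e1 yI)) (turn sW (eff e2 yW)))
               (start (CMove w (eff e2 yW) (eff e3 yC) tk (yW = RE \<and> 0 < e)) (yW = LE \<and> 0 < e))
               (if pz \<or> pe then keep c else v) (eff e1 yI) (eff e3 yC)))))"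

abbreviation col0 :: col where "col0 \<equiv> Col False False None 0 0 0"

sublocale sweep act scan0 dn "up D" col0 .

abbreviation vP where "vP cs \<equiv> val D (map cP cs)"
abbreviation vE where "vE cs \<equiv> val D (map cE cs)"
abbreviation vT where "vT cs \<equiv> val D (map cT cs)"

definition digits :: "col list \<Rightarrow> bool" where
  "digits cs \<longleftrightarrow> (\<forall>d \<in> set (map cP cs) \<union> set (map cE cs) \<union> set (map cT cs). d < D)"

context
  fixes x :: "bool list" and K l c :: nat
  assumes l: "l = (if e = 0 then 0 else K)" and c: "Suc c < D ^ K"
begin

text \<open>\<open>E\<close> holds the position \<open>Suc c\<close> of the right end marker. The
  test \<open>0 < e\<close> keeps the head mark off the columns when the simulated work tape is
  empty.\<close>

definition cols :: "col list \<Rightarrow> bool list \<Rightarrow> nat \<Rightarrow> nat \<Rightarrow> nat \<Rightarrow> bool" where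
  "cols cs wt h p t \<longleftrightarrow> length cs = K \<and> digits cs \<and> wt = (if e = 0 then [] else map cW cs) \<and>
     (\<forall>i<K. cH (cs ! i) \<longleftrightarrow> 0 < e \<and> h = Suc i) \<and> vP cs = p \<and> vE cs = Suc c \<and> vT cs = t"

lemma found_rd:
  "\<forall>i<length cs. cH (cs ! i) \<longleftrightarrow> b \<and> h = Suc i \<Longrightarrow> found cs = (if b then rd (map cW cs) h else None)"
proof (induction cs arbitrary: h)
  case Nil
  then show ?case by (auto simp: rd_def)
next
  case (Cons a cs)
  have 0: "cH a \<longleftrightarrow> b \<and> h = 1" using Cons.prems by force
  have "\<forall>i<length cs. cH (cs ! i) \<longleftrightarrow> b \<and> h - 1 = Suc i"
  proof (intro allI impI)
    fix i assume "i < length cs"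
    then have "cH ((a # cs) ! Suc i) \<longleftrightarrow> b \<and> h = Suc (Suc i)" using Cons.prems by (metis Suc_less_eq length_Cons)
    then show "cH (cs ! i) \<longleftrightarrow> b \<and> h - 1 = Suc i" by auto
  qed
  from Cons.IH[OF this] 0 show ?case
    by (cases h) (auto simp: rd_def nth_Cons split: nat.split)
qed

lemma found_cols: "cols cs wt h p t \<Longrightarrow> found cs = rd wt h"
  using found_rd[of cs "0 < e" h] by (simp add: cols_def rd_def)

lemma D_pos: "0 < D" using D by simp

lemma val_lt: "length cs = K \<Longrightarrow> digits cs \<Longrightarrow> vP cs < D ^ K \<and> vE cs < D ^ K \<and> vT cs < D ^ K"
  using val_less[of "map cP cs" D] val_less[of "map cE cs" D] val_less[of "map cT cs" D]
  by (simp add: digits_def)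

text \<open>Digit-wise tests made in one pass decide equality of numbers, because numerals of equal
  length with digits below \<open>D\<close> are unique.\<close>

lemma flags_cols:
  assumes "cols cs wt h p t"
  shows "(\<forall>a\<in>set cs. cP a = 0) \<longleftrightarrow> p = 0" "(\<forall>a\<in>set cs. cP a = cE a) \<longleftrightarrow> p = Suc c"
    "(\<forall>a\<in>set cs. cT a = 0) \<longleftrightarrow> t = 0"
proof -
  have *: "digits cs" "vP cs = p" "vE cs = Suc c" "vT cs = t" using assms by (auto simp: cols_def)
  show "(\<forall>a\<in>set cs. cP a = 0) \<longleftrightarrow> p = 0" using val_eq_0[OF D_pos, of "map cP cs"] * by simp
  show "(\<forall>a\<in>set cs. cT a = 0) \<longleftrightarrow> t = 0" using val_eq_0[OF D_pos, of "map cT cs"] * by simp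
  have "map cP cs = map cE cs" if "vP cs = vE cs"
    using val_inj[of "map cP cs" D "map cE cs"] *(1) that by (simp add: digits_def)
  then have "vP cs = vE cs \<longleftrightarrow> map cP cs = map cE cs" by metis
  also have "\<dots> \<longleftrightarrow> (\<forall>a\<in>set cs. cP a = cE a)" by auto
  finally show "(\<forall>a\<in>set cs. cP a = cE a) \<longleftrightarrow> p = Suc c" using * by simp
qed

lemma annot_nth: "i < length cs \<Longrightarrow> cH (annot cs ! i) = cH (cs ! i)" "i < length cs \<Longrightarrow> cW (annot cs ! i) = cW (cs ! i)"
  using nth_map[of i "annot cs" cH] nth_map[of i "annot cs" cW] by simp_all

text \<open>One sweep shifts the head mark, writes the work cell and updates the position and the
  clock. The bounds on \<open>p\<close> and on \<open>Suc c\<close> keep the position from wrapping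
  modulo \<open>D ^ K\<close>, whereas the clock is meant to wrap.\<close>

lemma cols_move:
  assumes cs: "cols cs wt h p t" and h: "h \<le> Suc l" "ok e2 (look wt h)"
    and p: "p \<le> Suc c" "e3 = Lft \<longrightarrow> p \<noteq> 0" "e3 = Rgt \<longrightarrow> p \<noteq> Suc c"
  shows "cols (upward (up D) (start (CMove w e2 e3 tk (look wt h = RE \<and> 0 < e)) (look wt h = LE \<and> 0 < e)) (annot cs))
     (write_cell wt h w) (go e2 h) (go e3 p) (if tk then Suc t mod D ^ K else t)"
proof -
  let ?R = "look wt h = RE \<and> 0 < e" and ?L = "look wt h = LE \<and> 0 < e"
  let ?cp = "if e3 = Rgt then 1 else 0 :: nat" and ?ct = "if tk then 1 else 0 :: nat"
  define ds where "ds = upward (up D) (CMove w e2 e3 tk ?R, ?L, ?cp, ?ct) (annot cs)"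
  have st: "start (CMove w e2 e3 tk ?R) ?L = (CMove w e2 e3 tk ?R, ?L, ?cp, ?ct)" by (simp add: start_def)
  note tr = move_tracks[of D w e2 e3 tk ?R ?L ?cp ?ct "annot cs", folded ds_def]
  have K: "length cs = K" "length ds = K" and dig: "digits cs" and wt: "wt = (if e = 0 then [] else map cW cs)"
    and H: "\<And>i. i < K \<Longrightarrow> cH (cs ! i) \<longleftrightarrow> 0 < e \<and> h = Suc i"
    and v: "vP cs = p" "vE cs = Suc c" "vT cs = t"
    using cs by (auto simp: cols_def ds_def)
  have lt: "t < D ^ K" using val_lt[OF K(1) dig] v by simp
  have mP: "map (\<lambda>a. (cP a, z)) (annot cs) = map (\<lambda>d. (d, z)) (map cP cs)" for z :: nat
    by (subst map_annot(3)[symmetric]) (simp only: map_map o_def)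
  have mT: "map (\<lambda>a. (cT a, z)) (annot cs) = map (\<lambda>d. (d, z)) (map cT cs)" for z :: nat
    by (subst map_annot(5)[symmetric]) (simp only: map_map o_def)
  have pair: "map fst (map (\<lambda>d. (d, z)) u) = u" "map snd (map (\<lambda>d. (d, z)) u) = replicate (length u) z" for u and z :: nat
    by (simp_all add: o_def map_replicate_const)
  have vPd: "vP ds = go e3 p"
  proof -
    have "vP ds = (p + val D (replicate K (if e3 = Lft then D - 1 else 0)) + ?cp) mod D ^ K"
      unfolding tr(1) mP val_ripple[OF D_pos] pair using K v by simp
    also have "\<dots> = go e3 p"
    proof (cases e3)
      case Lft
      have eq: "p + val D (replicate K (D - 1)) = p - 1 + D ^ K"
        using val_replicate[OF D_pos, of K] p(2) Lft by simp
      have "(p - 1 + D ^ K) mod D ^ K = p - 1" unfolding mod_add_self2 using p(1) c by simp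
      then have "(p + val D (replicate K (D - 1)) + 0) mod D ^ K = p - 1" unfolding eq by simp
      then show ?thesis using Lft by simp
    qed (use p c in auto)
    finally show ?thesis .
  qed
  have vTd: "vT ds = (if tk then Suc t mod D ^ K else t)"
    unfolding tr(3) mT val_ripple[OF D_pos] pair using K v lt by simp
  have digd: "digits ds"
    unfolding digits_def tr(1-3) using ripple_less[OF D_pos] dig by (auto simp: digits_def)
  have Wd: "write_cell wt h w = (if e = 0 then [] else map cW ds)"
  proof (cases "e = 0")
    case False
    have "map cW ds ! i = write_cell wt h w ! i" if "i < K" for i
    proof -
      have "map cW ds ! i = (if cH (cs ! i) then w else cW (cs ! i))"
        unfolding tr(4) using that K by (simp add: annot_nth)
      then show ?thesis using H[OF that] False that K by (auto simp: wt write_cell_def nth_list_update)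
    qed
    then show ?thesis using False K by (intro nth_equalityI) (auto simp: wt)
  qed (simp add: wt write_cell_def)
  have Hd: "cH (ds ! i) \<longleftrightarrow> 0 < e \<and> go e2 h = Suc i" if i: "i < K" for i
  proof -
    have *: "cH (ds ! i) = (case e2 of Stay \<Rightarrow> cH (cs ! i) | Rgt \<Rightarrow> (if i = 0 then ?L else cH (cs ! (i - 1)))
      | Lft \<Rightarrow> (case cX (annot cs ! i) of None \<Rightarrow> ?R | Some h' \<Rightarrow> h'))"
      unfolding ds_def using move_marks[of i "annot cs"] i K
      by (cases e2; cases i) (simp_all add: annot_nth)
    show ?thesis
    proof (cases e2)
      case Stay
      then show ?thesis using * H[OF i] by simp
    next
      case Rgt
      have "look wt h = LE \<longleftrightarrow> h = 0" by (simp add: look_def)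
      then show ?thesis using * H[of "i - 1"] i Rgt by (cases i) auto
    next
      case Lft
      have R: "0 < e \<Longrightarrow> look wt h = RE \<longleftrightarrow> h = Suc K" using h(1) l K by (auto simp: look_def wt)
      have "h \<noteq> 0" using h(2) Lft by (auto simp: ok_def look_def split: if_splits)
      show ?thesis
      proof (cases "Suc i < K")
        case True
        then show ?thesis using * H[OF True] K Lft cX_annot[of i cs] i by auto
      next
        case False
        then have "Suc i = K" using i by simp
        then show ?thesis using * R K Lft cX_annot[of i cs] i \<open>h \<noteq> 0\<close> by auto
      qed
    qed
  qed
  show ?thesis unfolding st ds_def[symmetric] cols_def
    using K digd Wd Hd vPd vTd tr(2) v by simp
qed

lemma okD: "ok d (look xs h) \<Longrightarrow> (d = Lft \<longrightarrow> h \<noteq> 0) \<and> (d = Rgt \<longrightarrow> h \<noteq> Suc (length xs))"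
  by (auto simp: ok_def look_def split: if_splits)

definition bd :: "conf \<Rightarrow> bool" where
  "bd C \<longleftrightarrow> ih C \<le> Suc (length x) \<and> length (wtape C) = l \<and> wh C \<le> Suc l \<and> length (ctape C) = c \<and> chd C \<le> Suc c"

text \<open>The same frame \<open>pre\<close>, \<open>post\<close> is kept along a simulation, which
  shows that the tape outside the block is never disturbed.\<close>

fun Rel :: "bool \<Rightarrow> bool list \<Rightarrow> bool list \<Rightarrow> ctl \<times> conf \<times> nat \<Rightarrow> (base, col) sconf \<Rightarrow> bool" where
  "Rel blk pre post (k, C, t) S \<longleftrightarrow> bd C \<and>
     (if res C = None then \<exists>sI sW cs. S = (Rn blk k (st C) sI sW, ih C, cs, pre @ ctape C @ post, length pre + chd C, None) \<and>
          (ih C = 0 \<longrightarrow> \<not> sI) \<and> (ih C = Suc (length x) \<longrightarrow> sI) \<and> (wh C = 0 \<longrightarrow> \<not> sW) \<and> (wh C = Suc l \<longrightarrow> sW) \<and>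
          cols cs (wtape C) (wh C) (chd C) t
      else \<exists>b i cs p. S = (b, i, cs, pre @ ctape C @ post, p, res C))"

text \<open>The excluded case is where the machines part: at the right marker of the first block
  \<open>tstep\<close> gives up, while \<open>mstep\<close> goes on to the second block.\<close>

lemma Rel_step:
  assumes R: "Rel blk pre post (k, C, t) S" and nx: "\<not> (res C = None \<and> k = RC \<and> symC C = RE \<and> \<not> blk)"
  shows "Rel blk pre post (tstep x (D ^ K) (k, C, t)) (mstep x S)"
proof (cases "res C = None")
  case False
  then have "tstep x (D ^ K) (k, C, t) = (k, C, t)" by (simp add: tstep_def)
  moreover have "mstep x S = S" using R False by (auto simp: mstep_def)
  ultimately show ?thesis using R by simp
next
  case True
  obtain sI sW cs where S: "S = (Rn blk k (st C) sI sW, ih C, cs, pre @ ctape C @ post, length pre + chd C, None)"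
    and sI: "ih C = 0 \<longrightarrow> \<not> sI" "ih C = Suc (length x) \<longrightarrow> sI"
    and sW: "wh C = 0 \<longrightarrow> \<not> sW" "wh C = Suc l \<longrightarrow> sW"
    and cs: "cols cs (wtape C) (wh C) (chd C) t"
    using R True by auto
  have bd: "ih C \<le> Suc (length x)" "length (wtape C) = l" "wh C \<le> Suc l" "length (ctape C) = c" "chd C \<le> Suc c"
    using R by (auto simp: bd_def)
  have yI: "side sI (rd x (ih C)) = symI x C" using side_look[OF bd(1) sI] .
  have yW: "side sW (found cs) = symW C"
    unfolding found_cols[OF cs] using side_look[of "wh C" "wtape C"] bd sW by simp
  let ?ct = "pre @ ctape C @ post" and ?p = "length pre + chd C"
  have rdct: "rd ?ct ?p = Some (ctape C ! (chd C - 1))" if "chd C \<noteq> 0" "chd C \<noteq> Suc c"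
    using that bd by (auto simp: rd_def nth_append)
  have yC: "(if chd C = 0 then LE else if chd C = Suc c then RE else Bit (keep (rd ?ct ?p))) = symC C"
    using bd rdct by (auto simp: look_def keep_def)
  have scan: "down dn scan0 cs = ((found cs, chd C = 0, chd C = Suc c, t = 0,
      case cs of [] \<Rightarrow> None | c # _ \<Rightarrow> Some (cH c)), annot cs)"
    by (simp add: down_dn flags_cols[OF cs])
  have nx': "(k = RC \<and> symC C = RE \<and> \<not> blk) = False" using nx True by blast
  have act: "act (Rn blk k (st C) sI sW) (fst (down dn scan0 cs)) (rd x (ih C)) (rd ?ct ?p) =
    (case \<theta> k (st C) (symI x C) (symW C) (symC C) (t = 0) of THalt r \<Rightarrow> SHalt r
         | TDo k' q' w v e1 e2 e3 tk \<Rightarrow>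
             SGo (Rn blk k' q' (turn sI (eff e1 (symI x C))) (turn sW (eff e2 (symW C))))
               (start (CMove w (eff e2 (symW C)) (eff e3 (symC C)) tk (symW C = RE \<and> 0 < e)) (symW C = LE \<and> 0 < e))
               (if chd C = 0 \<or> chd C = Suc c then keep (rd ?ct ?p) else v) (eff e1 (symI x C)) (eff e3 (symC C)))"
    unfolding act_def scan fst_conv prod.case base.case Let_def yI yW yC nx' if_False ..
  show ?thesis
  proof (cases "\<theta> k (st C) (symI x C) (symW C) (symC C) (t = 0)")
    case (THalt r)
    then have "mstep x S = (Rn blk k (st C) sI sW, ih C, cs, ?ct, ?p, Some r)"
      unfolding S by (intro mstep_SHalt) (simp only: act tact.case)
    moreover have "tstep x (D ^ K) (k, C, t) = (k, C\<lparr>res := Some r\<rparr>, t)"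
      using THalt True by (simp add: tstep_def)
    ultimately show ?thesis using bd by (simp add: bd_def)
  next
    case (TDo k' q' w v e1 e2 e3 tk)
    let ?e1 = "eff e1 (symI x C)" and ?e2 = "eff e2 (symW C)" and ?e3 = "eff e3 (symC C)"
    let ?cs = "upward (up D) (start (CMove w ?e2 ?e3 tk (symW C = RE \<and> 0 < e)) (symW C = LE \<and> 0 < e)) (annot cs)"
    let ?k = "if chd C = 0 \<or> chd C = Suc c then keep (rd ?ct ?p) else v"
    have ms: "mstep x S = (Rn blk k' q' (turn sI ?e1) (turn sW ?e2), move ?e1 (length x) (ih C), ?cs,
        wr ?ct ?p ?k, move ?e3 (length ?ct) ?p, None)"
      unfolding S using mstep_SGo[OF act[unfolded TDo tact.case]] by (simp only: scan snd_conv)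
    define C' where "C' = (shift ?e1 ?e2 ?e3 (put w v C))\<lparr>st := q'\<rparr>"
    have ts: "tstep x (D ^ K) (k, C, t) = (k', C', if tk then Suc t mod D ^ K else t)"
      using TDo True by (simp add: tstep_def C'_def)
    have o1: "?e1 = Lft \<longrightarrow> ih C \<noteq> 0" "?e1 = Rgt \<longrightarrow> ih C \<noteq> Suc (length x)"
      using okD[OF ok_eff[of e1 "symI x C"]] by (blast, blast)
    have o2: "?e2 = Lft \<longrightarrow> wh C \<noteq> 0" "?e2 = Rgt \<longrightarrow> wh C \<noteq> Suc l"
      using okD[OF ok_eff[of e2 "symW C"]] bd(2) by (blast, blast)
    have o3: "?e3 = Lft \<longrightarrow> chd C \<noteq> 0" "?e3 = Rgt \<longrightarrow> chd C \<noteq> Suc c"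
      using okD[OF ok_eff[of e3 "symC C"]] bd(4) by (blast, blast)
    note t1 = turn_go[OF bd(1) sI o1] and t2 = turn_go[OF bd(3) sW o2]
    have g3: "go ?e3 (chd C) \<le> Suc c" using o3 bd(5) by (cases ?e3) auto
    have m1: "move ?e1 (length x) (ih C) = ih C'"
      using move_go[OF bd(1) ok_eff] by (simp add: C'_def shift_def put_def)
    have m3: "move ?e3 (length ?ct) ?p = length pre + chd C'"
      using o3 bd(4,5) by (cases ?e3) (auto simp: C'_def shift_def put_def)
    have wct: "wr ?ct ?p ?k = pre @ ctape C' @ post"
    proof (cases "chd C = 0 \<or> chd C = Suc c")
      case True
      then have "write_cell (ctape C) (chd C) v = ctape C" using bd by (auto simp: write_cell_def)
      then show ?thesis using True by (auto simp: C'_def shift_def put_def)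
    next
      case False
      then show ?thesis using bd
        by (auto simp: C'_def shift_def put_def wr_def write_cell_def list_update_append)
    qed
    have "cols ?cs (write_cell (wtape C) (wh C) w) (go ?e2 (wh C)) (go ?e3 (chd C)) (if tk then Suc t mod D ^ K else t)"
      using cols_move[OF cs bd(3) ok_eff bd(5) o3] .
    then have cs': "cols ?cs (wtape C') (wh C') (chd C') (if tk then Suc t mod D ^ K else t)"
      by (simp add: C'_def shift_def put_def)
    have f: "ih C' = go ?e1 (ih C)" "wh C' = go ?e2 (wh C)" "chd C' = go ?e3 (chd C)" "st C' = q'" "res C' = None"
      "length (wtape C') = l" "length (ctape C') = c"
      using True bd by (simp_all add: C'_def shift_def put_def)
    have bd': "bd C'" using t1(1) t2(1) g3 f by (simp add: bd_def)
    have fl: "ih C' = 0 \<longrightarrow> \<not> turn sI ?e1" "ih C' = Suc (length x) \<longrightarrow> turn sI ?e1"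
      "wh C' = 0 \<longrightarrow> \<not> turn sW ?e2" "wh C' = Suc l \<longrightarrow> turn sW ?e2"
      unfolding f by (fact t1 t2)+
    have "Rel blk pre post (k', C', if tk then Suc t mod D ^ K else t)
      (Rn blk k' (st C') (turn sI ?e1) (turn sW ?e2), ih C', ?cs, pre @ ctape C' @ post, length pre + chd C', None)"
      unfolding Rel.simps if_P[OF f(5)]
      by (rule conjI[OF bd'], rule exI[of _ "turn sI ?e1"], rule exI[of _ "turn sW ?e2"], rule exI[of _ ?cs])
        (intro conjI refl cs' fl)
    then show ?thesis unfolding ts ms wct m1 m3 f(4) .
  qed
qed

text \<open>Had the excluded case of \<open>Rel_step\<close> occurred on the way, the walk would
  have stayed halted in \<open>RC\<close>, contrary to the condition on \<open>B\<close>.\<close>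

lemma Rel_run:
  assumes "Rel blk pre post A S" "(tstep x (D ^ K) ^^ n) A = B" "blk \<or> fst B \<noteq> RC \<or> res (fst (snd B)) = None"
  shows "\<exists>S'. reaches (mstep x) n S S' \<and> Rel blk pre post B S'"
  using assms
proof (induction n arbitrary: A S)
  case 0
  then show ?case by (intro exI[of _ S] conjI) simp_all
next
  case (Suc n)
  obtain k C t where A: "A = (k, C, t)" by (cases A)
  have B: "(tstep x (D ^ K) ^^ n) (tstep x (D ^ K) A) = B"
    using Suc.prems(2) by (simp add: funpow_simps_right(2) del: funpow.simps)
  have "\<not> (res C = None \<and> k = RC \<and> symC C = RE \<and> \<not> blk)"
  proof
    assume *: "res C = None \<and> k = RC \<and> symC C = RE \<and> \<not> blk"
    then have "tstep x (D ^ K) A = (RC, C\<lparr>res := Some None\<rparr>, t)" by (simp add: A tstep_def \<theta>_def Let_def)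
    moreover have "(tstep x (D ^ K) ^^ j) (RC, C\<lparr>res := Some None\<rparr>, t) = (RC, C\<lparr>res := Some None\<rparr>, t)" for j
      by (induction j) (simp_all add: tstep_def)
    ultimately have "B = (RC, C\<lparr>res := Some None\<rparr>, t)" using B by simp
    then show False using Suc.prems(3) * by simp
  qed
  from Suc.IH[OF Rel_step[OF Suc.prems(1)[unfolded A] this, folded A] B Suc.prems(3)]
  obtain S' where S': "reaches (mstep x) n (mstep x S) S'" "Rel blk pre post B S'" by blast
  from reaches_Suc[where f = "mstep x", OF refl S'(1)] S'(2) show ?case by blast
qed

section \<open>Computing the length of the simulated tape from the input\<close>

definition clean :: "col list \<Rightarrow> nat \<Rightarrow> nat \<Rightarrow> bool" where
  "clean cs p q \<longleftrightarrow> length cs = K \<and> digits cs \<and> map cW cs = replicate K False \<and> map cH cs = replicate K False \<and>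
     vP cs = p \<and> vE cs = q \<and> vT cs = 0"

lemma clean_0: "clean (replicate K col0) 0 0"
  using D by (auto simp: clean_def digits_def)

lemma clean_Nop: "clean cs p q \<Longrightarrow> clean (upward (up D) (start CNop False) (annot cs)) p q"
  by (simp add: clean_def start_def Nop_tracks digits_def del: set_map)

lemma clean_MovEP: "clean cs p q \<Longrightarrow> clean (upward (up D) (start CMovEP False) (annot cs)) 0 p"
  using D by (auto simp: clean_def start_def MovEP_tracks digits_def simp del: set_map)

lemma clean_IncE:
  assumes "clean cs p q" "Suc q < D ^ K"
  shows "clean (upward (up D) (start CIncE False) (annot cs)) p (Suc q)"
proof -
  have "map fst (map (\<lambda>c. (cE c, 0 :: nat)) (annot cs)) = map cE cs"
    "map snd (map (\<lambda>c. (cE c, 0 :: nat)) (annot cs)) = replicate K 0"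
    using assms(1) map_annot(4)[of cs] by (simp_all add: o_def map_replicate_const clean_def)
  then have "val D (ripple D 1 (map (\<lambda>c. (cE c, 0)) (annot cs))) = Suc q"
    unfolding val_ripple[OF D_pos] using assms by (simp add: clean_def)
  then show ?thesis using assms(1) ripple_less[OF D_pos]
    by (auto simp: clean_def start_def IncE_tracks digits_def simp del: set_map)
qed

lemma clean_AddPE:
  assumes "clean cs p q" "p + q < D ^ K"
  shows "clean (upward (up D) (start CAddPE False) (annot cs)) (p + q) q"
proof -
  have "map fst (map (\<lambda>c. (cP c, cE c)) (annot cs)) = map cP cs"
    "map snd (map (\<lambda>c. (cP c, cE c)) (annot cs)) = map cE cs"
    using map_annot(3,4)[of cs] by (simp_all add: o_def)
  then have "val D (ripple D 0 (map (\<lambda>c. (cP c, cE c)) (annot cs))) = p + q"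
    unfolding val_ripple[OF D_pos] using assms by (simp add: clean_def)
  then show ?thesis using assms(1) ripple_less[OF D_pos]
    by (auto simp: clean_def start_def AddPE_tracks digits_def simp del: set_map)
qed

lemma snd_down: "snd (down dn scan0 cs) = annot cs"
  by (simp add: down_dn)

lemma init_step:
  assumes "\<And>d a'. act b d (rd x i) a' = SGo b' u (keep a') dd Stay"
  shows "mstep x (b, i, cs, ct, p, None) = (b', move dd (length x) i, upward (up D) u (annot cs), ct, p, None)"
  using mstep_SGo[OF assms, of cs ct p] by (simp add: snd_down)

lemma rewind:
  assumes "clean cs p q" "h \<le> length x"
  shows "\<exists>cs'. reaches (mstep x) h (IW i, h, cs, ct, r, None) (IW i, 0, cs', ct, r, None) \<and> clean cs' p q"
  using assms
proof (induction h arbitrary: cs)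
  case 0
  then show ?case by (intro exI[of _ cs]) simp
next
  case (Suc h)
  have "mstep x (IW i, Suc h, cs, ct, r, None) = (IW i, h, upward (up D) (start CNop False) (annot cs), ct, r, None)"
    using Suc.prems(2) by (subst init_step[where b' = "IW i" and u = "start CNop False" and dd = Lft]) (auto simp: act_def rd_def)
  note s = reaches_Suc[where f = "mstep x", OF this]
  obtain cs' where "reaches (mstep x) h (IW i, h, upward (up D) (start CNop False) (annot cs), ct, r, None)
      (IW i, 0, cs', ct, r, None)" "clean cs' p q"
    using Suc.IH[OF clean_Nop[OF Suc.prems(1)]] Suc.prems(2) by auto
  with s show ?case by blast
qed

text \<open>Each input cell passed adds \<open>q\<close> to \<open>P\<close>: the input itself is
  the loop counter of a multiplication by its length.\<close>

lemma multiply_tape: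
  assumes "clean cs p q" "h \<le> length x" "p + (length x - h) * q < D ^ K" "j = min 2 h"
  shows "\<exists>cs'. reaches (mstep x) (length x - h) (IM i j, Suc h, cs, ct, r, None)
      (IM i (min 2 (length x)), Suc (length x), cs', ct, r, None) \<and> clean cs' (p + (length x - h) * q) q"
  using assms
proof (induction "length x - h" arbitrary: h j p cs)
  case 0
  then show ?case by (intro exI[of _ cs]) auto
next
  case (Suc n)
  have n: "n = length x - Suc h" "Suc h \<le> length x" "length x - h = Suc n" using Suc.hyps(2) by auto
  have "rd x (Suc h) \<noteq> None" using n by (simp add: rd_def)
  then have s: "mstep x (IM i j, Suc h, cs, ct, r, None) =
      (IM i (min 2 (Suc j)), Suc (Suc h), upward (up D) (start CAddPE False) (annot cs), ct, r, None)"
    using n by (subst init_step[where b' = "IM i (min 2 (Suc j))" and u = "start CAddPE False" and dd = Rgt]) (auto simp: act_def)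
  have le: "p + q + n * q = p + (length x - h) * q" by (simp add: n(3))
  then have c: "clean (upward (up D) (start CAddPE False) (annot cs)) (p + q) q"
    using Suc.prems(1,3) by (intro clean_AddPE) auto
  obtain cs' where "reaches (mstep x) n (IM i (min 2 (Suc j)), Suc (Suc h), upward (up D) (start CAddPE False) (annot cs), ct, r, None)
      (IM i (min 2 (length x)), Suc (length x), cs', ct, r, None)" "clean cs' (p + q + n * q) q"
  proof -
    have "p + q + (length x - Suc h) * q < D ^ K" using Suc.prems(3) le n(1) by simp
    moreover have "min 2 (Suc j) = min 2 (Suc h)" using Suc.prems(4) by simp
    ultimately show thesis using Suc.hyps(1)[OF n(1) c n(2), of "min 2 (Suc j)"] that
      unfolding n(1) by blast
  qed
  with reaches_Suc[where f = "mstep x", OF s] show ?case unfolding le n(3) by blast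
qed

text \<open>For inputs shorter than 2 the missing summands are added at the right marker, since the
  factor is \<open>max 2 n\<close>.\<close>

lemma multiply_end:
  assumes "clean cs p q" "j \<le> 2" "p + (2 - j) * q < D ^ K"
  shows "\<exists>cs'. reaches (mstep x) (2 - j) (IM i j, Suc (length x), cs, ct, r, None)
      (IM i 2, Suc (length x), cs', ct, r, None) \<and> clean cs' (p + (2 - j) * q) q"
  using assms
proof (induction "2 - j" arbitrary: j p cs)
  case 0
  then show ?case by (intro exI[of _ cs]) auto
next
  case (Suc n)
  have n: "n = 2 - Suc j" "Suc j \<le> 2" "2 - j = Suc n" using Suc.hyps(2) by auto
  have "rd x (Suc (length x)) = None" by (simp add: rd_def)
  then have s: "mstep x (IM i j, Suc (length x), cs, ct, r, None) =
      (IM i (Suc j), Suc (length x), upward (up D) (start CAddPE False) (annot cs), ct, r, None)"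
    using n by (subst init_step[where b' = "IM i (Suc j)" and u = "start CAddPE False" and dd = Stay]) (auto simp: act_def)
  have le: "p + q + n * q = p + (2 - j) * q" by (simp add: n(3))
  then have c: "clean (upward (up D) (start CAddPE False) (annot cs)) (p + q) q"
    using Suc.prems(1,3) by (intro clean_AddPE) auto
  obtain cs' where "reaches (mstep x) n (IM i (Suc j), Suc (length x), upward (up D) (start CAddPE False) (annot cs), ct, r, None)
      (IM i 2, Suc (length x), cs', ct, r, None)" "clean cs' (p + q + n * q) q"
    using Suc.hyps(1)[OF n(1) c n(2)] Suc.prems(3) le n(1) by auto
  with reaches_Suc[where f = "mstep x", OF s] show ?case unfolding le n(3) by blast
qed

lemma multiply_round:
  assumes "clean cs 0 q" "i < e" "max 2 (length x) * q < D ^ K"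
  shows "\<exists>cs'. reaches (mstep x) (2 * length x + 6) (IW i, 0, cs, ct, r, None) (IW (Suc i), 0, cs', ct, r, None)
     \<and> clean cs' 0 (max 2 (length x) * q)"
proof -
  let ?n = "length x"
  have max: "?n + (2 - min 2 ?n) = max 2 ?n" by auto
  have lt: "?n * q + (2 - min 2 ?n) * q < D ^ K" using assms(3) by (simp add: max flip: add_mult_distrib)
  have "mstep x (IW i, 0, cs, ct, r, None) = (IM i 0, 1, upward (up D) (start CNop False) (annot cs), ct, r, None)"
    using assms(2) by (subst init_step[where b' = "IM i 0" and u = "start CNop False" and dd = Rgt]) (auto simp: act_def)
  then have r1: "reaches (mstep x) 1 (IW i, 0, cs, ct, r, None) (IM i 0, 1, upward (up D) (start CNop False) (annot cs), ct, r, None)"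
    by (rule reaches_step) simp
  obtain cs1 where r2: "reaches (mstep x) ?n (IM i 0, 1, upward (up D) (start CNop False) (annot cs), ct, r, None)
      (IM i (min 2 ?n), Suc ?n, cs1, ct, r, None)" "clean cs1 (?n * q) q"
    using multiply_tape[OF clean_Nop[OF assms(1)], of 0 0 i ct r] lt by auto
  obtain cs2 where r3: "reaches (mstep x) (2 - min 2 ?n) (IM i (min 2 ?n), Suc ?n, cs1, ct, r, None)
      (IM i 2, Suc ?n, cs2, ct, r, None)" "clean cs2 (?n * q + (2 - min 2 ?n) * q) q"
    using multiply_end[OF r2(2) _ lt, of i ct r] by auto
  have "rd x (Suc ?n) = None" by (simp add: rd_def)
  then have "mstep x (IM i 2, Suc ?n, cs2, ct, r, None) =
      (IW (Suc i), ?n, upward (up D) (start CMovEP False) (annot cs2), ct, r, None)"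
    by (subst init_step[where b' = "IW (Suc i)" and u = "start CMovEP False" and dd = Lft]) (auto simp: act_def)
  then have r4: "reaches (mstep x) 1 (IM i 2, Suc ?n, cs2, ct, r, None)
      (IW (Suc i), ?n, upward (up D) (start CMovEP False) (annot cs2), ct, r, None)"
    by (rule reaches_step) simp
  obtain cs3 where r5: "reaches (mstep x) ?n (IW (Suc i), ?n, upward (up D) (start CMovEP False) (annot cs2), ct, r, None)
      (IW (Suc i), 0, cs3, ct, r, None)" "clean cs3 0 (?n * q + (2 - min 2 ?n) * q)"
    using rewind[OF clean_MovEP[OF r3(2)] order_refl, of "Suc i" ct r] by auto
  from reaches_trans[OF reaches_trans[OF reaches_trans[OF reaches_trans[OF r1 r2(1)] r3(1)] r4] r5(1)]
  have "reaches (mstep x) (2 * ?n + 6) (IW i, 0, cs, ct, r, None) (IW (Suc i), 0, cs3, ct, r, None)"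
    by (rule reaches_mono) simp
  moreover have "clean cs3 0 (max 2 ?n * q)" using r5(2) by (simp add: max flip: add_mult_distrib)
  ultimately show ?thesis by blast
qed

lemma power_rounds:
  assumes "clean cs 0 1" "i \<le> e" "max 2 (length x) ^ e < D ^ K"
  shows "\<exists>cs'. reaches (mstep x) (i * (2 * length x + 6)) (IW 0, 0, cs, ct, r, None) (IW i, 0, cs', ct, r, None)
     \<and> clean cs' 0 (max 2 (length x) ^ i)"
  using assms(2)
proof (induction i)
  case 0
  then show ?case using assms(1) by (intro exI[of _ cs]) simp
next
  case (Suc i)
  then obtain cs1 where 1: "reaches (mstep x) (i * (2 * length x + 6)) (IW 0, 0, cs, ct, r, None) (IW i, 0, cs1, ct, r, None)"
     "clean cs1 0 (max 2 (length x) ^ i)" by auto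
  have "max 2 (length x) ^ Suc i \<le> max 2 (length x) ^ e" using Suc.prems by (intro power_increasing) auto
  then have "max 2 (length x) * max 2 (length x) ^ i < D ^ K" using assms(3) by simp
  from multiply_round[OF 1(2) _ this, of i ct r] Suc.prems obtain cs2 where
    2: "reaches (mstep x) (2 * length x + 6) (IW i, 0, cs1, ct, r, None) (IW (Suc i), 0, cs2, ct, r, None)"
    "clean cs2 0 (max 2 (length x) ^ Suc i)" by auto
  from reaches_trans[OF 1(1) 2(1)] 2(2) show ?case by (auto simp: add.commute)
qed

text \<open>\<open>E\<close> is set to 1, multiplied by \<open>max 2 n\<close> in each of
  \<open>e\<close> rounds, and incremented once more, because the right marker is at position
  \<open>Suc c\<close>.\<close>

lemma initialise:
  assumes "c = max 2 (length x) ^ e"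
  shows "\<exists>cs. reaches (mstep x) (e * (2 * length x + 6) + 2) (IA, 0, replicate K col0, ct, 0, None)
    (Rn False (Top True m) 0 False False, 0, cs, ct, 0, None) \<and> clean cs 0 (Suc c)"
proof -
  have "1 \<le> c" by (simp add: assms)
  then have c1: "clean (upward (up D) (start CIncE False) (annot (replicate K col0))) 0 1"
    using clean_IncE[OF clean_0] c by simp
  have s1: "mstep x (IA, 0, replicate K col0, ct, 0, None) =
      (IW 0, 0, upward (up D) (start CIncE False) (annot (replicate K col0)), ct, 0, None)"
    by (subst init_step[where b' = "IW 0" and u = "start CIncE False" and dd = Stay]) (auto simp: act_def)
  obtain cs where 2: "reaches (mstep x) (e * (2 * length x + 6))
      (IW 0, 0, upward (up D) (start CIncE False) (annot (replicate K col0)), ct, 0, None) (IW e, 0, cs, ct, 0, None)"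
      "clean cs 0 c"
    using power_rounds[OF c1 order_refl, of ct 0] c assms by auto
  have "mstep x (IW e, 0, cs, ct, 0, None) =
      (Rn False (Top True m) 0 False False, 0, upward (up D) (start CIncE False) (annot cs), ct, 0, None)"
    by (subst init_step[where b' = "Rn False (Top True m) 0 False False" and u = "start CIncE False" and dd = Stay]) (auto simp: act_def)
  then have r3: "reaches (mstep x) 1 (IW e, 0, cs, ct, 0, None)
      (Rn False (Top True m) 0 False False, 0, upward (up D) (start CIncE False) (annot cs), ct, 0, None)"
    by (rule reaches_step) simp
  from reaches_trans[OF reaches_Suc[where f = "mstep x", OF s1 2(1)] r3] clean_IncE[OF 2(2) c]
  show ?thesis by auto
qed

lemma clean_cols: "clean cs 0 (Suc c) \<Longrightarrow> cols cs (replicate l False) 0 0 0"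
proof -
  assume a: "clean cs 0 (Suc c)"
  have "\<not> cH (cs ! i)" if "i < K" for i
    using a that nth_map[of i cs cH] by (simp add: clean_def)
  then show ?thesis using a by (simp add: clean_def cols_def l)
qed

lemma Rel_init:
  assumes "cols cs (replicate l False) 0 0 0" "length \<tau> = c"
  shows "Rel blk pre post (Top True m, init_conf l \<tau>, 0)
    (Rn blk (Top True m) 0 False False, 0, cs, pre @ \<tau> @ post, length pre, None)"
  using assms by (auto simp: bd_def init_conf_def)

text \<open>The head is at position \<open>Suc c\<close> of the first block. One cell to the left is
  position 0 relative to the longer frame \<open>pre @ ctape C\<close>. \<open>CReset\<close> clears
  all tracks but \<open>E\<close>, which serves the second block too.\<close>

lemma Rel_switch:
  assumes "Rel False pre (\<tau> @ post) (RC, C, t) S" "res C = None" "ih C = 0" "chd C = Suc c" "length \<tau> = c"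
  shows "Rel True (pre @ ctape C) post (Top True m, init_conf l \<tau>, 0) (mstep x S)"
proof -
  obtain sI sW cs where S: "S = (Rn False RC (st C) sI sW, 0, cs, pre @ ctape C @ \<tau> @ post, length pre + Suc c, None)"
    and cs: "cols cs (wtape C) (wh C) (Suc c) t" and lC: "length (ctape C) = c"
    using assms by (auto simp: bd_def)
  let ?cs = "upward (up D) (CReset, False, 0, 0) (annot cs)"
  have K: "length cs = K" "digits cs" "vE cs = Suc c" using cs by (auto simp: cols_def)
  have act: "act (Rn False RC (st C) sI sW) (fst (down dn scan0 cs)) (rd x 0) a = 
      SGo (Rn True (Top True m) 0 False False) (CReset, False, 0, 0) (keep a) Stay Lft" for a
    by (simp add: act_def down_dn flags_cols[OF cs] start_def)
  have "mstep x S = (Rn True (Top True m) 0 False False, 0, ?cs, pre @ ctape C @ \<tau> @ post, length pre + c, None)"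
    unfolding S using mstep_SGo[OF act] by (simp add: snd_down)
  moreover have "clean ?cs 0 (Suc c)"
    using K D by (auto simp: clean_def reset_tracks digits_def simp del: set_map)
  ultimately show ?thesis
    using Rel_init[OF clean_cols assms(5), of ?cs True "pre @ ctape C" post] lC by (simp del: Rel.simps)
qed

lemma Rel_reaches:
  assumes "Rel blk pre post A S" "reaches (tstep x (D ^ K)) N A B" "blk \<or> fst B \<noteq> RC \<or> res (fst (snd B)) = None"
  shows "\<exists>S'. reaches (mstep x) N S S' \<and> Rel blk pre post B S'"
proof -
  obtain n where n: "n \<le> N" "(tstep x (D ^ K) ^^ n) A = B" using assms(2) by (auto simp: reaches_def)
  from Rel_run[OF assms(1) n(2) assms(3)] obtain S' where
    S': "reaches (mstep x) n S S'" "Rel blk pre post B S'" by blast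
  from reaches_mono[OF S'(1) n(1)] S'(2) show ?thesis by blast
qed

lemma legal_init: "length \<tau> = c \<Longrightarrow> legal x l c (init_conf l \<tau>)"
  using wf by (simp add: legal_def init_conf_def wf_machine_def)

definition timely :: "bool list \<Rightarrow> bool" where
  "timely \<tau> \<longleftrightarrow> (\<exists>j<D ^ K. stops x ((tour x ^^ j) (init_conf l \<tau>, m)))"

abbreviation CB :: nat where "CB \<equiv> clock_bound x (D ^ K) c"

lemma run_block:
  assumes "Rel blk pre post (Top True m, init_conf l \<tau>, 0) S" "length \<tau> = c"
    and "path x (init_conf l \<tau>) ps R" "todo x R = Halt r" "ctape R = \<tau>"
  shows "(r \<noteq> None \<and> (\<exists>b i cs p. reaches (mstep x) CB S (b, i, cs, pre @ \<tau> @ post, p, Some r))) \<or>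
    ((r = None \<or> \<not> timely \<tau>) \<and> (\<exists>C t S'. reaches (mstep x) CB S S' \<and> Rel blk pre post (RC, C, t) S' \<and>
       res C = None \<and> ctape C = \<tau> \<and> ih C = 0 \<and> chd C = Suc c))"
proof -
  have pos: "0 < D ^ K" using D by simp
  have ct: "ctape (init_conf l \<tau>) = \<tau>" by (simp add: init_conf_def)
  from reaches_block[OF legal_init[OF assms(2)] assms(3) pos assms(4)] assms(5) ct
  consider (a) C' t v where "r = Some v" "reaches (tstep x (D ^ K)) CB (Top True m, init_conf l \<tau>, 0) (Al True m, C', t)"
      "res C' = Some r" "ctape C' = \<tau>"
    | (b) C' t where "r = None \<or> \<not> timely \<tau>" "reaches (tstep x (D ^ K)) CB (Top True m, init_conf l \<tau>, 0) (RC, C', t)"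
      "legal x l c C'" "ctape C' = \<tau>" "ih C' = 0" "chd C' = Suc c"
    unfolding timely_def by (simp only:) blast
  then show ?thesis
  proof cases
    case a
    have "blk \<or> fst (Al True m, C', t) \<noteq> RC \<or> res (fst (snd (Al True m, C', t))) = None" by simp
    from Rel_reaches[OF assms(1) a(2) this] obtain S' where
      S': "reaches (mstep x) CB S S'" "Rel blk pre post (Al True m, C', t) S'" by blast
    from S'(2) a(3,4) obtain b i cs p where "S' = (b, i, cs, pre @ \<tau> @ post, p, Some r)" by auto
    with S'(1) a(1) show ?thesis by blast
  next
    case b
    have rn: "res C' = None" using b(3) by (simp add: legal_def)
    then have "blk \<or> fst (RC, C', t) \<noteq> RC \<or> res (fst (snd (RC, C', t))) = None" by simp
    from Rel_reaches[OF assms(1) b(2) this] obtain S' where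
      S': "reaches (mstep x) CB S S'" "Rel blk pre post (RC, C', t) S'" by blast
    with b rn show ?thesis by blast
  qed
qed

text \<open>A proper answer in either block ends the run with the tape restored; the symbol for no
  answer is left for the case that both blocks give up.\<close>

theorem run_both_blocks:
  assumes c_def: "c = max 2 (length x) ^ e" and len: "length \<tau>1 = c" "length \<tau>2 = c"
    and 1: "path x (init_conf l \<tau>1) ps1 R1" "todo x R1 = Halt r1" "ctape R1 = \<tau>1"
    and 2: "path x (init_conf l \<tau>2) ps2 R2" "todo x R2 = Halt r2" "ctape R2 = \<tau>2"
  shows "\<exists>r b i cs p. reaches (mstep x) (e * (2 * length x + 6) + 2 * CB + 4)
      (IA, 0, replicate K col0, \<tau>1 @ \<tau>2 @ \<rho>, 0, None) (b, i, cs, \<tau>1 @ \<tau>2 @ \<rho>, p, Some r) \<and>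
      (r = None \<or> r = r1 \<or> r = r2) \<and>
      (r = None \<longrightarrow> (r1 = None \<or> \<not> timely \<tau>1) \<and> (r2 = None \<or> \<not> timely \<tau>2))"
proof -
  let ?ct = "\<tau>1 @ \<tau>2 @ \<rho>" and ?N = "e * (2 * length x + 6) + 2 * CB + 4"
  let ?S = "(IA, 0, replicate K col0, ?ct, 0, None)"
  obtain cs where i: "reaches (mstep x) (e * (2 * length x + 6) + 2) ?S
    (Rn False (Top True m) 0 False False, 0, cs, ?ct, 0, None)" "clean cs 0 (Suc c)"
    using initialise[OF c_def] by blast
  define S0 where "S0 = (Rn False (Top True m) 0 False False, 0 :: nat, cs, ?ct, 0 :: nat, None :: bool option option)"
  have rel0: "Rel False [] (\<tau>2 @ \<rho>) (Top True m, init_conf l \<tau>1, 0) S0"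
    using Rel_init[OF clean_cols[OF i(2)] len(1), of False "[]" "\<tau>2 @ \<rho>"] by (simp add: S0_def del: Rel.simps)
  consider
    (a) b i' cs' p where "r1 \<noteq> None" "reaches (mstep x) CB S0 (b, i', cs', [] @ \<tau>1 @ \<tau>2 @ \<rho>, p, Some r1)"
  | (b) C t S1 where "r1 = None \<or> \<not> timely \<tau>1" "reaches (mstep x) CB S0 S1" "Rel False [] (\<tau>2 @ \<rho>) (RC, C, t) S1"
      "res C = None" "ctape C = \<tau>1" "ih C = 0" "chd C = Suc c"
    using run_block[OF rel0 len(1) 1] by blast
  then show ?thesis
  proof cases
    case *: (a b i' cs' p)
    have "reaches (mstep x) ?N ?S (b, i', cs', ?ct, p, Some r1)"
      using reaches_trans[OF i(1)[folded S0_def] *(2)] by (auto elim: reaches_mono)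
    with *(1) show ?thesis by blast
  next
    case *: (b C t S1)
    have rel1: "Rel True \<tau>1 \<rho> (Top True m, init_conf l \<tau>2, 0) (mstep x S1)"
      using Rel_switch[OF *(3,4,6,7) len(2)] *(5) by (simp del: Rel.simps)
    have to1: "reaches (mstep x) (e * (2 * length x + 6) + CB + 3) ?S (mstep x S1)"
      using reaches_trans[OF reaches_trans[OF i(1)[folded S0_def] *(2)]
          reaches_step[where f = "mstep x" and b = 1, OF refl]] by (auto elim: reaches_mono)
    consider
      (a') b i' cs' p where "r2 \<noteq> None" "reaches (mstep x) CB (mstep x S1) (b, i', cs', \<tau>1 @ \<tau>2 @ \<rho>, p, Some r2)"
    | (b') C' t' S2 where "r2 = None \<or> \<not> timely \<tau>2" "reaches (mstep x) CB (mstep x S1) S2"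
        "Rel True \<tau>1 \<rho> (RC, C', t') S2" "res C' = None" "ctape C' = \<tau>2" "ih C' = 0" "chd C' = Suc c"
      using run_block[OF rel1 len(2) 2] by blast
    then show ?thesis
    proof cases
      case **: (a' b i' cs' p)
      have "reaches (mstep x) ?N ?S (b, i', cs', ?ct, p, Some r2)"
        using reaches_trans[OF to1 **(2)] by (auto elim: reaches_mono)
      with **(1) show ?thesis by blast
    next
      case **: (b' C' t' S2)
      have "symC C' = RE" using **(5,7) len(2) by (simp add: look_def)
      then have "tstep x (D ^ K) (RC, C', t') = (RC, C'\<lparr>res := Some None\<rparr>, t')"
        using **(4) by (simp add: tstep_def \<theta>_def Let_def)
      with Rel_step[OF **(3)] have "Rel True \<tau>1 \<rho> (RC, C'\<lparr>res := Some None\<rparr>, t') (mstep x S2)" by simp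
      then obtain b i' cs' p where S2: "mstep x S2 = (b, i', cs', ?ct, p, Some None)" using **(5) by auto
      have "reaches (mstep x) ?N ?S (b, i', cs', ?ct, p, Some None)"
        using reaches_trans[OF reaches_trans[OF to1 **(2)]
          reaches_step[where f = "mstep x" and b = 1, OF S2]] by (auto elim: reaches_mono)
      with *(1) **(1) show ?thesis by blast
    qed
  qed
qed

end

section \<open>Finiteness of the control\<close>

fun ctl_ok :: "ctl \<Rightarrow> bool" where
  "ctl_ok (Top f s) \<longleftrightarrow> s \<le> m" | "ctl_ok (Al f s) \<longleftrightarrow> s \<le> m" | "ctl_ok (Ck f s) \<longleftrightarrow> s < m"
| "ctl_ok (Fin f s) \<longleftrightarrow> s \<le> m" | "ctl_ok (Tst f s) \<longleftrightarrow> s \<le> m" | "ctl_ok _ \<longleftrightarrow> True"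

fun base_ok :: "base \<Rightarrow> bool" where
  "base_ok IA \<longleftrightarrow> True" | "base_ok (IW i) \<longleftrightarrow> i \<le> e" | "base_ok (IM i j) \<longleftrightarrow> i < e \<and> j \<le> 2"
| "base_ok (Rn b k q sI sW) \<longleftrightarrow> ctl_ok k \<and> q < nstates M"

lemma finite_ctl: "finite {k. ctl_ok k}"
proof -
  let ?S = "(UNIV :: bool set) \<times> {..m}"
  have "{k. ctl_ok k} \<subseteq> (\<lambda>(f, s). Top f s) ` ?S \<union> (\<lambda>(f, s). Al f s) ` ?S \<union> (\<lambda>(f, s). Ck f s) ` ?S
      \<union> (\<lambda>(f, s). Fin f s) ` ?S \<union> (\<lambda>(f, s). Tst f s) ` ?S \<union> {RI, RC}"
  proof
    fix k assume "k \<in> {k. ctl_ok k}"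
    then show "k \<in> (\<lambda>(f, s). Top f s) ` ?S \<union> (\<lambda>(f, s). Al f s) ` ?S \<union> (\<lambda>(f, s). Ck f s) ` ?S
      \<union> (\<lambda>(f, s). Fin f s) ` ?S \<union> (\<lambda>(f, s). Tst f s) ` ?S \<union> {RI, RC}"
      by (cases k) (auto simp: image_iff)
  qed
  then show ?thesis by (rule finite_subset) simp
qed

lemma finite_base: "finite {b. base_ok b}"
proof -
  let ?S = "IW ` {..e} \<union> (\<lambda>(i, j). IM i j) ` ({..e} \<times> {..2}) \<union> {IA} \<union>
    (\<lambda>(b, k, q, sI, sW). Rn b k q sI sW) ` (UNIV \<times> {k. ctl_ok k} \<times> {..<nstates M} \<times> UNIV \<times> UNIV)"
  have "{b. base_ok b} \<subseteq> ?S"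
  proof
    fix b assume "b \<in> {b. base_ok b}"
    then show "b \<in> ?S" by (cases b) (auto simp: image_iff)
  qed
  moreover have "finite ?S" by (intro finite_UnI finite_imageI finite_cartesian_product finite_ctl) auto
  ultimately show ?thesis by (rule finite_subset)
qed

lemma finite_dir: "finite (UNIV :: dir set)"
proof (rule finite_subset)
  show "UNIV \<subseteq> {Lft, Stay, Rgt}" using dir.exhaust by auto
qed simp

lemma finite_cmd: "finite (UNIV :: cmd set)"
proof -
  let ?S = "{CReset, CIncE, CAddPE, CMovEP, CNop} \<union>
    (\<lambda>(w, d2, d3, tk, r). CMove w d2 d3 tk r) ` (UNIV \<times> UNIV \<times> UNIV \<times> UNIV \<times> UNIV)"
  have "UNIV \<subseteq> ?S"
  proof
    fix u show "u \<in> ?S" by (cases u) (auto simp: image_iff)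
  qed
  moreover have "finite ?S" by (intro finite_UnI finite_imageI finite_cartesian_product finite_dir) auto
  ultimately show ?thesis by (rule finite_subset)
qed

definition columns :: "col set" where
  "columns = {a. cP a < D \<and> cE a < D \<and> cT a < D}"

lemma finite_columns: "finite columns"
proof -
  let ?S = "(\<lambda>(w, h, y, p, q, t). Col w h y p q t) ` (UNIV \<times> UNIV \<times> UNIV \<times> {..<D} \<times> {..<D} \<times> {..<D})"
  have "columns \<subseteq> ?S"
  proof
    fix a assume "a \<in> columns"
    then show "a \<in> ?S" by (cases a) (auto simp: image_iff columns_def)
  qed
  moreover have "finite ?S" by (intro finite_imageI finite_cartesian_product) auto
  ultimately show ?thesis by (rule finite_subset)
qed

lemma \<theta>_ok:
  assumes "\<theta> k q a b c z = TDo k' q' w v e1 e2 e3 tk" "ctl_ok k" "q < nstates M"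
  shows "ctl_ok k' \<and> q' < nstates M"
proof (cases k)
  case (Al f s)
  show ?thesis
  proof (cases "s = m")
    case True
    show ?thesis
    proof (cases "delta M q (opt a) (opt b) (opt c)")
      case (Halt r)
      then show ?thesis using assms Al True by (auto simp: \<theta>_def Let_def split: if_splits)
    next
      case (Step q1 w1 v1 d1 d2 d3)
      then have "q1 < nstates M" using wf assms(3) unfolding wf_machine_def by blast
      then show ?thesis using assms Al True Step idx[of "(q, a, b, c)"] by (auto simp: \<theta>_def Let_def)
    qed
  next
    case False
    show ?thesis
    proof (cases "cand s")
      case None
      then show ?thesis using assms Al False by (auto simp: \<theta>_def Let_def)
    next
      case (Some y)
      obtain q0 q1 a' b' c' w' v' d1 d2 d3 where "y = (q0, q1, a', b', c', w', v', d1, d2, d3)"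
        by (cases y) auto
      then show ?thesis using assms Al False Some by (auto simp: \<theta>_def Let_def split: if_splits)
    qed
  qed
next
  case (Ck f s)
  have s: "fst (slots ! s) < nstates M" using fst_slots assms(2) Ck by simp
  show ?thesis
  proof (cases "cand s")
    case None
    then show ?thesis using assms Ck by (auto simp: \<theta>_def Let_def)
  next
    case (Some y)
    obtain q0 q1 a' b' c' w' v' d1 d2 d3 where y: "y = (q0, q1, a', b', c', w', v', d1, d2, d3)"
      by (cases y) auto
    obtain q2 a2 b2 c2 where sl: "slots ! s = (q2, a2, b2, c2)" by (metis prod_cases4)
    have "q2 = q0" using Some y by (cases "delta M q2 (opt a2) (opt b2) (opt c2)") (auto simp: cand_def sl)
    then have "q0 < nstates M" using s sl by simp
    then show ?thesis using assms Ck Some y by (auto simp: \<theta>_def Let_def split: if_splits)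
  qed
next
  case (Top f s)
  then show ?thesis using assms prv_le[of s] by (auto simp: \<theta>_def Let_def)
next
  case (Fin f s)
  then show ?thesis using assms nxt_le[of s] by (auto simp: \<theta>_def Let_def)
next
  case (Tst f s)
  then show ?thesis using assms by (auto simp: \<theta>_def Let_def)
next
  case RI
  then show ?thesis using assms by (auto simp: \<theta>_def Let_def split: if_splits)
next
  case RC
  then show ?thesis using assms by (auto simp: \<theta>_def Let_def split: if_splits)
qed

definition carries :: "(cmd \<times> bool \<times> nat \<times> nat) set" where
  "carries = UNIV \<times> UNIV \<times> {..1} \<times> {..1}"

lemma start_carries: "start u h \<in> carries"
  by (cases u) (auto simp: start_def carries_def)

sublocale finite_sweep act scan0 dn "up D" col0 "{b. base_ok b}" UNIV carries columns IA
proof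
  show "finite {b. base_ok b}" by (rule finite_base)
  show "finite (UNIV :: scan set)" by (rule finite)
  show "finite carries" unfolding carries_def by (intro finite_cartesian_product finite_cmd) auto
  show "finite columns" by (rule finite_columns)
  show "IA \<in> {b. base_ok b}" by simp
  show "col0 \<in> columns" using D by (simp add: columns_def)
  show "dn d w \<in> UNIV \<times> columns" if "w \<in> columns" for d w
    using that by (cases d; cases w) (auto simp: columns_def)
  show "up D u w \<in> carries \<times> columns" if uc: "u \<in> carries" and wc: "w \<in> columns" for u w
  proof -
    \<comment> \<open>Two digits and a carry bit sum to less than \<open>2 * D\<close>, so carries
      remain bits and the upward pass needs finitely many states.\<close>
    have le: "(y + z + n) div D \<le> 1" if "y < D" "z < D" "n \<le> 1" for y z n
    proof -
      have "(y + z + n) div D < 2" by (rule less_mult_imp_div_less) (use that in simp)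
      then show ?thesis by simp
    qed
    obtain cm h p t where u: "u = (cm, h, p, t)" "p \<le> 1" "t \<le> 1"
      using uc by (auto simp: carries_def)
    obtain W H X P E T where w: "w = Col W H X P E T" "P < D" "E < D" "T < D"
      using wc by (cases w) (auto simp: columns_def)
    show ?thesis
    proof (cases cm)
      case (CMove w' e2 e3 tk iR)
      then show ?thesis using u w D le[of P "if e3 = Lft then D - 1 else 0" p] le[of T 0 t]
        by (auto simp: carries_def columns_def Let_def)
    next
      case CIncE
      then show ?thesis using u w D le[of E 0 p] by (auto simp: carries_def columns_def)
    next
      case CAddPE
      then show ?thesis using u w D le[of P E p] by (auto simp: carries_def columns_def)
    qed (use u w D in \<open>auto simp: carries_def columns_def\<close>)
  qed
  show "b' \<in> {b. base_ok b} \<and> u \<in> carries" if "b \<in> {b. base_ok b}" "act b d a c = SGo b' u k d1 d3"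
    for b d a c b' u k d1 d3
  proof -
    obtain f pz pe tz h where d: "d = (f, pz, pe, tz, h)" by (cases d) auto
    have n: "0 < nstates M" using wf by (simp add: wf_machine_def)
    show ?thesis
    proof (cases b)
      case (Rn blk kk q sI sW)
      let ?yI = "side sI a" and ?yW = "side sW f" and ?yC = "if pz then LE else if pe then RE else Bit (keep c)"
      show ?thesis
      proof (cases "kk = RC \<and> ?yC = RE \<and> \<not> blk")
        case True
        then have "b' = Rn True (Top True m) 0 False False \<and> u = start CReset False"
          using that(2) by (simp add: act_def Rn d Let_def split: if_splits)
        then show ?thesis using n start_carries by auto
      next
        case False
        have ac: "act b d a c = (case \<theta> kk q ?yI ?yW ?yC tz of THalt r \<Rightarrow> SHalt r
         | TDo k' q' w v e1 e2 e3 tk \<Rightarrow>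
             SGo (Rn blk k' q' (turn sI (eff e1 ?yI)) (turn sW (eff e2 ?yW)))
               (start (CMove w (eff e2 ?yW) (eff e3 ?yC) tk (?yW = RE \<and> 0 < e)) (?yW = LE \<and> 0 < e))
               (if pz \<or> pe then keep c else v) (eff e1 ?yI) (eff e3 ?yC))"
          unfolding act_def Rn d prod.case base.case Let_def if_not_P[OF False] ..
        show ?thesis
        proof (cases "\<theta> kk q ?yI ?yW ?yC tz")
          case (THalt r)
          then show ?thesis using that(2) unfolding ac THalt by simp
        next
          case (TDo k' q' w v e1 e2 e3 tk)
          have "ctl_ok k' \<and> q' < nstates M" using \<theta>_ok[OF TDo] that(1) Rn by simp
          then show ?thesis using that(2) start_carries unfolding ac TDo by auto
        qed
      qed
    qed (use that n start_carries in \<open>auto simp: act_def d split: if_splits\<close>)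
  qed
qed simp

end

section \<open>Sizes and probabilities\<close>

definition lg :: "nat \<Rightarrow> nat" where
  "lg n = nat \<lceil>log 2 (real (max 2 n))\<rceil>"

lemma logsp_lg: "logsp k n = k * lg n"
  by (simp add: logsp_def lg_def)

lemma lg_ge_1: "1 \<le> lg n" and le_exp_lg: "max 2 n \<le> 2 ^ lg n" and exp_lg_le: "2 ^ lg n \<le> 2 * max 2 n"
proof -
  let ?N = "real (max 2 n)"
  have N: "2 \<le> ?N" by simp
  have l1: "1 \<le> log 2 ?N" using N by (simp add: le_log_iff)
  then have "1 \<le> \<lceil>log 2 ?N\<rceil>" by linarith
  then show "1 \<le> lg n" unfolding lg_def by linarith
  have r: "real (lg n) = of_int \<lceil>log 2 ?N\<rceil>" using l1 by (simp add: lg_def)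
  have pw: "2 powr log 2 ?N = ?N" using N by (intro powr_log_cancel) auto
  have "?N \<le> 2 powr real (lg n)" using r le_of_int_ceiling[of "log 2 ?N"]
    by (subst pw[symmetric]) (intro powr_mono, auto)
  then have "?N \<le> 2 ^ lg n" by (simp add: powr_realpow)
  then show "max 2 n \<le> 2 ^ lg n" by (metis of_nat_le_iff of_nat_numeral of_nat_power)
  have "2 powr real (lg n) \<le> 2 powr (log 2 ?N + 1)"
    using r ceiling_correct[of "log 2 ?N"] by (intro powr_mono) auto
  also have "\<dots> = 2 * ?N" by (simp add: powr_add pw)
  finally have "2 ^ lg n \<le> 2 * ?N" by (simp add: powr_realpow)
  then have "real (2 ^ lg n) \<le> real (2 * max 2 n)" by simp
  then show "2 ^ lg n \<le> 2 * max 2 n" by (simp only: of_nat_le_iff)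
qed

text \<open>Each factor is at most a power of \<open>2 ^ K\<close>, with exponent \<open>Z\<close>
  for \<open>Z\<close> itself, 1 for \<open>2 ^ (k * lg n)\<close> and 2 for each of the three
  factors with summand 2. The sum \<open>Z + 7\<close> dictates \<open>D\<close>. The product lacks
  the factor \<open>2 ^ c\<close> of \<open>card_legal\<close>: it counts per catalytic tape.
  \<open>max 1 k\<close> keeps \<open>K\<close> positive for \<open>k = 0\<close>.\<close>

lemma size_bounds:
  fixes k n Z :: nat
  defines "K \<equiv> max 1 k * lg n" and "c \<equiv> max 2 n ^ k" and "D \<equiv> 2 ^ (Z + 7) :: nat"
  shows "Suc c < D ^ K" "Z * ((n + 2) * (2 ^ (k * lg n) * ((k * lg n + 2) * (c + 2)))) \<le> D ^ K"
    "n \<le> D ^ K" "K \<le> D ^ K" "D ^ K \<le> max 2 n ^ (2 * (Z + 7) * max 1 k)"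
proof -
  have K: "1 \<le> K" "lg n \<le> K" "k * lg n \<le> K" using lg_ge_1[of n] by (auto simp: K_def)
  have DK: "D ^ K = 2 ^ ((Z + 7) * K)" by (simp add: D_def power_mult)
  have two: "x + 2 \<le> 2 ^ (2 * K)" if "x \<le> 2 ^ K" for x :: nat
  proof -
    have 2: "2 \<le> (2::nat) ^ K" using K(1) power_increasing[of 1 K "2::nat"] by simp
    have "x + 2 \<le> 2 * 2 ^ K" using that 2 by linarith
    also have "\<dots> \<le> 2 ^ K * 2 ^ K" using 2 by (rule mult_le_mono1)
    also have "\<dots> = 2 ^ (2 * K)" by (simp add: mult_2 power_add)
    finally show ?thesis .
  qed
  have lgK: "(2::nat) ^ lg n \<le> 2 ^ K" using K(2) by (intro power_increasing) auto
  have n: "n + 2 \<le> 2 ^ (2 * K)" using le_exp_lg[of n] lgK by (intro two) linarith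
  have "c \<le> (2 ^ lg n) ^ k" unfolding c_def by (intro power_mono le_exp_lg) auto
  also have "\<dots> = 2 ^ (k * lg n)" by (simp add: mult.commute flip: power_mult)
  also have "\<dots> \<le> 2 ^ K" using K(3) by (intro power_increasing) auto
  finally have c: "c + 2 \<le> 2 ^ (2 * K)" by (rule two)
  have l1: "(2::nat) ^ (k * lg n) \<le> 2 ^ K" using K(3) by (intro power_increasing) auto
  have "k * lg n \<le> 2 ^ (k * lg n)" using less_exp[of "k * lg n"] by simp
  then have l2: "k * lg n + 2 \<le> 2 ^ (2 * K)" using l1 by (intro two) linarith
  have "Z \<le> 2 ^ Z" using less_exp[of Z] by simp
  also have "\<dots> \<le> (2::nat) ^ (Z * K)" using K(1) by (intro power_increasing) auto
  finally have Z: "Z \<le> 2 ^ (Z * K)" .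
  have "Z * ((n + 2) * (2 ^ (k * lg n) * ((k * lg n + 2) * (c + 2)))) \<le>
      2 ^ (Z * K) * (2 ^ (2 * K) * (2 ^ K * (2 ^ (2 * K) * 2 ^ (2 * K))))"
    by (intro mult_le_mono Z n l1 l2 c)
  also have "\<dots> = 2 ^ (Z * K + (2 * K + (K + (2 * K + 2 * K))))" by (simp only: power_add)
  also have "Z * K + (2 * K + (K + (2 * K + 2 * K))) = (Z + 7) * K" by (simp add: algebra_simps)
  finally show "Z * ((n + 2) * (2 ^ (k * lg n) * ((k * lg n + 2) * (c + 2)))) \<le> D ^ K" unfolding DK .
  have le: "(2::nat) ^ (2 * K) \<le> D ^ K" unfolding DK by (intro power_increasing mult_le_mono1) auto
  then show "Suc c < D ^ K" "n \<le> D ^ K" using c n by auto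
  have "K < 2 ^ K" by (rule less_exp)
  moreover have "(2::nat) ^ K \<le> 2 ^ (2 * K)" by (intro power_increasing) auto
  ultimately show "K \<le> D ^ K" using le by linarith
  have "D ^ K = (2 ^ lg n) ^ ((Z + 7) * max 1 k)"
    unfolding DK unfolding K_def by (simp add: mult_ac flip: power_mult)
  also have "\<dots> \<le> (2 * max 2 n) ^ ((Z + 7) * max 1 k)" by (intro power_mono exp_lg_le) auto
  also have "\<dots> \<le> (max 2 n ^ 2) ^ ((Z + 7) * max 1 k)"
    by (intro power_mono) (auto simp: power2_eq_square)
  also have "\<dots> = max 2 n ^ (2 * (Z + 7) * max 1 k)" by (simp add: mult_ac flip: power_mult)
  finally show "D ^ K \<le> max 2 n ^ (2 * (Z + 7) * max 1 k)" .
qed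

text \<open>Resolves a circularity: the width of a column is a factor of the running time and also
  determines the exponent that has to bound it. The exponential in \<open>v\<close> wins over the
  polynomial.\<close>

lemma linear_le_exp:
  fixes W X v :: nat
  assumes "W \<le> v" "X \<le> v" "2 \<le> v"
  shows "W * (X + 3 * v) \<le> 2 ^ (3 * v)"
proof -
  have v: "v \<le> 2 ^ v" using less_exp[of v] by simp
  have "W * (X + 3 * v) \<le> v * (4 * v)" using assms by (intro mult_le_mono) auto
  also have "\<dots> \<le> 2 ^ v * (2 ^ 2 * 2 ^ v)" using v by (intro mult_le_mono) auto
  also have "\<dots> = 2 ^ (v + (2 + v))" by (simp add: power_add)
  also have "\<dots> \<le> 2 ^ (3 * v)" using assms(3) by (intro power_increasing) auto
  finally show ?thesis .
qed

text \<open>\<open>Y\<close> is the clock period and also bounds all sizes. One factor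
  \<open>Y\<close> pays for the tour and one for the length of a sweep, whence \<open>2 * V\<close>;
  \<open>h\<close> absorbs the constants.\<close>

lemma time_bound:
  fixes k n c K Y g N h V H :: nat
  assumes "n \<le> Y" "c \<le> Y" "K \<le> Y" "1 \<le> Y" "1 \<le> g" "Y \<le> N ^ V"
    and "(8 * k + 52) * 42 * g \<le> N ^ h" "2 * V + h \<le> H" "1 \<le> N"
  shows "(k * (2 * n + 6) + 2 * (10 * Y + n + c + 10) + 4) * (2 * K + 4) * (3 * g + 4) \<le> N ^ H"
proof -
  have "k * (2 * n + 6) \<le> k * (8 * Y)" using assms(1,4) by (intro mult_le_mono) auto
  then have a: "k * (2 * n + 6) + 2 * (10 * Y + n + c + 10) + 4 \<le> (8 * k + 52) * Y"
    using assms(1,2,4) by (simp add: algebra_simps)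
  have b: "2 * K + 4 \<le> 6 * Y" "3 * g + 4 \<le> 7 * g" using assms by auto
  have "(k * (2 * n + 6) + 2 * (10 * Y + n + c + 10) + 4) * (2 * K + 4) * (3 * g + 4)
      \<le> ((8 * k + 52) * Y) * (6 * Y) * (7 * g)"
    by (intro mult_le_mono a b)
  also have "\<dots> = ((8 * k + 52) * 42 * g) * (Y * Y)" by (simp add: algebra_simps)
  also have "\<dots> \<le> N ^ h * (N ^ V * N ^ V)" using assms by (intro mult_le_mono) auto
  also have "\<dots> = N ^ (2 * V + h)" by (simp add: power_add mult_2)
  also have "\<dots> \<le> N ^ H" using assms by (intro power_increasing) auto
  finally show ?thesis .
qed

lemma card_bool_lists: "finite {\<tau> :: bool list. length \<tau> = n}" "card {\<tau> :: bool list. length \<tau> = n} = 2 ^ n"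
  using finite_lists_length_eq[of "UNIV :: bool set" n] card_lists_length_eq[of "UNIV :: bool set" n]
  by simp_all

text \<open>Cutting a tape into two blocks and a remainder is injective.\<close>

lemma card_two_blocks:
  assumes "F \<subseteq> {\<tau> :: bool list. length \<tau> = c}" "2 * c \<le> N"
  shows "card {\<tau>. length \<tau> = N \<and> take c \<tau> \<in> F \<and> take c (drop c \<tau>) \<in> F} \<le> card F * card F * 2 ^ (N - 2 * c)"
proof -
  let ?f = "\<lambda>\<tau>. (take c \<tau>, take c (drop c \<tau>), drop (2 * c) \<tau>)"
  let ?A = "{\<tau>. length \<tau> = N \<and> take c \<tau> \<in> F \<and> take c (drop c \<tau>) \<in> F}"
  have dec: "\<tau> = take c \<tau> @ take c (drop c \<tau>) @ drop (2 * c) \<tau>" for \<tau> :: "bool list"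
    by (metis append_take_drop_id drop_drop mult_2)
  have "inj_on ?f ?A"
  proof (rule inj_onI)
    fix \<sigma> \<tau> :: "bool list" assume "?f \<sigma> = ?f \<tau>"
    then show "\<sigma> = \<tau>" using dec[of \<sigma>] dec[of \<tau>] by simp
  qed
  moreover have "?f ` ?A \<subseteq> F \<times> F \<times> {\<tau>. length \<tau> = N - 2 * c}" by auto
  moreover have "finite F" using assms(1) card_bool_lists(1) finite_subset by blast
  ultimately have "card ?A \<le> card (F \<times> F \<times> {\<tau> :: bool list. length \<tau> = N - 2 * c})"
    by (intro card_inj_on_le) (auto simp: card_bool_lists)
  then show ?thesis by (simp add: card_cartesian_product card_bool_lists mult.assoc)
qed

text \<open>Disjoint blocks are independent, so both lie in \<open>F\<close> for at most 25/64 of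
  the tapes, which leaves at least 39/64.\<close>

lemma half_successful:
  assumes "F \<subseteq> {\<tau> :: bool list. length \<tau> = c}" "2 * c \<le> N" "8 * card F \<le> 5 * 2 ^ c"
    and "\<And>\<tau>. length \<tau> = N \<Longrightarrow> \<not> (take c \<tau> \<in> F \<and> take c (drop c \<tau>) \<in> F) \<Longrightarrow> \<tau> \<in> S"
    and "S \<subseteq> {\<tau>. length \<tau> = N}"
  shows "2 ^ N \<le> 2 * card S"
proof -
  let ?A = "{\<tau> :: bool list. length \<tau> = N \<and> take c \<tau> \<in> F \<and> take c (drop c \<tau>) \<in> F}"
  have finS: "finite S" using assms(5) card_bool_lists(1) finite_subset by blast
  have finA: "finite ?A" by (rule finite_subset[OF _ card_bool_lists(1)[of N]]) auto
  have "{\<tau>. length \<tau> = N} \<subseteq> S \<union> ?A" using assms(4) by blast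
  then have "card {\<tau> :: bool list. length \<tau> = N} \<le> card (S \<union> ?A)" using finS finA by (intro card_mono) auto
  also have "\<dots> \<le> card S + card ?A" by (rule card_Un_le)
  finally have 1: "2 ^ N \<le> card S + card ?A" by (simp add: card_bool_lists)
  have "64 * card ?A \<le> (8 * card F) * (8 * card F) * 2 ^ (N - 2 * c)"
    using card_two_blocks[OF assms(1,2)] by simp
  also have "\<dots> \<le> (5 * 2 ^ c) * (5 * 2 ^ c) * 2 ^ (N - 2 * c)"
    by (intro mult_le_mono assms(3) order_refl)
  also have "\<dots> = 25 * 2 ^ (c + c + (N - 2 * c))" by (simp add: power_add)
  also have "c + c + (N - 2 * c) = N" using assms(2) by simp
  finally show ?thesis using 1 by linarith
qed

lemma ZP_tau_CL_subset: "ZP_tau_CL \<subseteq> ZP_tau_CLP"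
proof
  fix L assume "L \<in> ZP_tau_CL"
  then obtain k M where dec: "zp_tau_decides M L (logsp k) (polyb k) None"
    by (auto simp: ZP_tau_CL_def ZP_tau_CSPACE_def)
  then have wf: "wf_machine M" by (simp add: zp_tau_decides_def)
  interpret A: catalytic M by unfold_locales (rule wf)
  \<comment> \<open>The constant factors of the count: \<open>Suc A.m\<close> slots,
    \<open>nstates M\<close> states, and 8 for the fraction 1/8 of slow tapes.\<close>
  define Z where "Z = 8 * Suc A.m * nstates M"
  define D :: nat where "D = 2 ^ (Z + 7)"
  have D2: "2 \<le> D" unfolding D_def using power_increasing[of 1 "Z + 7" "2 :: nat"] by simp
  interpret C: clocked M k D by unfold_locales (rule D2)
  define \<kappa> where "\<kappa> = max 1 k"
  define W where "W = (8 * k + 52) * 42"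
  \<comment> \<open>Large enough to dominate the time constant \<open>W\<close>, the first summand
    of \<open>g\<close> and the number of column symbols.\<close>
  define v where "v = W + 4 * (Z + 7) + card C.columns + 2"
  \<comment> \<open>\<open>g\<close> is both the number of bits per column and the factor of the
    final exponent \<open>g * \<kappa>\<close>, so that \<open>K\<close> columns fill the work tape
    exactly. The summand \<open>4 * (Z + 7)\<close> is twice the exponent of the clock period, and
    \<open>3 * v\<close> absorbs the constants of the running time.\<close>
  define g where "g = 4 * (Z + 7) + 3 * v"
  have "card C.columns \<le> g" by (simp add: g_def v_def)
  then have "card C.columns \<le> 2 ^ g" using less_exp[of g] by linarith
  moreover have g1: "1 \<le> g" by (simp add: g_def)
  ultimately obtain M' where wf': "wf_machine M'" and M': "\<And>x K \<tau> n b i cs ct p r.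
      reaches (C.mstep x) n (IA, 0, replicate K C.col0, \<tau>, 0, None) (b, i, cs, ct, p, Some r) \<Longrightarrow>
       \<exists>t\<le>n * (2 * K + 4) * (3 * g + 4).
         res (run M' x (g * K) \<tau> t) = Some r \<and> ctape (run M' x (g * K) \<tau> t) = ct"
    using C.sweep_machine by blast
  have Wg: "W * g \<le> 2 ^ (3 * v)" unfolding g_def by (intro linear_le_exp) (auto simp: v_def)

  define win where "win x = {\<tau>. length \<tau> = polyb k (length x) \<and>
      (\<exists>t. res (run M x (logsp k (length x)) \<tau> t) = Some (Some (x \<in> L)))}" for x
  \<comment> \<open>The bad blocks: the given machine has no answer on them, or their tour outlasts
    the clock.\<close>
  define F where "F x = {\<tau>. length \<tau> = polyb k (length x) \<and>
      \<not> (\<tau> \<in> win x \<and> C.timely x (\<kappa> * lg (length x)) (logsp k (length x)) \<tau>)}" for x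

  have answer: "\<exists>t\<le>polyb (g * \<kappa>) (length x). \<exists>r.
      res (run M' x (logsp (g * \<kappa>) (length x)) \<tau> t) = Some r \<and>
      ctape (run M' x (logsp (g * \<kappa>) (length x)) \<tau> t) = \<tau> \<and> (r = Some (x \<in> L) \<or> r = None) \<and>
      (r = None \<longrightarrow> take (polyb k (length x)) \<tau> \<in> F x \<and>
         take (polyb k (length x)) (drop (polyb k (length x)) \<tau>) \<in> F x)"
    and few: "8 * card (F x) \<le> 5 * 2 ^ polyb k (length x)"
    and room: "2 * polyb k (length x) \<le> polyb (g * \<kappa>) (length x)"
    if len\<tau>: "length \<tau> = polyb (g * \<kappa>) (length x)" for x \<tau>
  proof -
    define n c l K where nd: "n = length x" and cd: "c = polyb k n" and ld: "l = logsp k n"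
      and Kd: "K = \<kappa> * lg n"
    have c: "c = max 2 n ^ k" by (simp add: cd polyb_def)
    have K: "K = max 1 k * lg n" by (simp add: Kd \<kappa>_def)
    have l: "l = k * lg n" by (simp add: ld logsp_lg)
    have l': "l = (if k = 0 then 0 else K)" by (simp add: l K)
    note sz = size_bounds[where k = k and n = n and Z = Z, folded D_def K c l]
    show room': "2 * polyb k (length x) \<le> polyb (g * \<kappa>) (length x)"
    proof -
      have "k + 1 \<le> 2 * \<kappa>" by (auto simp: \<kappa>_def)
      also have "\<dots> \<le> g * \<kappa>" by (intro mult_le_mono1) (simp add: g_def)
      finally have "max 2 n ^ (k + 1) \<le> max 2 n ^ (g * \<kappa>)" by (intro power_increasing) auto
      moreover have "2 * max 2 n ^ k \<le> max 2 n ^ (k + 1)" by simp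
      ultimately show ?thesis unfolding polyb_def nd[symmetric] by linarith
    qed
    \<comment> \<open>The promised run of a tape ends in a root carrying the same tape. By
      uniqueness of paths, an answer at any time is the answer of this root.\<close>
    have root: "\<exists>ps R r. A.path x (init_conf l \<sigma>) ps R \<and> A.todo x R = Halt r \<and> ctape R = \<sigma> \<and>
        (r = Some (x \<in> L) \<or> r = None) \<and> (\<sigma> \<in> win x \<longrightarrow> r = Some (x \<in> L))" if len: "length \<sigma> = c" for \<sigma>
    proof -
      have leg: "A.legal x l c (init_conf l \<sigma>)" using C.legal_init[OF l' sz(1) len] .
      obtain t r where t: "halts_restoring M x l \<sigma> t r" "r = Some (x \<in> L) \<or> r = None"
        using dec len unfolding zp_tau_decides_def cd ld nd by blast
      from A.path_run[OF leg, of t r] t(1) obtain ps R where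
        R: "A.path x (init_conf l \<sigma>) ps R" "ctape R = \<sigma>" "A.todo x R = Halt r"
        by (auto simp: halts_restoring_def run_def)
      have "r = Some (x \<in> L)" if "\<sigma> \<in> win x"
      proof -
        obtain t' where "res (run M x l \<sigma> t') = Some (Some (x \<in> L))"
          using \<open>\<sigma> \<in> win x\<close> by (auto simp: win_def ld nd)
        with A.path_run[OF leg, of t' "Some (x \<in> L)"] obtain ps' R' where
          "A.path x (init_conf l \<sigma>) ps' R'" "A.todo x R' = Halt (Some (x \<in> L))"
          by (auto simp: run_def)
        then show ?thesis using A.path_unique[OF R(1)] R(3) by auto
      qed
      then show ?thesis using R t(2) by blast
    qed
    show "8 * card (F x) \<le> 5 * 2 ^ polyb k (length x)"
    proof -
      define slow where "slow = {\<sigma>. length \<sigma> = c \<and> \<not> C.timely x K l \<sigma>}"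
      let ?U = "{\<sigma> :: bool list. length \<sigma> = c}"
      \<comment> \<open>A slow tape meets no stop at the first \<open>D ^ K\<close> positions, so
        \<open>long_tours\<close> applies with \<open>T = D ^ K\<close>.\<close>
      have "card slow * Suc (D ^ K) \<le> card {C. A.legal x l c C} * Suc A.m"
      proof (rule A.long_tours[where I = "init_conf l"])
        show "A.legal x l c (init_conf l \<sigma>) \<and> (\<exists>ps R. A.path x (init_conf l \<sigma>) ps R \<and> ctape R = \<sigma>)"
          if "\<sigma> \<in> slow" for \<sigma>
          using that root[of \<sigma>] C.legal_init[OF l' sz(1), of \<sigma>] unfolding slow_def by blast
        show "\<not> A.stops x ((A.tour x ^^ i) (init_conf l \<sigma>, A.m))" if "\<sigma> \<in> slow" "i < D ^ K" for \<sigma> i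
          using that C.timely_def[OF l' sz(1)] unfolding slow_def by blast
      qed
      also have "\<dots> \<le> nstates M * ((n + 2) * (2 ^ l * ((l + 2) * (2 ^ c * (c + 2))))) * Suc A.m"
        unfolding nd by (intro mult_le_mono1 A.card_legal)
      finally have "8 * (card slow * Suc (D ^ K)) \<le> 8 * (nstates M * ((n + 2) * (2 ^ l * ((l + 2) * (2 ^ c * (c + 2))))) * Suc A.m)"
        by simp
      also have "\<dots> = Z * ((n + 2) * (2 ^ l * ((l + 2) * (c + 2)))) * 2 ^ c"
        by (simp add: Z_def algebra_simps)
      also have "\<dots> \<le> D ^ K * 2 ^ c" using sz(2) by (rule mult_le_mono1)
      also have "\<dots> \<le> 2 ^ c * Suc (D ^ K)" by simp
      finally have "(8 * card slow) * Suc (D ^ K) \<le> 2 ^ c * Suc (D ^ K)" by (simp only: mult.assoc)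
      then have slow: "8 * card slow \<le> 2 ^ c" by (simp only: mult_le_cancel2)
      have win: "2 ^ c \<le> 2 * card (win x)" "win x \<subseteq> ?U"
        using dec unfolding zp_tau_decides_def win_def cd nd by auto
      have fin: "finite (win x)" using win(2) card_bool_lists(1) finite_subset by blast
      have "F x \<subseteq> (?U - win x) \<union> slow" by (auto simp: F_def slow_def cd nd ld Kd)
      moreover have "finite slow" by (rule finite_subset[OF _ card_bool_lists(1)[of c]]) (auto simp: slow_def)
      ultimately have "card (F x) \<le> card ((?U - win x) \<union> slow)"
        by (intro card_mono) (auto simp: card_bool_lists)
      also have "\<dots> \<le> card (?U - win x) + card slow" by (rule card_Un_le)
      also have "card (?U - win x) = 2 ^ c - card (win x)"
        using fin win(2) by (simp add: card_Diff_subset card_bool_lists)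
      \<comment> \<open>At most 4/8 of the blocks lack an answer and at most 1/8 are slow.\<close>
      finally have "8 * card (F x) \<le> 5 * 2 ^ c" using slow win(1) by simp
      then show ?thesis by (simp add: cd nd)
    qed
    define \<tau>1 \<tau>2 \<rho> where "\<tau>1 = take c \<tau>" and "\<tau>2 = take c (drop c \<tau>)" and "\<rho> = drop (2 * c) \<tau>"
    have \<tau>: "\<tau> = \<tau>1 @ \<tau>2 @ \<rho>"
      unfolding \<tau>1_def \<tau>2_def \<rho>_def by (metis append_take_drop_id drop_drop mult_2)
    have "2 * c \<le> length \<tau>" using room' len\<tau> by (simp add: cd nd)
    then have len: "length \<tau>1 = c" "length \<tau>2 = c" by (auto simp: \<tau>1_def \<tau>2_def)
    obtain ps1 R1 r1 where 1: "A.path x (init_conf l \<tau>1) ps1 R1" "A.todo x R1 = Halt r1" "ctape R1 = \<tau>1"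
      "r1 = Some (x \<in> L) \<or> r1 = None" "\<tau>1 \<in> win x \<longrightarrow> r1 = Some (x \<in> L)" using root[OF len(1)] by blast
    obtain ps2 R2 r2 where 2: "A.path x (init_conf l \<tau>2) ps2 R2" "A.todo x R2 = Halt r2" "ctape R2 = \<tau>2"
      "r2 = Some (x \<in> L) \<or> r2 = None" "\<tau>2 \<in> win x \<longrightarrow> r2 = Some (x \<in> L)" using root[OF len(2)] by blast
    from C.run_both_blocks[OF l' sz(1) c[unfolded nd] len 1(1-3) 2(1-3), of \<rho>, folded \<tau>]
    obtain r b i cs p where r: "reaches (C.mstep x) (k * (2 * length x + 6) + 2 * A.clock_bound x (D ^ K) c + 4)
        (IA, 0, replicate K C.col0, \<tau>, 0, None) (b, i, cs, \<tau>, p, Some r)"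
      "r = None \<or> r = r1 \<or> r = r2"
      "r = None \<longrightarrow> (r1 = None \<or> \<not> C.timely x K l \<tau>1) \<and> (r2 = None \<or> \<not> C.timely x K l \<tau>2)"
      by blast
    from M'[OF r(1)] obtain t where
      t: "t \<le> (k * (2 * length x + 6) + 2 * A.clock_bound x (D ^ K) c + 4) * (2 * K + 4) * (3 * g + 4)"
      "res (run M' x (g * K) \<tau> t) = Some r" "ctape (run M' x (g * K) \<tau> t) = \<tau>" by blast
    have "(k * (2 * n + 6) + 2 * (10 * D ^ K + n + c + 10) + 4) * (2 * K + 4) * (3 * g + 4) \<le> max 2 n ^ (g * \<kappa>)"
    proof (rule time_bound[where V = "2 * (Z + 7) * \<kappa>" and h = "3 * v * \<kappa>"])
      show "n \<le> D ^ K" "K \<le> D ^ K" "c \<le> D ^ K" using sz(1,3,4) by auto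
      show "1 \<le> D ^ K" using D2 by simp
      show "D ^ K \<le> max 2 n ^ (2 * (Z + 7) * \<kappa>)" using sz(5) by (simp add: \<kappa>_def)
      have "(2::nat) ^ (3 * v) \<le> 2 ^ (3 * v * \<kappa>)" by (intro power_increasing) (auto simp: \<kappa>_def)
      also have "\<dots> \<le> max 2 n ^ (3 * v * \<kappa>)" by (intro power_mono) auto
      finally show "(8 * k + 52) * 42 * g \<le> max 2 n ^ (3 * v * \<kappa>)" using Wg by (simp add: W_def)
      show "2 * (2 * (Z + 7) * \<kappa>) + 3 * v * \<kappa> \<le> g * \<kappa>" by (simp add: g_def algebra_simps)
    qed (use g1 in auto)
    then have tb: "t \<le> polyb (g * \<kappa>) (length x)"
      using t(1) by (simp add: A.clock_bound_def polyb_def nd)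
    have sp: "logsp (g * \<kappa>) (length x) = g * K" by (simp add: logsp_lg Kd nd)
    have "r = Some (x \<in> L) \<or> r = None" using r(2) 1(4) 2(4) by auto
    moreover have "\<tau>1 \<in> F x \<and> \<tau>2 \<in> F x" if "r = None"
      using r(3) that 1(5) 2(5) len unfolding F_def by (auto simp: cd nd ld Kd)
    ultimately show "\<exists>t\<le>polyb (g * \<kappa>) (length x). \<exists>r.
      res (run M' x (logsp (g * \<kappa>) (length x)) \<tau> t) = Some r \<and>
      ctape (run M' x (logsp (g * \<kappa>) (length x)) \<tau> t) = \<tau> \<and> (r = Some (x \<in> L) \<or> r = None) \<and>
      (r = None \<longrightarrow> take (polyb k (length x)) \<tau> \<in> F x \<and>
         take (polyb k (length x)) (drop (polyb k (length x)) \<tau>) \<in> F x)"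
      using t(2,3) tb unfolding sp \<tau>1_def \<tau>2_def cd nd by blast
  qed

  have "zp_tau_decides M' L (logsp (g * \<kappa>)) (polyb (g * \<kappa>)) (Some (polyb (g * \<kappa>)))"
    unfolding zp_tau_decides_def halts_restoring_def option.case
  proof (intro conjI allI impI wf')
    fix x \<tau> :: "bool list" assume "length \<tau> = polyb (g * \<kappa>) (length x)"
    from answer[OF this] show "\<exists>t r. (res (run M' x (logsp (g * \<kappa>) (length x)) \<tau> t) = Some r \<and>
        ctape (run M' x (logsp (g * \<kappa>) (length x)) \<tau> t) = \<tau>) \<and> (r = Some (x \<in> L) \<or> r = None) \<and>
        t \<le> polyb (g * \<kappa>) (length x)" by blast
  next
    fix x :: "bool list"
    \<comment> \<open>\<open>few\<close> and \<open>room\<close> were proved under the assumption of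
      a tape of this length; any such tape discharges it.\<close>
    have ex: "length (replicate (polyb (g * \<kappa>) (length x)) False) = polyb (g * \<kappa>) (length x)" by simp
    show "2 ^ polyb (g * \<kappa>) (length x) \<le> 2 * card {\<tau>. length \<tau> = polyb (g * \<kappa>) (length x) \<and>
        (\<exists>t. res (run M' x (logsp (g * \<kappa>) (length x)) \<tau> t) = Some (Some (x \<in> L)))}"
    proof (rule half_successful[OF _ room[OF ex] few[OF ex]])
      fix \<tau> :: "bool list"
      assume *: "length \<tau> = polyb (g * \<kappa>) (length x)"
        "\<not> (take (polyb k (length x)) \<tau> \<in> F x \<and> take (polyb k (length x)) (drop (polyb k (length x)) \<tau>) \<in> F x)"
      from answer[OF *(1)] *(2) show "\<tau> \<in> {\<tau>. length \<tau> = polyb (g * \<kappa>) (length x) \<and>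
        (\<exists>t. res (run M' x (logsp (g * \<kappa>) (length x)) \<tau> t) = Some (Some (x \<in> L)))}"
        using *(1) by auto
    qed (auto simp: F_def)
  qed
  then show "L \<in> ZP_tau_CLP" by (auto simp: ZP_tau_CLP_def)
qed

lemma ZP_tau_CLP_subset: "ZP_tau_CLP \<subseteq> ZP_tau_CL"
proof
  fix L assume "L \<in> ZP_tau_CLP"
  then obtain k M where "zp_tau_decides M L (logsp k) (polyb k) (Some (polyb k))"
    by (auto simp: ZP_tau_CLP_def)
  then have "zp_tau_decides M L (logsp k) (polyb k) None"
    unfolding zp_tau_decides_def option.case by blast
  then show "L \<in> ZP_tau_CL" by (auto simp: ZP_tau_CL_def ZP_tau_CSPACE_def)
qed

theorem theorem6p6:
  shows "ZP_tau_CL = ZP_tau_CLP"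
  using ZP_tau_CL_subset ZP_tau_CLP_subset by blast

end
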